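(* Under the regularity conditions (i)–(iii) below, $\hat{\boldsymbol{\tau}}$ has smaller (PSD order) asymptotic sampling covariance under $\text{ReFMT}_\text{F}$ (thresholds $a_1,\dots,a_H>0$) than under the CRFE, and the reduction in the asymptotic covariance of $\sqrt n(\hat{\boldsymbol{\tau}}-\boldsymbol{\tau})$ is $\lim_{n\to\infty}n\sum_{h=1}^H(1-v_{LF_h,a_h})\boldsymbol{W}^{\parallel}_{\tau\tau}[h]$. In particular, for each $1\le f\le F$, the percentage reduction in asymptotic sampling variance of $\hat\tau_f$ is $\lim_{n\to\infty}\sum_{h=1}^H(1-v_{LF_h,a_h})\rho^2_f[h]$.
   Context: Setup ($2^K$ factorial experiment, finite population). $K\ge1$ two-level factors, $Q=2^K$ treatment combinations $q=1,\dots,Q$; combination $q$ sets factor $k$ at $\iota_k(q)\in\{-1,+1\}$, bijectively onto $\{-1,+1\}^K$. $F=Q-1$ factorial effects, one per nonempty $A\subseteq\{1,\dots,K\}$, enumerated $f=1,\dots,F$, with $g_{fq}=\prod_{k\in A}\iota_k(q)$; $\boldsymbol{b}_q=(g_{1q},\dots,g_{Fq})'$. Units $i=1,\dots,n$ have fixed potential outcomes $Y_i(q)$ and covariates $\boldsymbol{x}_i\in\mathbb{R}^L$; $\bar Y(q),\bar{\boldsymbol{x}}$ means; $\boldsymbol{\tau}_i=2^{-(K-1)}\sum_q\boldsymbol{b}_qY_i(q)$, $\boldsymbol{\tau}=2^{-(K-1)}\sum_q\boldsymbol{b}_q\bar Y(q)$. Finite-population (co)variances with divisor $n-1$: $S_{qk}$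 between $Y(q),Y(k)$; $\boldsymbol{S}_{\tau\tau}$ of $\boldsymbol{\tau}_i$; $\boldsymbol{S}_{xx}$ of $\boldsymbol{x}$; $\boldsymbol{S}_{q,x}$ between $Y(q),\boldsymbol{x}$. $\boldsymbol{V}_{\tau\tau}=2^{-2(K-1)}\sum_qn_q^{-1}\boldsymbol{b}_q\boldsymbol{b}_q'S_{qq}-n^{-1}\boldsymbol{S}_{\tau\tau}$, with diagonal entries $V_{\tau_f\tau_f}$. CRFE: fixed $n_q\ge1$, $\sum n_q=n$; $\boldsymbol{Z}$ uniform over assignments with $n_q$ units in combination $q$; $\hat{\bar Y}(q),\hat{\bar{\boldsymbol{x}}}(q)$ group-$q$ means of observed outcomes $Y_i(Z_i)$ and covariates; $\hat{\boldsymbol{\tau}}=(\hat\tau_1,\dots,\hat\tau_F)'=2^{-(K-1)}\sum_q\boldsymbol{b}_q\hat{\bar Y}(q)$. Tiers: partition $\{1,\dots,F\}$ into disjoint nonempty $\mathcal{F}_1,\dots,\mathcal{F}_H$, $F_h=|\mathcal{F}_h|$, $\mathcal{F}_{\overline h}=\bigcup_{l\le h}\mathcal{F}_l$. $\tilde{\boldsymbol{B}}=2^{-2(K-1)}\sum_qn_q^{-1}\boldsymbol{b}_q\boldsymbol{b}_q'$, with subvector/submatrix notation $\boldsymbol{b}_q[\mathcal{I}]$, $\tilde{\boldsymbol{B}}[\mathcal{I},\mathcal{J}]$. $\boldsymbol{c}_q[1]=\boldsymbol{b}_q[\mathcal{F}_1]$, and for $h\ge2$, $\boldsymbol{c}_q[h]=\boldsymbol{b}_q[\mathcal{F}_h]-\tilde{\boldsymbol{B}}[\mathcal{F}_h,\mathcal{F}_{\overline{h-1}}]\{\tilde{\boldsymbol{B}}[\mathcal{F}_{\overline{h-1}},\mathcal{F}_{\overline{h-1}}]\}^{-1}\boldsymbol{b}_q[\mathcal{F}_{\overline{h-1}}]$.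 $\hat{\boldsymbol{\theta}}_x[h]=2^{-(K-1)}\sum_q\boldsymbol{c}_q[h]\otimes\hat{\bar{\boldsymbol{x}}}(q)$, $\boldsymbol{W}_{\tau x}[h]=2^{-2(K-1)}\sum_qn_q^{-1}(\boldsymbol{b}_q\boldsymbol{c}_q[h]')\otimes\boldsymbol{S}_{q,x}$, $\boldsymbol{W}_{xx}[h]=2^{-2(K-1)}\sum_qn_q^{-1}(\boldsymbol{c}_q[h]\boldsymbol{c}_q[h]')\otimes\boldsymbol{S}_{xx}$, $\boldsymbol{W}^{\parallel}_{\tau\tau}[h]=\boldsymbol{W}_{\tau x}[h]\boldsymbol{W}_{xx}[h]^{-1}\boldsymbol{W}_{\tau x}[h]'$, with $f$th diagonal entry $W^{\parallel}_{\tau_f\tau_f}[h]$, and $\rho^2_f[h]=W^{\parallel}_{\tau_f\tau_f}[h]/V_{\tau_f\tau_f}$. $M_h=\hat{\boldsymbol{\theta}}_x[h]'\boldsymbol{W}_{xx}[h]^{-1}\hat{\boldsymbol{\theta}}_x[h]$; $\text{ReFMT}_\text{F}$ accepts an assignment iff $M_h\le a_h$ for all $h$; its distribution is the CRFE distribution conditional on acceptance. $v_{m,a}=P(\chi^2_{m+2}\le a)/P(\chi^2_m\le a)$. Asymptotic covariance = covariance of the weak limit of $\sqrt n(\hat{\boldsymbol{\tau}}-\boldsymbol{\tau})$; percentage reduction in asymptotic sampling variance of $\hat\tau_f$ = $1-$(asymptotic variance under $\text{ReFMT}_\text{F}$)/(asymptotic variance under CRFE). Regularity conditions, as $n\to\infty$,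 for all $q\ne k$: (i) $n_q/n$ has a positive limit; (ii) $S_{qq},S_{qk},\boldsymbol{S}_{xx},\boldsymbol{S}_{q,x}$ have limits, $\boldsymbol{S}_{xx}$ and its limit nonsingular; (iii) $\max_i|Y_i(q)-\bar Y(q)|^2/n\to0$, $\max_i\|\boldsymbol{x}_i-\bar{\boldsymbol{x}}\|_2^2/n\to0$. *)

theory Defs
  imports "HOL-Probability.Probability"
begin

definition chi2_density :: "nat \<Rightarrow> real \<Rightarrow> real" where
  "chi2_density k x =
     (if x > 0 then x powr (real k / 2 - 1) * exp (- x / 2) / (2 powr (real k / 2) * Gamma (real k / 2))
      else 0)"

definition chi2_cdf :: "nat \<Rightarrow> real \<Rightarrow> real" where
  "chi2_cdf k a = (LINT x:{0<..a}|lborel. chi2_density k x)"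

definition v_const :: "nat \<Rightarrow> real \<Rightarrow> real" where
  "v_const m a = chi2_cdf (m + 2) a / chi2_cdf m a"

text \<open>Inverse of a square matrix indexed by the finite set I (meaningful when it is nonsingular).\<close>
definition mat_inv_on :: "'i set \<Rightarrow> ('i \<Rightarrow> 'i \<Rightarrow> real) \<Rightarrow> 'i \<Rightarrow> 'i \<Rightarrow> real" where
  "mat_inv_on I M = (SOME N. \<forall>i\<in>I. \<forall>j\<in>I. (\<Sum>k\<in>I. M i k * N k j) = (if i = j then 1 else 0))"

definition psd_on :: "'i set \<Rightarrow> ('i \<Rightarrow> 'i \<Rightarrow> real) \<Rightarrow> bool" where
  "psd_on I M \<longleftrightarrow> (\<forall>u. (\<Sum>i\<in>I. \<Sum>j\<in>I. u i * M i j * u j) \<ge> 0)"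

text \<open>Factors are the elements of the finite type 'k (K = CARD('k)); a treatment combination
  q is the set of factors set at level +1; factorial effects are the nonempty sets A of factors.\<close>

definition iota :: "'k \<Rightarrow> 'k set \<Rightarrow> real" where
  "iota k q = (if k \<in> q then 1 else -1)"

definition gval :: "'k set \<Rightarrow> 'k set \<Rightarrow> real" where
  "gval A q = (\<Prod>k\<in>A. iota k q)"

definition effects :: "'k set set" where
  "effects = {A. A \<noteq> {}}"

definition cK :: "'k::finite itself \<Rightarrow> real" where
  "cK _ = inverse (2 ^ (CARD('k) - 1))"

definition pmean :: "nat \<Rightarrow> (nat \<Rightarrow> real) \<Rightarrow> real" where
  "pmean n u = (\<Sum>i<n. u i) / real n"

definition pcov :: "nat \<Rightarrow> (nat \<Rightarrow> real) \<Rightarrow> (nat \<Rightarrow> real) \<Rightarrow> real" where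
  "pcov n u v = (\<Sum>i<n. (u i - pmean n u) * (v i - pmean n v)) / (real n - 1)"

definition S_Y :: "nat \<Rightarrow> (nat \<Rightarrow> 'k set \<Rightarrow> real) \<Rightarrow> 'k set \<Rightarrow> 'k set \<Rightarrow> real" where
  "S_Y n Y q k = pcov n (\<lambda>i. Y i q) (\<lambda>i. Y i k)"

definition S_xx :: "nat \<Rightarrow> (nat \<Rightarrow> 'l \<Rightarrow> real) \<Rightarrow> 'l \<Rightarrow> 'l \<Rightarrow> real" where
  "S_xx n x l l' = pcov n (\<lambda>i. x i l) (\<lambda>i. x i l')"

definition S_qx :: "nat \<Rightarrow> (nat \<Rightarrow> 'k set \<Rightarrow> real) \<Rightarrow> (nat \<Rightarrow> 'l \<Rightarrow> real) \<Rightarrow> 'k set \<Rightarrow> 'l \<Rightarrow> real" where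
  "S_qx n Y x q l = pcov n (\<lambda>i. Y i q) (\<lambda>i. x i l)"

definition tau_unit :: "(nat \<Rightarrow> 'k::finite set \<Rightarrow> real) \<Rightarrow> nat \<Rightarrow> 'k set \<Rightarrow> real" where
  "tau_unit Y i A = cK TYPE('k) * (\<Sum>q\<in>UNIV. gval A q * Y i q)"

definition tau_pop :: "nat \<Rightarrow> (nat \<Rightarrow> 'k::finite set \<Rightarrow> real) \<Rightarrow> 'k set \<Rightarrow> real" where
  "tau_pop n Y A = cK TYPE('k) * (\<Sum>q\<in>UNIV. gval A q * pmean n (\<lambda>i. Y i q))"

definition S_tautau :: "nat \<Rightarrow> (nat \<Rightarrow> 'k::finite set \<Rightarrow> real) \<Rightarrow> 'k set \<Rightarrow> 'k set \<Rightarrow> real" where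
  "S_tautau n Y A B = pcov n (\<lambda>i. tau_unit Y i A) (\<lambda>i. tau_unit Y i B)"

definition V_tautau :: "nat \<Rightarrow> ('k::finite set \<Rightarrow> nat) \<Rightarrow> (nat \<Rightarrow> 'k set \<Rightarrow> real) \<Rightarrow> 'k set \<Rightarrow> 'k set \<Rightarrow> real" where
  "V_tautau n nq Y A B =
     (cK TYPE('k))\<^sup>2 * (\<Sum>q\<in>UNIV. gval A q * gval B q * S_Y n Y q q / real (nq q))
     - S_tautau n Y A B / real n"

definition Btil :: "('k::finite set \<Rightarrow> nat) \<Rightarrow> 'k set \<Rightarrow> 'k set \<Rightarrow> real" where
  "Btil nq A B = (cK TYPE('k))\<^sup>2 * (\<Sum>q\<in>UNIV. gval A q * gval B q / real (nq q))"

definition tiers_upto :: "(nat \<Rightarrow> 'k set set) \<Rightarrow> nat \<Rightarrow> 'k set set" where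
  "tiers_upto T h = (\<Union>l\<in>{1..h}. T l)"

text \<open>c_q[h], a vector indexed by the effects in tier T h.\<close>
definition cvec :: "('k::finite set \<Rightarrow> nat) \<Rightarrow> (nat \<Rightarrow> 'k set set) \<Rightarrow> nat \<Rightarrow> 'k set \<Rightarrow> 'k set \<Rightarrow> real" where
  "cvec nq T h q A =
     (if h = 1 then gval A q
      else gval A q -
        (\<Sum>B\<in>tiers_upto T (h - 1). \<Sum>C\<in>tiers_upto T (h - 1).
            Btil nq A B * mat_inv_on (tiers_upto T (h - 1)) (Btil nq) B C * gval C q))"

text \<open>Index set of the Kronecker products c_q[h] (x) (.) : pairs (effect in T h, covariate).\<close>
definition kidx :: "(nat \<Rightarrow> 'k set set) \<Rightarrow> nat \<Rightarrow> ('k set \<times> 'l) set" where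
  "kidx T h = T h \<times> UNIV"

definition W_taux :: "nat \<Rightarrow> ('k::finite set \<Rightarrow> nat) \<Rightarrow> (nat \<Rightarrow> 'k set set) \<Rightarrow> (nat \<Rightarrow> 'k set \<Rightarrow> real)
     \<Rightarrow> (nat \<Rightarrow> 'l \<Rightarrow> real) \<Rightarrow> nat \<Rightarrow> 'k set \<Rightarrow> 'k set \<times> 'l \<Rightarrow> real" where
  "W_taux n nq T Y x h B = (\<lambda>(A, l).
     (cK TYPE('k))\<^sup>2 * (\<Sum>q\<in>UNIV. gval B q * cvec nq T h q A * S_qx n Y x q l / real (nq q)))"

definition W_xx :: "nat \<Rightarrow> ('k::finite set \<Rightarrow> nat) \<Rightarrow> (nat \<Rightarrow> 'k set set)
     \<Rightarrow> (nat \<Rightarrow> 'l \<Rightarrow> real) \<Rightarrow> nat \<Rightarrow> 'k set \<times> 'l \<Rightarrow> 'k set \<times> 'l \<Rightarrow> real" where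
  "W_xx n nq T x h = (\<lambda>(A, l) (A', l').
     (cK TYPE('k))\<^sup>2 * (\<Sum>q\<in>UNIV. cvec nq T h q A * cvec nq T h q A' * S_xx n x l l' / real (nq q)))"

definition W_par :: "nat \<Rightarrow> ('k::finite set \<Rightarrow> nat) \<Rightarrow> (nat \<Rightarrow> 'k set set) \<Rightarrow> (nat \<Rightarrow> 'k set \<Rightarrow> real)
     \<Rightarrow> (nat \<Rightarrow> 'l::finite \<Rightarrow> real) \<Rightarrow> nat \<Rightarrow> 'k set \<Rightarrow> 'k set \<Rightarrow> real" where
  "W_par n nq T Y x h B B' =
     (\<Sum>i\<in>kidx T h. \<Sum>j\<in>kidx T h.
        W_taux n nq T Y x h B i * mat_inv_on (kidx T h) (W_xx n nq T x h) i j * W_taux n nq T Y x h B' j)"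

definition rho2 :: "nat \<Rightarrow> ('k::finite set \<Rightarrow> nat) \<Rightarrow> (nat \<Rightarrow> 'k set set) \<Rightarrow> (nat \<Rightarrow> 'k set \<Rightarrow> real)
     \<Rightarrow> (nat \<Rightarrow> 'l::finite \<Rightarrow> real) \<Rightarrow> nat \<Rightarrow> 'k set \<Rightarrow> real" where
  "rho2 n nq T Y x h f = W_par n nq T Y x h f f / V_tautau n nq Y f f"

definition assignments :: "nat \<Rightarrow> ('k set \<Rightarrow> nat) \<Rightarrow> (nat \<Rightarrow> 'k set) set" where
  "assignments n nq = {Z \<in> {..<n} \<rightarrow>\<^sub>E UNIV. \<forall>q. card {i\<in>{..<n}. Z i = q} = nq q}"

definition Yhat :: "nat \<Rightarrow> ('k set \<Rightarrow> nat) \<Rightarrow> (nat \<Rightarrow> 'k set \<Rightarrow> real) \<Rightarrow> (nat \<Rightarrow> 'k set) \<Rightarrow> 'k set \<Rightarrow> real" where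
  "Yhat n nq Y Z q = (\<Sum>i\<in>{i\<in>{..<n}. Z i = q}. Y i q) / real (nq q)"

definition xhat :: "nat \<Rightarrow> ('k set \<Rightarrow> nat) \<Rightarrow> (nat \<Rightarrow> 'l \<Rightarrow> real) \<Rightarrow> (nat \<Rightarrow> 'k set) \<Rightarrow> 'k set \<Rightarrow> 'l \<Rightarrow> real" where
  "xhat n nq x Z q l = (\<Sum>i\<in>{i\<in>{..<n}. Z i = q}. x i l) / real (nq q)"

definition tau_hat :: "nat \<Rightarrow> ('k::finite set \<Rightarrow> nat) \<Rightarrow> (nat \<Rightarrow> 'k set \<Rightarrow> real) \<Rightarrow> (nat \<Rightarrow> 'k set) \<Rightarrow> 'k set \<Rightarrow> real" where
  "tau_hat n nq Y Z A = cK TYPE('k) * (\<Sum>q\<in>UNIV. gval A q * Yhat n nq Y Z q)"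

definition theta_x :: "nat \<Rightarrow> ('k::finite set \<Rightarrow> nat) \<Rightarrow> (nat \<Rightarrow> 'k set set) \<Rightarrow> (nat \<Rightarrow> 'l \<Rightarrow> real)
     \<Rightarrow> (nat \<Rightarrow> 'k set) \<Rightarrow> nat \<Rightarrow> 'k set \<times> 'l \<Rightarrow> real" where
  "theta_x n nq T x Z h = (\<lambda>(A, l). cK TYPE('k) * (\<Sum>q\<in>UNIV. cvec nq T h q A * xhat n nq x Z q l))"

definition M_stat :: "nat \<Rightarrow> ('k::finite set \<Rightarrow> nat) \<Rightarrow> (nat \<Rightarrow> 'k set set) \<Rightarrow> (nat \<Rightarrow> 'l::finite \<Rightarrow> real)
     \<Rightarrow> (nat \<Rightarrow> 'k set) \<Rightarrow> nat \<Rightarrow> real" where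
  "M_stat n nq T x Z h =
     (\<Sum>i\<in>kidx T h. \<Sum>j\<in>kidx T h.
        theta_x n nq T x Z h i * mat_inv_on (kidx T h) (W_xx n nq T x h) i j * theta_x n nq T x Z h j)"

definition accepted :: "nat \<Rightarrow> ('k::finite set \<Rightarrow> nat) \<Rightarrow> nat \<Rightarrow> (nat \<Rightarrow> 'k set set) \<Rightarrow> (nat \<Rightarrow> real)
     \<Rightarrow> (nat \<Rightarrow> 'l::finite \<Rightarrow> real) \<Rightarrow> (nat \<Rightarrow> 'k set) \<Rightarrow> bool" where
  "accepted n nq H T a x Z \<longleftrightarrow> (\<forall>h\<in>{1..H}. M_stat n nq T x Z h \<le> a h)"

definition CRFE :: "nat \<Rightarrow> ('k set \<Rightarrow> nat) \<Rightarrow> (nat \<Rightarrow> 'k set) pmf" where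
  "CRFE n nq = pmf_of_set (assignments n nq)"

definition ReFMT :: "nat \<Rightarrow> ('k::finite set \<Rightarrow> nat) \<Rightarrow> nat \<Rightarrow> (nat \<Rightarrow> 'k set set) \<Rightarrow> (nat \<Rightarrow> real)
     \<Rightarrow> (nat \<Rightarrow> 'l::finite \<Rightarrow> real) \<Rightarrow> (nat \<Rightarrow> 'k set) pmf" where
  "ReFMT n nq H T a x = pmf_of_set {Z \<in> assignments n nq. accepted n nq H T a x Z}"

text \<open>sqrt n (tau_hat - tau), as a vector indexed by 'k set (the coordinate of the empty set,
  which is not a factorial effect, is set to 0).\<close>
definition scaled_err :: "nat \<Rightarrow> ('k::finite set \<Rightarrow> nat) \<Rightarrow> (nat \<Rightarrow> 'k set \<Rightarrow> real) \<Rightarrow> (nat \<Rightarrow> 'k set) \<Rightarrow> 'k set \<Rightarrow> real" where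
  "scaled_err n nq Y Z A = (if A \<in> effects then sqrt (real n) * (tau_hat n nq Y Z A - tau_pop n Y A) else 0)"

definition weak_conv_to :: "(nat \<Rightarrow> 'a::topological_space pmf) \<Rightarrow> 'a measure \<Rightarrow> bool" where
  "weak_conv_to P \<mu> \<longleftrightarrow>
     (\<forall>g :: 'a \<Rightarrow> real. continuous_on UNIV g \<and> bounded (range g) \<longrightarrow>
        (\<lambda>n. measure_pmf.expectation (P n) g) \<longlonglongrightarrow> integral\<^sup>L \<mu> g)"

definition cov_meas :: "('a \<Rightarrow> real) measure \<Rightarrow> 'a \<Rightarrow> 'a \<Rightarrow> real" where
  "cov_meas \<mu> A B = (\<integral>v. v A * v B \<partial>\<mu>) - (\<integral>v. v A \<partial>\<mu>) * (\<integral>v. v B \<partial>\<mu>)"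

end

theory Submission
  imports Defs "HOL-Real_Asymp.Real_Asymp"
begin

text \<open>
  A linear statistic \<open>\<Sum>i. b i (Z i)\<close> of a completely randomized assignment satisfies a central limit theorem by
  Stein's exchangeable pair: exchanging the treatments of two units leaves the law of \<open>Z\<close> unchanged, which turns
  \<open>s \<mapsto> E cos (s T + c)\<close> into an approximate solution of \<open>f' = - s \<sigma>\<^sup>2 f\<close>. Applied to all linear combinations of the
  scaled group means this gives a joint Gaussian limit of the effect estimators and the covariate contrasts.
  The vectors \<open>c\<^sub>q[h]\<close> are a Gram--Schmidt orthogonalization of the contrasts across tiers, so in the limit the
  \<open>M\<^sub>h\<close> are squared norms of independent standard Gaussian blocks, and the estimators are linear in these blocks plus an
  independent residual. Conditioning on \<open>M\<^sub>h \<le> a\<^sub>h\<close> keeps the blocks uncorrelated and scales the covariance of the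
  \<open>h\<close>-th one by \<open>v\<close>, because the density of the squared norm of a standard Gaussian block satisfies
  \<open>r * f\<^sub>m r = m * f\<^sub>m\<^sub>+\<^sub>2 r\<close>.
\<close>

section \<open>Matrices on finite index sets\<close>

definition nonsing_on :: "'i set \<Rightarrow> ('i \<Rightarrow> 'i \<Rightarrow> real) \<Rightarrow> bool" where
  "nonsing_on I M \<longleftrightarrow> (\<forall>u. (\<forall>i\<in>I. (\<Sum>j\<in>I. M i j * u j) = 0) \<longrightarrow> (\<forall>j\<in>I. u j = 0))"

definition ext_mat :: "'i::finite set \<Rightarrow> ('i \<Rightarrow> 'i \<Rightarrow> real) \<Rightarrow> real^'i^'i" where
  "ext_mat I M = (\<chi> i j. if i \<in> I \<and> j \<in> I then M i j else if i = j then 1 else 0)"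

lemma ext_mat_mult:
  "(\<Sum>j\<in>UNIV. ext_mat I M $ i $ j * x j) = (if i \<in> I then \<Sum>j\<in>I. M i j * x j else x i)"
proof -
  have "(\<Sum>j\<in>UNIV. ext_mat I M $ i $ j * x j) = (\<Sum>j\<in>UNIV. if i \<in> I then (if j \<in> I then M i j * x j else 0) else (if j = i then x j else 0))"
    by (intro sum.cong refl) (auto simp: ext_mat_def)
  then show ?thesis by (auto simp: sum.If_cases)
qed

lemma det_ext_mat_iff: "det (ext_mat I M) \<noteq> 0 \<longleftrightarrow> nonsing_on I M"
proof -
  have "det (ext_mat I M) \<noteq> 0 \<longleftrightarrow> (\<forall>x. ext_mat I M *v x = 0 \<longrightarrow> x = 0)"
    by (simp add: invertible_det_nz[symmetric] invertible_left_inverse matrix_left_invertible_ker)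
  also have "\<dots> \<longleftrightarrow> nonsing_on I M"
  proof
    assume r: "\<forall>x. ext_mat I M *v x = 0 \<longrightarrow> x = 0"
    show "nonsing_on I M" unfolding nonsing_on_def
    proof (intro allI impI)
      fix u assume u: "\<forall>i\<in>I. (\<Sum>j\<in>I. M i j * u j) = 0"
      have "ext_mat I M *v (\<chi> j. if j \<in> I then u j else 0) = 0"
        using u by (simp add: vec_eq_iff matrix_vector_mult_def ext_mat_mult cong: sum.cong)
      then have "(\<chi> j. if j \<in> I then u j else 0) = 0" using r by blast
      then show "\<forall>j\<in>I. u j = 0" by (auto simp: vec_eq_iff split: if_splits)
    qed
  next
    assume r: "nonsing_on I M"
    show "\<forall>x. ext_mat I M *v x = 0 \<longrightarrow> x = 0"
    proof (intro allI impI)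
      fix x assume "ext_mat I M *v x = 0"
      then have x: "(if i \<in> I then \<Sum>j\<in>I. M i j * x $ j else x $ i) = 0" for i
        by (simp add: vec_eq_iff matrix_vector_mult_def ext_mat_mult)
      have "\<forall>i\<in>I. (\<Sum>j\<in>I. M i j * x $ j) = 0"
      proof
        fix i assume "i \<in> I" then show "(\<Sum>j\<in>I. M i j * x $ j) = 0" using x[of i] by simp
      qed
      then have I: "\<forall>j\<in>I. x $ j = 0" using r unfolding nonsing_on_def by blast
      have "x $ i = 0" for i using x[of i] I by (cases "i \<in> I") auto
      then show "x = 0" by (simp add: vec_eq_iff)
    qed
  qed
  finally show ?thesis .
qed

lemma mat_inv_on_right:
  fixes I :: "'i::finite set"
  assumes M: "nonsing_on I M" and ij: "i \<in> I" "j \<in> I"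
  shows "(\<Sum>k\<in>I. M i k * mat_inv_on I M k j) = (if i = j then 1 else 0)"
proof -
  have "invertible (ext_mat I M)" using M by (simp add: det_ext_mat_iff invertible_det_nz)
  then obtain N where "ext_mat I M ** N = mat 1" by (auto simp: invertible_def)
  then have "(\<Sum>k\<in>UNIV. ext_mat I M $ i $ k * N $ k $ j) = (if i = j then 1 else 0)" for i j
    by (simp add: vec_eq_iff matrix_matrix_mult_def mat_def)
  then have "\<forall>i\<in>I. \<forall>j\<in>I. (\<Sum>k\<in>I. M i k * (\<lambda>k j. N $ k $ j) k j) = (if i = j then 1 else 0)"
    unfolding ext_mat_mult by metis
  from someI[of "\<lambda>N. \<forall>i\<in>I. \<forall>j\<in>I. (\<Sum>k\<in>I. M i k * N k j) = (if i = j then 1 else 0)", OF this]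
  show ?thesis using ij unfolding mat_inv_on_def by blast
qed

lemma mat_inv_on_cramer:
  fixes I :: "'i::finite set"
  assumes M: "nonsing_on I M" and kj: "k \<in> I" "j \<in> I"
  shows "mat_inv_on I M k j =
    det (\<chi> i l. if l = k then (if i = j then 1 else 0) else ext_mat I M $ i $ l) / det (ext_mat I M)"
proof -
  let ?x = "\<chi> k. if k \<in> I then mat_inv_on I M k j else 0"
  have "ext_mat I M *v ?x = (\<chi> i. if i = j then 1 else 0)"
    using kj mat_inv_on_right[OF M]
    by (auto simp: vec_eq_iff matrix_vector_mult_def ext_mat_mult cong: sum.cong)
  then have "?x = (\<chi> k. det (\<chi> i l. if l = k then (\<chi> i. if i = j then 1 else 0) $ i else ext_mat I M $ i $ l) / det (ext_mat I M))"
    using M by (subst (asm) cramer) (auto simp: det_ext_mat_iff)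
  from arg_cong[OF this, of "\<lambda>v. v $ k"] show ?thesis using kj by (simp cong: if_cong)
qed

lemma mat_inv_on_left:
  fixes I :: "'i::finite set"
  assumes M: "nonsing_on I M" and ij: "i \<in> I" "j \<in> I"
  shows "(\<Sum>k\<in>I. mat_inv_on I M i k * M k j) = (if i = j then 1 else 0)"
proof -
  let ?N = "mat_inv_on I M"
  have "(ext_mat I M ** ext_mat I ?N) $ i $ j = mat 1 $ i $ j" for i j
    using mat_inv_on_right[OF M, of i j]
    by (auto simp: matrix_matrix_mult_def mat_def ext_mat_mult) (auto simp: ext_mat_def intro!: sum.neutral)
  then have "ext_mat I M ** ext_mat I ?N = mat 1" by (simp add: vec_eq_iff)
  then have "ext_mat I ?N ** ext_mat I M = mat 1" by (rule matrix_left_right_inverse1)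
  then have "(ext_mat I ?N ** ext_mat I M) $ i $ j = mat 1 $ i $ j" by simp
  then have "(\<Sum>k\<in>I. ?N i k * ext_mat I M $ k $ j) = (if i = j then 1 else 0)"
    using ij by (simp add: matrix_matrix_mult_def mat_def ext_mat_mult)
  moreover have "(\<Sum>k\<in>I. ?N i k * ext_mat I M $ k $ j) = (\<Sum>k\<in>I. ?N i k * M k j)"
    using ij by (intro sum.cong) (auto simp: ext_mat_def)
  ultimately show ?thesis by simp
qed

lemma mat_inv_on_unique:
  fixes I :: "'i::finite set"
  assumes M: "nonsing_on I M" and kj: "k \<in> I" "j \<in> I"
    and N: "\<And>i. i \<in> I \<Longrightarrow> (\<Sum>k\<in>I. M i k * N k) = (if i = j then 1 else 0)"
  shows "mat_inv_on I M k j = N k"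
proof -
  have "\<forall>i\<in>I. (\<Sum>k\<in>I. M i k * (mat_inv_on I M k j - N k)) = 0"
    using mat_inv_on_right[OF M _ kj(2)] N by (simp add: right_diff_distrib sum_subtractf)
  then have "\<forall>k\<in>I. mat_inv_on I M k j - N k = 0"
    using M[unfolded nonsing_on_def, THEN spec, of "\<lambda>k. mat_inv_on I M k j - N k"] by (rule mp[rotated])
  then show ?thesis using kj(1) by simp
qed

lemma nonsing_on_scale: "c \<noteq> 0 \<Longrightarrow> nonsing_on I (\<lambda>i j. c * M i j) \<longleftrightarrow> nonsing_on I M"
  by (simp add: nonsing_on_def mult.assoc flip: sum_distrib_left)

lemma mat_inv_on_scale:
  fixes I :: "'i::finite set"
  assumes M: "nonsing_on I M" and c: "c \<noteq> 0" and kj: "k \<in> I" "j \<in> I"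
  shows "mat_inv_on I M k j = c * mat_inv_on I (\<lambda>i j. c * M i j) k j"
proof -
  have "mat_inv_on I (\<lambda>i j. c * M i j) k j = mat_inv_on I M k j / c"
    using c mat_inv_on_right[OF M _ kj(2)]
    by (intro mat_inv_on_unique) (auto simp: nonsing_on_scale M kj)
  then show ?thesis using c by simp
qed

lemma tendsto_det:
  fixes A :: "'a \<Rightarrow> real^'n^'n"
  assumes "\<And>i j. ((\<lambda>x. A x $ i $ j) \<longlongrightarrow> B $ i $ j) F"
  shows "((\<lambda>x. det (A x)) \<longlongrightarrow> det B) F"
  unfolding det_def by (intro tendsto_intros assms)

lemma tendsto_ext_mat:
  assumes "\<And>i j. i \<in> I \<Longrightarrow> j \<in> I \<Longrightarrow> ((\<lambda>x. A x i j) \<longlongrightarrow> B i j) F"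
  shows "((\<lambda>x. ext_mat I (A x) $ i $ j) \<longlongrightarrow> ext_mat I B $ i $ j) F"
  using assms by (auto simp: ext_mat_def)

lemma eventually_nonsing_on:
  assumes A: "\<And>i j. i \<in> I \<Longrightarrow> j \<in> I \<Longrightarrow> ((\<lambda>x. A x i j) \<longlongrightarrow> B i j) F" and B: "nonsing_on I B"
  shows "\<forall>\<^sub>F x in F. nonsing_on (I :: 'i::finite set) (A x)"
proof -
  have "((\<lambda>x. det (ext_mat I (A x))) \<longlongrightarrow> det (ext_mat I B)) F"
    by (intro tendsto_det tendsto_ext_mat A)
  moreover have "det (ext_mat I B) \<noteq> 0" using B by (simp add: det_ext_mat_iff)
  ultimately show ?thesis
    unfolding det_ext_mat_iff[symmetric] by (rule tendsto_imp_eventually_ne)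
qed

lemma tendsto_mat_inv_on:
  assumes A: "\<And>i j. i \<in> I \<Longrightarrow> j \<in> I \<Longrightarrow> ((\<lambda>x. A x i j) \<longlongrightarrow> B i j) F" and B: "nonsing_on I B"
    and kj: "k \<in> I" "j \<in> (I :: 'i::finite set)"
  shows "((\<lambda>x. mat_inv_on I (A x) k j) \<longlongrightarrow> mat_inv_on I B k j) F"
proof -
  let ?c = "\<lambda>A. det (\<chi> i l. if l = k then (if i = j then 1 else 0) else ext_mat I A $ i $ l) / det (ext_mat I A)"
  have "((\<lambda>x. ?c (A x)) \<longlongrightarrow> ?c B) F"
    using B by (intro tendsto_divide tendsto_det) (auto simp: det_ext_mat_iff intro!: tendsto_ext_mat A)
  moreover have "\<forall>\<^sub>F x in F. ?c (A x) = mat_inv_on I (A x) k j"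
  proof -
    have "\<forall>\<^sub>F x in F. nonsing_on I (A x)" using A B by (rule eventually_nonsing_on)
    then show ?thesis by eventually_elim (simp add: mat_inv_on_cramer kj)
  qed
  ultimately show ?thesis
    by (simp add: mat_inv_on_cramer[OF B kj] tendsto_cong)
qed

lemma psd_zero_diag:
  assumes I: "finite I" and sym: "\<And>i j. i \<in> I \<Longrightarrow> j \<in> I \<Longrightarrow> W i j = W j i"
    and psd: "psd_on I W" and ij: "i \<in> I" "j \<in> I" and z: "W i i = 0"
  shows "W i j = 0"
proof (cases "i = j")
  case False
  have "0 \<le> 2 * t * W i j + W j j" for t
  proof -
    let ?u = "\<lambda>k. if k = i then t else if k = j then 1 else 0"
    have two: "(\<Sum>k\<in>I. ?u k * f k) = t * f i + f j" for f
    proof -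
      have "(\<Sum>k\<in>I. ?u k * f k) = (\<Sum>k\<in>{i, j}. ?u k * f k)"
        using I ij by (intro sum.mono_neutral_right) auto
      then show ?thesis using False by simp
    qed
    have "(\<Sum>i\<in>I. \<Sum>j\<in>I. ?u i * W i j * ?u j) = (\<Sum>i\<in>I. ?u i * (\<Sum>j\<in>I. ?u j * W i j))"
      by (simp add: sum_distrib_left mult_ac)
    also have "\<dots> = 2 * t * W i j + W j j"
      unfolding two using z sym[OF ij] by (simp add: algebra_simps)
    finally show ?thesis using psd[unfolded psd_on_def, THEN spec, of ?u] by simp
  qed
  from this[of "- (W j j + 1) / (2 * W i j)"] show ?thesis
    by (cases "W i j = 0") (auto simp: field_simps)
qed (use z in simp)

lemma psd_sum_squares:
  assumes "finite I" "\<And>i j. i \<in> I \<Longrightarrow> j \<in> I \<Longrightarrow> W i j = W j i" "psd_on I W"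
  shows "\<exists>L. \<forall>i\<in>I. \<forall>j\<in>I. W i j = (\<Sum>k\<in>I. L k i * (L k j :: real))"
  using assms
proof (induction I arbitrary: W rule: finite_induct)
  case empty
  then show ?case by simp
next
  case (insert a I)
  note sym = insert.prems(1) and psd = insert.prems(2)
  define W' where "W' i j = W i j - W a i * W a j / W a a" for i j
  have zero: "W a j = 0" if "W a a = 0" "j \<in> insert a I" for j
    by (rule psd_zero_diag[OF _ sym psd _ _ that(1)]) (use insert.hyps that(2) in auto)
  have aa: "0 \<le> W a a"
  proof -
    have "0 \<le> (\<Sum>i\<in>insert a I. \<Sum>j\<in>insert a I. (if i = a then 1 else 0) * W i j * (if j = a then 1 else 0))"
      using psd[unfolded psd_on_def, THEN spec, of "\<lambda>i. if i = a then 1 else 0"] .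
    also have "\<dots> = (\<Sum>i\<in>insert a I. \<Sum>j\<in>insert a I. if j = a then (if i = a then W i j else 0) else 0)"
      by (intro sum.cong refl) auto
    also have "\<dots> = W a a" using insert.hyps by simp
    finally show ?thesis .
  qed
  have psd': "psd_on I W'" unfolding psd_on_def
  proof
    fix u
    define s where "s = (\<Sum>j\<in>I. W a j * u j)"
    define u' where "u' = u(a := - s / W a a)"
    have u'I: "(\<Sum>j\<in>I. f j * u' j) = (\<Sum>j\<in>I. f j * u j)" for f
      using insert.hyps by (intro sum.cong) (auto simp: u'_def)
    have s': "(\<Sum>i\<in>I. u i * W i a) = s"
      unfolding s_def by (intro sum.cong) (auto simp: sym mult.commute)
    have "0 \<le> (\<Sum>i\<in>insert a I. \<Sum>j\<in>insert a I. u' i * W i j * u' j)"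
      using psd unfolding psd_on_def by blast
    also have "\<dots> = (\<Sum>i\<in>insert a I. (\<Sum>j\<in>insert a I. W i j * u' j) * u' i)"
      by (simp only: sum_distrib_right) (simp only: mult_ac)
    also have "\<dots> = (W a a * u' a + s) * u' a + (\<Sum>i\<in>I. (W i a * u' a + (\<Sum>j\<in>I. W i j * u j)) * u i)"
      using insert.hyps by (simp add: u'I s_def)
    also have "(\<Sum>i\<in>I. (W i a * u' a + (\<Sum>j\<in>I. W i j * u j)) * u i)
       = s * u' a + (\<Sum>i\<in>I. \<Sum>j\<in>I. u i * W i j * u j)"
    proof -
      have "(W i a * u' a + (\<Sum>j\<in>I. W i j * u j)) * u i = (u i * W i a) * u' a + (\<Sum>j\<in>I. u i * W i j * u j)" for i
        unfolding distrib_right sum_distrib_right by (simp only: mult_ac)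
      then show ?thesis
        unfolding s'[symmetric] by (simp only: sum.distrib sum_distrib_right)
    qed
    also have "(W a a * u' a + s) * u' a + (s * u' a + (\<Sum>i\<in>I. \<Sum>j\<in>I. u i * W i j * u j))
       = (\<Sum>i\<in>I. \<Sum>j\<in>I. u i * W i j * u j) - s * s / W a a"
      by (cases "W a a = 0") (simp_all only: u'_def fun_upd_same, simp_all)
    also have "\<dots> = (\<Sum>i\<in>I. \<Sum>j\<in>I. u i * W' i j * u j)"
    proof -
      have "s * s / W a a = (\<Sum>i\<in>I. \<Sum>j\<in>I. u i * (W a i * W a j / W a a) * u j)"
        unfolding s_def sum_product sum_divide_distrib by (simp add: mult_ac)
      then show ?thesis
        by (simp add: W'_def right_diff_distrib left_diff_distrib sum_subtractf)
    qed
    finally show "0 \<le> (\<Sum>i\<in>I. \<Sum>j\<in>I. u i * W' i j * u j)" .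
  qed
  have "\<exists>L. \<forall>i\<in>I. \<forall>j\<in>I. W' i j = (\<Sum>k\<in>I. L k i * L k j)"
    by (rule insert.IH[OF _ psd']) (simp add: W'_def sym mult.commute)
  then obtain L where L: "\<forall>i\<in>I. \<forall>j\<in>I. W' i j = (\<Sum>k\<in>I. L k i * L k j)" by blast
  define L' where "L' k j = (if k = a then W a j / sqrt (W a a) else if j = a then 0 else L k j)" for k j
  have a_part: "L' a i * L' a j = W a i * W a j / W a a" for i j
    using aa by (simp add: L'_def)
  show ?case
  proof (intro exI[of _ L'] ballI)
    fix i j assume ij: "i \<in> insert a I" "j \<in> insert a I"
    have sum: "(\<Sum>k\<in>insert a I. L' k i * L' k j) = W a i * W a j / W a a + (\<Sum>k\<in>I. L' k i * L' k j)"
      using insert.hyps by (simp add: a_part)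
    show "W i j = (\<Sum>k\<in>insert a I. L' k i * L' k j)"
    proof (cases "i = a \<or> j = a")
      case True
      then have "(\<Sum>k\<in>I. L' k i * L' k j) = 0"
        using insert.hyps by (intro sum.neutral) (auto simp: L'_def)
      moreover have "W a i * W a j / W a a = W i j"
        using True zero[OF _ ij(1)] zero[OF _ ij(2)] sym[OF ij] by (cases "W a a = 0") auto
      ultimately show ?thesis using sum by simp
    next
      case False
      then have "(\<Sum>k\<in>I. L' k i * L' k j) = (\<Sum>k\<in>I. L k i * L k j)"
        using insert.hyps by (intro sum.cong) (auto simp: L'_def)
      also have "\<dots> = W' i j" using L ij False by auto
      finally show ?thesis using sum by (simp add: W'_def)
    qed
  qed
qed

lemma whitening:
  fixes I :: "'i::finite set"
  assumes sym: "\<And>i j. i \<in> I \<Longrightarrow> j \<in> I \<Longrightarrow> W i j = W j i" and psd: "psd_on I W" and ns: "nonsing_on I W"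
  obtains K where
    "\<And>k l. k \<in> I \<Longrightarrow> l \<in> I \<Longrightarrow> (\<Sum>i\<in>I. \<Sum>j\<in>I. K i k * K j l * W i j) = (if k = l then 1 else 0)"
    "\<And>i j. i \<in> I \<Longrightarrow> j \<in> I \<Longrightarrow> mat_inv_on I W i j = (\<Sum>k\<in>I. K i k * K j k)"
proof -
  obtain L where L: "\<And>i j. i \<in> I \<Longrightarrow> j \<in> I \<Longrightarrow> W i j = (\<Sum>k\<in>I. L k i * L k j)"
    using psd_sum_squares[OF _ sym psd] by auto
  have nsL: "nonsing_on I L" unfolding nonsing_on_def
  proof (intro allI impI)
    fix u assume u: "\<forall>i\<in>I. (\<Sum>j\<in>I. L i j * u j) = 0"
    have "\<forall>i\<in>I. (\<Sum>j\<in>I. W i j * u j) = 0"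
    proof
      fix i assume i: "i \<in> I"
      have "(\<Sum>j\<in>I. W i j * u j) = (\<Sum>j\<in>I. \<Sum>k\<in>I. L k i * (L k j * u j))"
        using i by (intro sum.cong refl) (simp add: L sum_distrib_right mult.assoc)
      also have "\<dots> = (\<Sum>k\<in>I. L k i * (\<Sum>j\<in>I. L k j * u j))"
        by (subst sum.swap) (simp add: sum_distrib_left)
      finally show "(\<Sum>j\<in>I. W i j * u j) = 0" using u by simp
    qed
    then show "\<forall>j\<in>I. u j = 0" using ns unfolding nonsing_on_def by blast
  qed
  define K where "K = mat_inv_on I L"
  have LK: "(\<Sum>k\<in>I. L i k * K k j) = (if i = j then 1 else 0)" if "i \<in> I" "j \<in> I" for i j
    unfolding K_def by (rule mat_inv_on_right[OF nsL that])
  have KL: "(\<Sum>k\<in>I. K i k * L k j) = (if i = j then 1 else 0)" if "i \<in> I" "j \<in> I" for i j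
    unfolding K_def by (rule mat_inv_on_left[OF nsL that])
  show ?thesis
  proof (rule that[of K])
    fix k l assume kl: "k \<in> I" "l \<in> I"
    have "(\<Sum>i\<in>I. \<Sum>j\<in>I. K i k * K j l * W i j) = (\<Sum>i\<in>I. \<Sum>j\<in>I. \<Sum>m\<in>I. (L m i * K i k) * (L m j * K j l))"
      by (intro sum.cong refl) (simp add: L sum_distrib_left mult_ac)
    also have "\<dots> = (\<Sum>i\<in>I. \<Sum>m\<in>I. \<Sum>j\<in>I. (L m i * K i k) * (L m j * K j l))"
      by (intro sum.cong refl sum.swap)
    also have "\<dots> = (\<Sum>m\<in>I. \<Sum>i\<in>I. \<Sum>j\<in>I. (L m i * K i k) * (L m j * K j l))"
      by (rule sum.swap)
    also have "\<dots> = (\<Sum>m\<in>I. (\<Sum>i\<in>I. L m i * K i k) * (\<Sum>j\<in>I. L m j * K j l))"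
      by (simp add: sum_product)
    also have "\<dots> = (\<Sum>m\<in>I. if m = k then (if k = l then 1 else 0) else 0)"
      using kl by (intro sum.cong refl) (auto simp: LK)
    also have "\<dots> = (if k = l then 1 else 0)" using kl by simp
    finally show "(\<Sum>i\<in>I. \<Sum>j\<in>I. K i k * K j l * W i j) = (if k = l then 1 else 0)" .
  next
    fix i j assume ij: "i \<in> I" "j \<in> I"
    show "mat_inv_on I W i j = (\<Sum>k\<in>I. K i k * K j k)"
    proof (rule mat_inv_on_unique[OF ns ij])
      fix r assume r: "r \<in> I"
      have "(\<Sum>i\<in>I. W r i * (\<Sum>k\<in>I. K i k * K j k)) = (\<Sum>i\<in>I. \<Sum>m\<in>I. \<Sum>k\<in>I. L m r * (L m i * K i k) * K j k)"
      proof (intro sum.cong refl)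
        fix i assume i: "i \<in> I"
        show "W r i * (\<Sum>k\<in>I. K i k * K j k) = (\<Sum>m\<in>I. \<Sum>k\<in>I. L m r * (L m i * K i k) * K j k)"
          unfolding L[OF r i] sum_product by (simp only: mult_ac)
      qed
      also have "\<dots> = (\<Sum>m\<in>I. \<Sum>i\<in>I. \<Sum>k\<in>I. L m r * (L m i * K i k) * K j k)"
        by (rule sum.swap)
      also have "\<dots> = (\<Sum>m\<in>I. \<Sum>k\<in>I. \<Sum>i\<in>I. L m r * (L m i * K i k) * K j k)"
        by (intro sum.cong refl sum.swap)
      also have "\<dots> = (\<Sum>m\<in>I. \<Sum>k\<in>I. L m r * (\<Sum>i\<in>I. L m i * K i k) * K j k)"
        by (simp add: sum_distrib_left sum_distrib_right)
      also have "\<dots> = (\<Sum>m\<in>I. \<Sum>k\<in>I. if k = m then L m r * K j m else 0)"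
        by (intro sum.cong refl) (auto simp: LK)
      also have "\<dots> = (\<Sum>m\<in>I. K j m * L m r)" by (simp add: mult.commute)
      also have "\<dots> = (if r = j then 1 else 0)" using KL[OF ij(2) r] by auto
      finally show "(\<Sum>i\<in>I. W r i * (\<Sum>k\<in>I. K i k * K j k)) = (if r = j then 1 else 0)" .
    qed
  qed
qed

lemma nonsing_on_if_pos_def:
  assumes "\<And>u. (\<Sum>i\<in>I. \<Sum>j\<in>I. u i * W i j * u j) = 0 \<Longrightarrow> \<forall>i\<in>I. u i = 0"
  shows "nonsing_on I W"
  unfolding nonsing_on_def
proof (intro allI impI)
  fix u assume u: "\<forall>i\<in>I. (\<Sum>j\<in>I. W i j * u j) = 0"
  have "(\<Sum>i\<in>I. \<Sum>j\<in>I. u i * W i j * u j) = (\<Sum>i\<in>I. u i * (\<Sum>j\<in>I. W i j * u j))"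
    by (simp add: sum_distrib_left mult.assoc)
  also have "\<dots> = 0" using u by simp
  finally show "\<forall>j\<in>I. u j = 0" by (rule assms)
qed

lemma psd_invertible_pos_def:
  fixes S :: "'l::finite \<Rightarrow> 'l \<Rightarrow> real"
  assumes sym: "\<And>i j. S i j = S j i" and psd: "psd_on UNIV S" and inv: "invertible (\<chi> l l'. S l l')"
    and u: "(\<Sum>i\<in>UNIV. \<Sum>j\<in>UNIV. u i * S i j * u j) = 0"
  shows "u i = 0"
proof -
  obtain L :: "'l \<Rightarrow> 'l \<Rightarrow> real" where "\<forall>i\<in>UNIV. \<forall>j\<in>UNIV. S i j = (\<Sum>k\<in>UNIV. L k i * L k j)"
    using psd_sum_squares[OF finite_class.finite_UNIV sym psd] by blast
  then have L: "S i j = (\<Sum>k\<in>UNIV. L k i * L k j)" for i j by blast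
  have "(\<Sum>i\<in>UNIV. \<Sum>j\<in>UNIV. u i * S i j * u j) = (\<Sum>i\<in>UNIV. \<Sum>j\<in>UNIV. \<Sum>k\<in>UNIV. (L k i * u i) * (L k j * u j))"
    unfolding L sum_distrib_left sum_distrib_right by (simp only: mult_ac)
  also have "\<dots> = (\<Sum>i\<in>UNIV. \<Sum>k\<in>UNIV. \<Sum>j\<in>UNIV. (L k i * u i) * (L k j * u j))"
    by (intro sum.cong refl sum.swap)
  also have "\<dots> = (\<Sum>k\<in>UNIV. \<Sum>i\<in>UNIV. \<Sum>j\<in>UNIV. (L k i * u i) * (L k j * u j))"
    by (rule sum.swap)
  also have "\<dots> = (\<Sum>k\<in>UNIV. (\<Sum>i\<in>UNIV. L k i * u i)\<^sup>2)"
    by (simp add: sum_product power2_eq_square)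
  finally have Lu: "\<forall>k. (\<Sum>i\<in>UNIV. L k i * u i) = 0"
    using u by (simp add: sum_nonneg_eq_0_iff)
  have "(\<Sum>j\<in>UNIV. S i j * u j) = 0" for i
  proof -
    have "(\<Sum>j\<in>UNIV. S i j * u j) = (\<Sum>j\<in>UNIV. \<Sum>k\<in>UNIV. L k i * (L k j * u j))"
      unfolding L sum_distrib_right by (simp only: mult.assoc)
    also have "\<dots> = (\<Sum>k\<in>UNIV. L k i * (\<Sum>j\<in>UNIV. L k j * u j))"
      by (subst sum.swap) (simp add: sum_distrib_left)
    finally show ?thesis using Lu by simp
  qed
  then have "(\<chi> l l'. S l l') *v (\<chi> l. u l) = 0"
    by (simp add: matrix_vector_mult_def vec_eq_iff)
  then have "(\<chi> l. u l) = 0"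
    using inv by (simp add: invertible_left_inverse matrix_left_invertible_ker)
  then show ?thesis by (simp add: vec_eq_iff)
qed

section \<open>Factorial contrasts\<close>

lemma gval_empty [simp]: "gval {} q = 1"
  by (simp add: gval_def)

lemma iota_sq: "iota k q * iota k q = 1"
  by (simp add: iota_def)

lemma gval_toggle:
  assumes "k \<in> A" "finite A"
  shows "gval A (if k \<in> q then q - {k} else insert k q) = - gval A q"
proof -
  let ?t = "if k \<in> q then q - {k} else insert k q"
  have "(\<Prod>j\<in>A - {k}. iota j ?t) = (\<Prod>j\<in>A - {k}. iota j q)"
    by (intro prod.cong) (auto simp: iota_def)
  moreover have "iota k ?t = - iota k q" by (auto simp: iota_def)
  ultimately show ?thesis
    unfolding gval_def using assms by (simp add: prod.remove[of A k])
qed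

lemma gval_toggle_notin:
  assumes "k \<notin> A"
  shows "gval A (if k \<in> q then q - {k} else insert k q) = gval A q"
  unfolding gval_def using assms by (intro prod.cong) (auto simp: iota_def)

lemma gval_orthogonal:
  fixes A B :: "'k::finite set"
  assumes "A \<noteq> B"
  shows "(\<Sum>q\<in>UNIV. gval A q * gval B q) = 0"
proof -
  obtain k where k: "k \<in> A \<and> k \<notin> B \<or> k \<in> B \<and> k \<notin> A" using assms by blast
  let ?t = "\<lambda>q. if k \<in> q then q - {k} else insert k q"
  have tt: "?t (?t q) = q" for q by auto
  have "(\<Sum>q\<in>UNIV. gval A q * gval B q) = (\<Sum>q\<in>UNIV. gval A (?t q) * gval B (?t q))"
    by (rule sum.reindex_bij_witness[where i = ?t and j = ?t]) (auto simp only: tt UNIV_I)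
  also have "gval A (?t q) * gval B (?t q) = - (gval A q * gval B q)" for q
    using k gval_toggle[of k A q] gval_toggle[of k B q] gval_toggle_notin[of k A q] gval_toggle_notin[of k B q]
    by auto
  then have "(\<Sum>q\<in>UNIV. gval A (?t q) * gval B (?t q)) = - (\<Sum>q\<in>UNIV. gval A q * gval B q)"
    by (simp add: sum_negf)
  finally show ?thesis by simp
qed

lemma gval_sq: "gval (A :: 'k::finite set) q * gval A q = 1"
  by (simp add: gval_def prod.distrib[symmetric] iota_sq)

lemma sum_gval: "A \<noteq> {} \<Longrightarrow> (\<Sum>q\<in>UNIV. gval (A :: 'k::finite set) q) = 0"
  using gval_orthogonal[of A "{}"] by simp

lemma gval_independent:
  fixes I :: "'k::finite set set"
  assumes z: "\<And>q. (\<Sum>A\<in>I. u A * gval A q) = 0" and B: "B \<in> I"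
  shows "u B = 0"
proof -
  have "0 = (\<Sum>q\<in>UNIV. (\<Sum>A\<in>I. u A * gval A q) * gval B q)" by (simp add: z)
  also have "\<dots> = (\<Sum>A\<in>I. u A * (\<Sum>q\<in>UNIV. gval A q * gval B q))"
    unfolding sum_distrib_right by (subst sum.swap) (simp add: sum_distrib_left mult.assoc)
  also have "\<dots> = (\<Sum>A\<in>I. if A = B then u B * real (CARD('k set)) else 0)"
    by (intro sum.cong refl) (auto simp: gval_orthogonal gval_sq)
  also have "\<dots> = u B * real (CARD('k set))" using B by simp
  finally show ?thesis by simp
qed

definition Bmat :: "('k::finite set \<Rightarrow> real) \<Rightarrow> 'k set \<Rightarrow> 'k set \<Rightarrow> real" where
  "Bmat w A B = (cK TYPE('k))\<^sup>2 * (\<Sum>q\<in>UNIV. gval A q * gval B q * w q)"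

definition proj_coef :: "('k::finite set \<Rightarrow> real) \<Rightarrow> 'k set set \<Rightarrow> 'k set \<Rightarrow> 'k set \<Rightarrow> real" where
  "proj_coef w U A C = (\<Sum>B\<in>U. Bmat w A B * mat_inv_on U (Bmat w) B C)"

definition cvecw :: "('k::finite set \<Rightarrow> real) \<Rightarrow> (nat \<Rightarrow> 'k set set) \<Rightarrow> nat \<Rightarrow> 'k set \<Rightarrow> 'k set \<Rightarrow> real" where
  "cvecw w T h q A = gval A q - (\<Sum>C\<in>tiers_upto T (h - 1). proj_coef w (tiers_upto T (h - 1)) A C * gval C q)"

lemma Btil_eq_Bmat: "Btil nq = Bmat (\<lambda>q. 1 / real (nq q))"
  by (intro ext) (simp add: Btil_def Bmat_def)

lemma cK_pos: "cK TYPE('k::finite) > 0"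
  by (simp add: cK_def)

lemma Bmat_scale: "Bmat (\<lambda>q. c * w q) = (\<lambda>A B. c * Bmat w A B)"
  by (intro ext) (simp add: Bmat_def sum_distrib_left mult_ac)

lemma nonsing_Bmat:
  fixes w :: "'k::finite set \<Rightarrow> real"
  assumes w: "\<And>q. w q > 0"
  shows "nonsing_on U (Bmat w)"
proof (rule nonsing_on_if_pos_def)
  fix u assume u: "(\<Sum>A\<in>U. \<Sum>B\<in>U. u A * Bmat w A B * u B) = 0"
  have "(\<Sum>A\<in>U. \<Sum>B\<in>U. u A * Bmat w A B * u B)
     = (\<Sum>A\<in>U. \<Sum>B\<in>U. \<Sum>q\<in>UNIV. (cK TYPE('k))\<^sup>2 * (w q * ((u A * gval A q) * (u B * gval B q))))"
    unfolding Bmat_def sum_distrib_left sum_distrib_right by (simp only: mult_ac)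
  also have "\<dots> = (\<Sum>A\<in>U. \<Sum>q\<in>UNIV. \<Sum>B\<in>U. (cK TYPE('k))\<^sup>2 * (w q * ((u A * gval A q) * (u B * gval B q))))"
    by (intro sum.cong refl sum.swap)
  also have "\<dots> = (\<Sum>q\<in>UNIV. \<Sum>A\<in>U. \<Sum>B\<in>U. (cK TYPE('k))\<^sup>2 * (w q * ((u A * gval A q) * (u B * gval B q))))"
    by (rule sum.swap)
  also have "\<dots> = (\<Sum>q\<in>UNIV. (cK TYPE('k))\<^sup>2 * (w q * (\<Sum>A\<in>U. u A * gval A q)\<^sup>2))"
    by (simp only: power2_eq_square[of "sum _ _"] sum_product) (simp only: sum_distrib_left)
  finally have "(\<Sum>q\<in>UNIV. (cK TYPE('k))\<^sup>2 * (w q * (\<Sum>A\<in>U. u A * gval A q)\<^sup>2)) = 0" using u by simp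
  then have z: "\<forall>q\<in>UNIV. (cK TYPE('k))\<^sup>2 * (w q * (\<Sum>A\<in>U. u A * gval A q)\<^sup>2) = 0"
    using w by (subst (asm) sum_nonneg_eq_0_iff) (auto simp: less_imp_le)
  have "(\<Sum>A\<in>U. u A * gval A q) = 0" for q
    using z[THEN bspec, of q] w[of q] cK_pos[where 'k = 'k] by simp
  then show "\<forall>A\<in>U. u A = 0" using gval_independent by blast
qed

lemma cvec_eq_cvecw:
  assumes nq: "\<And>q. nq q \<ge> 1" and n: "n > 0" and A: "h \<ge> 1"
  shows "cvec nq T h q A = cvecw (\<lambda>q. real n / real (nq q)) T h q A"
proof -
  let ?U = "tiers_upto T (h - 1)"
  let ?w = "\<lambda>q. 1 / real (nq q)"
  have w: "?w q > 0" for q using nq[of q] by simp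
  have s: "Bmat (\<lambda>q. real n / real (nq q)) = (\<lambda>A B. real n * Bmat ?w A B)"
    using Bmat_scale[of "real n" ?w] by simp
  have p: "proj_coef (\<lambda>q. real n / real (nq q)) ?U A C = (\<Sum>B\<in>?U. Btil nq A B * mat_inv_on ?U (Btil nq) B C)" if "C \<in> ?U" for C
    unfolding proj_coef_def s Btil_eq_Bmat
  proof (rule sum.cong[OF refl])
    fix B assume "B \<in> ?U"
    then show "real n * Bmat ?w A B * mat_inv_on ?U (\<lambda>A B. real n * Bmat ?w A B) B C = Bmat ?w A B * mat_inv_on ?U (Bmat ?w) B C"
      using mat_inv_on_scale[OF nonsing_Bmat[where w = ?w, OF w], of "real n" B ?U C] n that by simp
  qed
  have "(\<Sum>B\<in>?U. \<Sum>C\<in>?U. Btil nq A B * mat_inv_on ?U (Btil nq) B C * gval C q)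
    = (\<Sum>C\<in>?U. (\<Sum>B\<in>?U. Btil nq A B * mat_inv_on ?U (Btil nq) B C) * gval C q)"
    unfolding sum_distrib_right by (rule sum.swap)
  also have "\<dots> = (\<Sum>C\<in>?U. proj_coef (\<lambda>q. real n / real (nq q)) ?U A C * gval C q)"
    by (intro sum.cong refl) (simp only: p)
  finally have eq: "(\<Sum>B\<in>?U. \<Sum>C\<in>?U. Btil nq A B * mat_inv_on ?U (Btil nq) B C * gval C q)
     = (\<Sum>C\<in>?U. proj_coef (\<lambda>q. real n / real (nq q)) ?U A C * gval C q)" .
  have "h = 1 \<Longrightarrow> ?U = {}" by (simp add: tiers_upto_def)
  then show ?thesis unfolding cvec_def cvecw_def eq by simp
qed

lemma tendsto_cvecw:
  assumes wn: "\<And>q. (\<lambda>n. wn n q) \<longlonglongrightarrow> w q" and w: "\<And>q. w q > 0"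
  shows "(\<lambda>n. cvecw (wn n) T h q A) \<longlonglongrightarrow> cvecw w T h q A"
proof -
  have B: "(\<lambda>n. Bmat (wn n) A B) \<longlonglongrightarrow> Bmat w A B" for A B
    unfolding Bmat_def by (intro tendsto_intros wn)
  show ?thesis
    unfolding cvecw_def proj_coef_def
    by (intro tendsto_intros B tendsto_mat_inv_on nonsing_Bmat w)
qed

lemma cvecw_orthogonal_earlier:
  fixes w :: "'k::finite set \<Rightarrow> real"
  assumes w: "\<And>q. w q > 0" and C: "C \<in> tiers_upto T (h - 1)"
  shows "(\<Sum>q\<in>UNIV. cvecw w T h q A * gval C q * w q) = 0"
proof -
  let ?U = "tiers_upto T (h - 1)" let ?N = "mat_inv_on ?U (Bmat w)"
  have "(cK TYPE('k))\<^sup>2 * (\<Sum>q\<in>UNIV. cvecw w T h q A * gval C q * w q)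
     = Bmat w A C - (\<Sum>C'\<in>?U. proj_coef w ?U A C' * Bmat w C' C)"
  proof -
    have "(\<Sum>q\<in>UNIV. (\<Sum>C'\<in>?U. proj_coef w ?U A C' * gval C' q) * gval C q * w q)
        = (\<Sum>C'\<in>?U. proj_coef w ?U A C' * (\<Sum>q\<in>UNIV. gval C' q * gval C q * w q))"
      unfolding sum_distrib_right sum_distrib_left by (subst sum.swap) (simp only: mult_ac)
    then show ?thesis
      unfolding cvecw_def Bmat_def
      by (simp add: left_diff_distrib sum_subtractf right_diff_distrib sum_distrib_left mult_ac)
  qed
  also have "(\<Sum>C'\<in>?U. proj_coef w ?U A C' * Bmat w C' C) = (\<Sum>C'\<in>?U. \<Sum>B\<in>?U. Bmat w A B * (?N B C' * Bmat w C' C))"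
    unfolding proj_coef_def sum_distrib_right by (simp only: mult.assoc)
  also have "\<dots> = (\<Sum>B\<in>?U. Bmat w A B * (\<Sum>C'\<in>?U. ?N B C' * Bmat w C' C))"
    unfolding sum_distrib_left by (rule sum.swap)
  also have "\<dots> = (\<Sum>B\<in>?U. if B = C then Bmat w A C else 0)"
    using C by (intro sum.cong refl) (auto simp: mat_inv_on_left nonsing_Bmat w)
  also have "\<dots> = Bmat w A C" using C by simp
  finally show ?thesis using cK_pos[where 'k = 'k] by simp
qed

lemma cvecw_sum_zero:
  assumes "A \<noteq> {}" "{} \<notin> tiers_upto T (h - 1)"
  shows "(\<Sum>q\<in>UNIV. cvecw w T h (q :: 'k::finite set) A) = 0"
proof -
  let ?U = "tiers_upto T (h - 1)"
  have "(\<Sum>q\<in>UNIV. \<Sum>C\<in>?U. proj_coef w ?U A C * gval C q) = (\<Sum>C\<in>?U. proj_coef w ?U A C * (\<Sum>q\<in>UNIV. gval C q))"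
    by (subst sum.swap) (simp add: sum_distrib_left)
  also have "\<dots> = 0"
  proof (intro sum.neutral ballI)
    fix C assume "C \<in> ?U"
    then have "C \<noteq> {}" using assms(2) by blast
    then show "proj_coef w ?U A C * (\<Sum>q\<in>UNIV. gval C q) = 0" using sum_gval[of C] by simp
  qed
  finally show ?thesis using assms(1) by (simp add: cvecw_def sum_subtractf sum_gval)
qed

lemma cvecw_orthogonal_tiers:
  fixes w :: "'k::finite set \<Rightarrow> real"
  assumes w: "\<And>q. w q > 0" and h: "1 \<le> h" "h < h'" and A: "A \<in> T h"
  shows "(\<Sum>q\<in>UNIV. cvecw w T h q A * cvecw w T h' q A' * w q) = 0"
proof -
  let ?U = "tiers_upto T (h - 1)"
  have z: "(\<Sum>q\<in>UNIV. gval C q * (cvecw w T h' q A' * w q)) = 0" if "C \<in> tiers_upto T (h' - 1)" for C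
    using cvecw_orthogonal_earlier[where w = w, OF w that, of A'] by (simp only: mult_ac)
  have sub: "?U \<subseteq> tiers_upto T (h' - 1)"
    unfolding tiers_upto_def using h by (intro UN_mono) auto
  have sub': "A \<in> tiers_upto T (h' - 1)"
    unfolding tiers_upto_def using h A by (intro UN_I[of h]) auto
  have "(\<Sum>q\<in>UNIV. cvecw w T h q A * cvecw w T h' q A' * w q)
    = (\<Sum>q\<in>UNIV. gval A q * (cvecw w T h' q A' * w q))
     - (\<Sum>q\<in>UNIV. \<Sum>C\<in>?U. proj_coef w ?U A C * (gval C q * (cvecw w T h' q A' * w q)))"
    unfolding sum_subtractf[symmetric] cvecw_def[of w T h]
    by (intro sum.cong refl) (simp add: left_diff_distrib sum_distrib_right mult.assoc)
  also have "(\<Sum>q\<in>UNIV. \<Sum>C\<in>?U. proj_coef w ?U A C * (gval C q * (cvecw w T h' q A' * w q)))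
     = (\<Sum>C\<in>?U. proj_coef w ?U A C * (\<Sum>q\<in>UNIV. gval C q * (cvecw w T h' q A' * w q)))"
    by (subst sum.swap) (simp add: sum_distrib_left)
  also have "\<dots> = 0" using sub z by (intro sum.neutral) auto
  finally show ?thesis using z[OF sub'] by simp
qed

lemma cvecw_independent:
  fixes T :: "nat \<Rightarrow> 'k::finite set set"
  assumes disj: "T h \<inter> tiers_upto T (h - 1) = {}"
    and z: "\<And>q. (\<Sum>A\<in>T h. u A * cvecw w T h q A) = 0" and A: "A \<in> T h"
  shows "u A = 0"
proof -
  let ?U = "tiers_upto T (h - 1)"
  define v where "v C = (if C \<in> T h then u C else - (\<Sum>A\<in>T h. u A * proj_coef w ?U A C))" for C
  have v0: "(\<Sum>C\<in>T h \<union> ?U. v C * gval C q) = 0" for q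
  proof -
    have "(\<Sum>C\<in>T h \<union> ?U. v C * gval C q) = (\<Sum>C\<in>T h. v C * gval C q) + (\<Sum>C\<in>?U. v C * gval C q)"
      using disj by (intro sum.union_disjoint) auto
    also have "(\<Sum>C\<in>T h. v C * gval C q) = (\<Sum>A\<in>T h. u A * gval A q)"
      by (intro sum.cong) (auto simp: v_def)
    also have "(\<Sum>C\<in>?U. v C * gval C q) = (\<Sum>C\<in>?U. - (\<Sum>A\<in>T h. u A * (proj_coef w ?U A C * gval C q)))"
      using disj by (intro sum.cong refl) (auto simp: v_def sum_distrib_right mult.assoc)
    also have "\<dots> = - (\<Sum>A\<in>T h. u A * (\<Sum>C\<in>?U. proj_coef w ?U A C * gval C q))"
      unfolding sum_negf sum_distrib_left by (subst sum.swap) (rule refl)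
    also have "(\<Sum>A\<in>T h. u A * gval A q) + \<dots> = (\<Sum>A\<in>T h. u A * cvecw w T h q A)"
      unfolding cvecw_def by (simp add: right_diff_distrib sum_subtractf)
    finally show ?thesis using z by simp
  qed
  have "v A = 0" by (rule gval_independent[where I = "T h \<union> ?U" and u = v, OF v0]) (use A in blast)
  then show ?thesis using A by (simp add: v_def)
qed

section \<open>A central limit theorem for completely randomized assignments\<close>

lemma abs_mult_le_sum_squares: "\<bar>y * z\<bar> \<le> y\<^sup>2 + (z::real)\<^sup>2"
  using sum_squares_bound[of "\<bar>y\<bar>" "\<bar>z\<bar>"] mult_nonneg_nonneg[of "\<bar>y\<bar>" "\<bar>z\<bar>"]
  unfolding abs_mult by (simp only: power2_abs) linarith

definition avg :: "'a set \<Rightarrow> ('a \<Rightarrow> real) \<Rightarrow> real" where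
  "avg S f = (\<Sum>s\<in>S. f s) / real (card S)"

lemma avg_add: "avg S (\<lambda>s. f s + g s) = avg S f + avg S g"
  by (simp add: avg_def sum.distrib add_divide_distrib)

lemma avg_diff: "avg S (\<lambda>s. f s - g s) = avg S f - avg S g"
  by (simp add: avg_def sum_subtractf diff_divide_distrib)

lemma avg_uminus: "avg S (\<lambda>s. - f s) = - avg S f"
  by (simp add: avg_def sum_negf)

lemma avg_cmult: "avg S (\<lambda>s. c * f s) = c * avg S f"
  by (simp add: avg_def sum_distrib_left)

lemma avg_sum: "avg S (\<lambda>s. \<Sum>i\<in>I. f i s) = (\<Sum>i\<in>I. avg S (f i))"
  by (simp add: avg_def sum_divide_distrib sum.swap[of _ S I])

lemma avg_const: "finite S \<Longrightarrow> S \<noteq> {} \<Longrightarrow> avg S (\<lambda>_. c) = c"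
  by (simp add: avg_def)

lemma avg_mono: "(\<And>s. s \<in> S \<Longrightarrow> f s \<le> g s) \<Longrightarrow> avg S f \<le> avg S g"
  by (simp add: avg_def divide_right_mono sum_mono)

lemma avg_nonneg: "(\<And>s. s \<in> S \<Longrightarrow> 0 \<le> f s) \<Longrightarrow> 0 \<le> avg S f"
  by (simp add: avg_def sum_nonneg)

lemma avg_cong: "(\<And>s. s \<in> S \<Longrightarrow> f s = g s) \<Longrightarrow> avg S f = avg S g"
  by (simp add: avg_def)

lemma abs_avg_le: "\<bar>avg S f\<bar> \<le> avg S (\<lambda>s. \<bar>f s\<bar>)"
  by (simp add: avg_def divide_right_mono sum_abs)

lemma avg_abs_le_sqrt:
  assumes "finite S" "S \<noteq> {}"
  shows "avg S (\<lambda>s. \<bar>f s\<bar>) \<le> sqrt (avg S (\<lambda>s. (f s)\<^sup>2))"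
proof -
  let ?m = "avg S (\<lambda>s. \<bar>f s\<bar>)"
  have "0 \<le> avg S (\<lambda>s. (\<bar>f s\<bar> - ?m)\<^sup>2)" by (rule avg_nonneg) simp
  also have "avg S (\<lambda>s. (\<bar>f s\<bar> - ?m)\<^sup>2) = avg S (\<lambda>s. (f s)\<^sup>2 - 2 * ?m * \<bar>f s\<bar> + ?m\<^sup>2)"
    by (rule avg_cong) (simp add: power2_diff)
  also have "\<dots> = avg S (\<lambda>s. (f s)\<^sup>2) - ?m\<^sup>2"
    by (simp add: avg_add avg_diff avg_cmult avg_const[OF assms] power2_eq_square)
  finally show ?thesis by (simp add: real_le_rsqrt)
qed

lemma avg_eq_expectation:
  "finite S \<Longrightarrow> S \<noteq> {} \<Longrightarrow> measure_pmf.expectation (pmf_of_set S) f = avg S f"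
  by (simp add: avg_def integral_pmf_of_set)

lemma exists_map_with_fibre_cards:
  assumes "finite S" "finite A" "card A = (\<Sum>q\<in>S. f q)"
  shows "\<exists>Z\<in>A \<rightarrow> S. \<forall>q\<in>S. card {i\<in>A. Z i = q} = f q"
  using assms
proof (induction S arbitrary: A rule: finite_induct)
  case empty
  then show ?case by simp
next
  case (insert q S)
  then obtain B where B: "B \<subseteq> A" "card B = f q"
    by (metis le_add1 sum.insert obtain_subset_with_card_n)
  have "card (A - B) = (\<Sum>q\<in>S. f q)"
    using insert B by (simp add: card_Diff_subset finite_subset)
  then obtain Z where Z: "Z \<in> (A - B) \<rightarrow> S" "\<forall>q\<in>S. card {i\<in>A - B. Z i = q} = f q"
    using insert.IH[of "A - B"] insert.prems by auto
  define Z' where "Z' = (\<lambda>i. if i \<in> B then q else Z i)"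
  have "{i\<in>A. Z' i = q} = B"
    using Z(1) B insert.hyps by (auto simp: Z'_def)
  moreover have "{i\<in>A. Z' i = r} = {i\<in>A - B. Z i = r}" if "r \<in> S" for r
    using that insert.hyps B by (auto simp: Z'_def)
  ultimately show ?case
    using Z B by (intro bexI[of _ Z']) (auto simp: Z'_def Pi_iff)
qed

lemma finite_assignments: "finite (assignments n (nq :: 'k::finite set \<Rightarrow> nat))"
  unfolding assignments_def
  by (rule finite_subset[of _ "{..<n} \<rightarrow>\<^sub>E UNIV"]) (auto intro: finite_PiE)

lemma assignments_nonempty:
  fixes nq :: "'k::finite set \<Rightarrow> nat"
  assumes "(\<Sum>q\<in>UNIV. nq q) = n"
  shows "assignments n nq \<noteq> {}"
proof -
  obtain Z :: "nat \<Rightarrow> 'k set" where Z: "\<forall>q\<in>UNIV. card {i\<in>{..<n}. Z i = q} = nq q"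
    using exists_map_with_fibre_cards[of UNIV "{..<n}" nq] assms by auto
  have "{i\<in>{..<n}. restrict Z {..<n} i = q} = {i\<in>{..<n}. Z i = q}" for q by auto
  then have "restrict Z {..<n} \<in> assignments n nq"
    using Z by (auto simp: assignments_def)
  then show ?thesis by blast
qed

lemma sin_diff_taylor: "\<bar>sin x - sin (x - y) - y * cos x\<bar> \<le> y\<^sup>2 / (2::real)"
proof -
  have "\<bar>sin (x - y) - (\<Sum>i<2. (if i = 0 then sin x else cos x) / fact i * (- y) ^ i)\<bar> \<le> y\<^sup>2 / 2"
  proof -
    define d :: "nat \<Rightarrow> real \<Rightarrow> real" where
      "d = (\<lambda>m t. if m = 0 then sin (x + t) else if m = 1 then cos (x + t) else - sin (x + t))"
    have "\<exists>t. \<bar>t\<bar> \<le> \<bar>-y\<bar> \<and> sin (x + -y) = (\<Sum>m<2. d m 0 / fact m * (-y) ^ m) + d 2 t / fact 2 * (-y)^2"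
    proof (rule Maclaurin_bi_le)
      show "d 0 = (\<lambda>t. sin (x + t))" by (simp add: d_def)
      show "\<forall>m t. m < 2 \<and> \<bar>t\<bar> \<le> \<bar>- y\<bar> \<longrightarrow> (d m has_real_derivative d (Suc m) t) (at t)"
      proof (intro allI impI)
        fix m :: nat and t assume "m < 2 \<and> \<bar>t\<bar> \<le> \<bar>-y\<bar>"
        then consider "m = 0" | "m = 1" by linarith
        then show "(d m has_real_derivative d (Suc m) t) (at t)"
          by cases (auto simp: d_def intro!: derivative_eq_intros)
      qed
    qed
    then obtain t where "sin (x + -y) = (\<Sum>m<2. d m 0 / fact m * (-y) ^ m) + d 2 t / fact 2 * (-y)^2"
      by blast
    moreover have "(\<Sum>m<2. d m 0 / fact m * (-y) ^ m) = (\<Sum>i<2. (if i = 0 then sin x else cos x) / fact i * (- y) ^ i)"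
      by (intro sum.cong) (auto simp: d_def)
    moreover have "\<bar>d 2 t / fact 2 * (-y)^2\<bar> \<le> y\<^sup>2 / 2"
      using mult_right_mono[OF abs_sin_le_one[of "x + t"], of "y\<^sup>2"] by (simp add: d_def abs_mult)
    ultimately show ?thesis by simp
  qed
  moreover have "(\<Sum>i<2. (if i = 0 then sin x else cos x) / fact i * (- y) ^ i) = sin x - y * cos x"
    by (simp add: numeral_2_eq_2)
  ultimately have "\<bar>sin (x - y) - (sin x - y * cos x)\<bar> \<le> y\<^sup>2 / 2" by simp
  then show ?thesis by linarith
qed

definition swap_units :: "nat \<Rightarrow> nat \<Rightarrow> (nat \<Rightarrow> 'a) \<Rightarrow> nat \<Rightarrow> 'a" where
  "swap_units i j Z = Z(i := Z j, j := Z i)"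

lemma swap_units_swap_units [simp]: "swap_units i j (swap_units i j Z) = Z"
  by (auto simp: swap_units_def)

locale crfe_design =
  fixes n :: nat and nq :: "'k::finite set \<Rightarrow> nat"
  assumes n_pos: "n > 0" and nq_sum: "(\<Sum>q\<in>UNIV. nq q) = n"
begin

abbreviation "E \<equiv> avg (assignments n nq)"

lemmas fin = finite_assignments[of n nq]
lemmas nonempty = assignments_nonempty[OF nq_sum]

definition lin :: "(nat \<Rightarrow> 'k set \<Rightarrow> real) \<Rightarrow> (nat \<Rightarrow> 'k set) \<Rightarrow> real" where
  "lin b Z = (\<Sum>i<n. b i (Z i))"

definition swap_diff :: "(nat \<Rightarrow> 'k set \<Rightarrow> real) \<Rightarrow> nat \<Rightarrow> nat \<Rightarrow> (nat \<Rightarrow> 'k set) \<Rightarrow> real" where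
  "swap_diff b i j Z = b i (Z i) + b j (Z j) - b i (Z j) - b j (Z i)"

definition sq_total :: "(nat \<Rightarrow> 'k set \<Rightarrow> real) \<Rightarrow> real" where
  "sq_total b = (\<Sum>i<n. \<Sum>q\<in>UNIV. (b i q)\<^sup>2)"

lemma swap_units_assignments:
  assumes Z: "Z \<in> assignments n nq" and ij: "i < n" "j < n"
  shows "swap_units i j Z \<in> assignments n nq"
proof -
  have "card {k\<in>{..<n}. swap_units i j Z k = q} = card {k\<in>{..<n}. Z k = q}" for q
    by (rule bij_betw_same_card[of "Transposition.transpose i j"],
        rule bij_betwI[where g = "Transposition.transpose i j"])
       (use ij in \<open>auto simp: swap_units_def Transposition.transpose_def split: if_splits\<close>)
  then show ?thesis
    using Z ij by (auto simp: assignments_def swap_units_def PiE_iff extensional_def)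
qed

lemma E_swap_units:
  assumes "i < n" "j < n"
  shows "E (\<lambda>Z. f (swap_units i j Z)) = E f"
  unfolding avg_def
  by (rule arg_cong[where f = "\<lambda>x. x / _"],
      rule sum.reindex_bij_witness[where i = "swap_units i j" and j = "swap_units i j"])
     (use assms in \<open>auto intro: swap_units_assignments\<close>)

lemma lin_swap_units:
  assumes ij: "i < n" "j < n"
  shows "lin b (swap_units i j Z) = lin b Z - swap_diff b i j Z"
proof (cases "i = j")
  case True
  then show ?thesis by (simp add: swap_units_def swap_diff_def)
next
  case False
  have split: "(\<Sum>k<n. f k) = f i + f j + (\<Sum>k\<in>{..<n} - {i} - {j}. f k)" for f :: "nat \<Rightarrow> real"
    using ij False by (subst sum.remove[of _ i]) (auto simp: sum.remove[of _ j])
  have "(\<Sum>k\<in>{..<n} - {i} - {j}. b k (swap_units i j Z k)) = (\<Sum>k\<in>{..<n} - {i} - {j}. b k (Z k))"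
    by (rule sum.cong) (auto simp: swap_units_def)
  then show ?thesis
    unfolding lin_def split using False by (simp add: swap_units_def swap_diff_def)
qed

lemma swap_diff_swap_units: "swap_diff b i j (swap_units i j Z) = - swap_diff b i j Z"
  by (simp add: swap_units_def swap_diff_def)

lemma sum_over_units:
  assumes Z: "Z \<in> assignments n nq"
  shows "(\<Sum>j<n. f (Z j)) = (\<Sum>q\<in>UNIV. real (nq q) * f q)"
proof -
  have "(\<Sum>j<n. f (Z j)) = (\<Sum>q\<in>UNIV. \<Sum>j\<in>{j\<in>{..<n}. Z j = q}. f (Z j))"
    by (rule sum.group[symmetric]) auto
  also have "\<dots> = (\<Sum>q\<in>UNIV. real (nq q) * f q)"
    using Z by (intro sum.cong) (auto simp: assignments_def)
  finally show ?thesis .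
qed

lemma sum_swap_diff:
  assumes Z: "Z \<in> assignments n nq"
  shows "(\<Sum>i<n. \<Sum>j<n. swap_diff b i j Z) = 2 * real n * lin b Z - 2 * (\<Sum>q\<in>UNIV. real (nq q) * (\<Sum>i<n. b i q))"
proof -
  have 1: "(\<Sum>i<n. \<Sum>j<n. b i (Z j)) = (\<Sum>q\<in>UNIV. real (nq q) * (\<Sum>i<n. b i q))"
    by (subst sum.swap) (rule sum_over_units[OF Z])
  have 2: "(\<Sum>i<n. \<Sum>j<n. b j (Z i)) = (\<Sum>i<n. \<Sum>j<n. b i (Z j))"
    by (rule sum.swap)
  show ?thesis
    unfolding swap_diff_def
    by (simp add: sum.distrib sum_subtractf 2) (simp add: 1 lin_def sum_distrib_left[symmetric])
qed

lemma E_swap_diff: "i < n \<Longrightarrow> j < n \<Longrightarrow> E (swap_diff b i j) = 0"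
  using E_swap_units[of i j "swap_diff b i j"] by (simp add: swap_diff_swap_units avg_uminus)

lemma E_lin: "E (lin b) = (\<Sum>q\<in>UNIV. real (nq q) * (\<Sum>i<n. b i q)) / real n"
proof -
  have "0 = E (\<lambda>Z. \<Sum>i<n. \<Sum>j<n. swap_diff b i j Z)"
    by (simp add: avg_sum E_swap_diff)
  also have "\<dots> = E (\<lambda>Z. 2 * real n * lin b Z - 2 * (\<Sum>q\<in>UNIV. real (nq q) * (\<Sum>i<n. b i q)))"
    by (intro avg_cong sum_swap_diff)
  also have "\<dots> = 2 * real n * E (lin b) - 2 * (\<Sum>q\<in>UNIV. real (nq q) * (\<Sum>i<n. b i q))"
    by (simp add: avg_diff avg_cmult avg_const[OF fin nonempty])
  finally show ?thesis using n_pos by (simp add: field_simps)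
qed

text \<open>The exchangeable-pair identity: the difference of the statistic is antisymmetric under the swap.\<close>

lemma E_swap_diff_mult:
  assumes "i < n" "j < n"
  shows "E (\<lambda>Z. swap_diff b i j Z * F Z) = E (\<lambda>Z. swap_diff b i j Z * (F Z - F (swap_units i j Z))) / 2"
proof -
  have "E (\<lambda>Z. swap_diff b i j Z * F Z) = E (\<lambda>Z. - (swap_diff b i j Z * F (swap_units i j Z)))"
    using E_swap_units[OF assms, of "\<lambda>Z. swap_diff b i j Z * F Z"] by (simp add: swap_diff_swap_units)
  then show ?thesis
    by (simp add: right_diff_distrib avg_diff avg_uminus)
qed

lemma E_lin_mult:
  assumes cen: "\<And>q. (\<Sum>i<n. b i q) = 0"
  shows "E (\<lambda>Z. lin b Z * F Z) = (\<Sum>i<n. \<Sum>j<n. E (\<lambda>Z. swap_diff b i j Z * (F Z - F (swap_units i j Z)))) / (4 * real n)"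
proof -
  have "2 * real n * E (\<lambda>Z. lin b Z * F Z) = E (\<lambda>Z. (\<Sum>i<n. \<Sum>j<n. swap_diff b i j Z) * F Z)"
    unfolding avg_cmult[symmetric] by (rule avg_cong) (simp add: sum_swap_diff cen)
  also have "\<dots> = (\<Sum>i<n. \<Sum>j<n. E (\<lambda>Z. swap_diff b i j Z * F Z))"
    by (simp add: sum_distrib_right avg_sum)
  also have "\<dots> = (\<Sum>i<n. \<Sum>j<n. E (\<lambda>Z. swap_diff b i j Z * (F Z - F (swap_units i j Z)))) / 2"
    unfolding sum_divide_distrib by (intro sum.cong refl E_swap_diff_mult) auto
  finally show ?thesis using n_pos by (simp add: field_simps)
qed

lemma E_lin_sq:
  assumes cen: "\<And>q. (\<Sum>i<n. b i q) = 0"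
  shows "E (\<lambda>Z. (lin b Z)\<^sup>2) = (\<Sum>i<n. \<Sum>j<n. E (\<lambda>Z. (swap_diff b i j Z)\<^sup>2)) / (4 * real n)"
proof -
  have "(\<Sum>i<n. \<Sum>j<n. E (\<lambda>Z. swap_diff b i j Z * (lin b Z - lin b (swap_units i j Z)))) = (\<Sum>i<n. \<Sum>j<n. E (\<lambda>Z. (swap_diff b i j Z)\<^sup>2))"
    by (intro sum.cong avg_cong refl) (simp add: lin_swap_units power2_eq_square)
  then show ?thesis
    using E_lin_mult[where F = "lin b", OF cen] by (simp add: power2_eq_square)
qed

lemma sum_nq_le: "(\<Sum>q\<in>UNIV. real (nq q) * (\<Sum>i<n. (b i q)\<^sup>2)) \<le> real n * sq_total b"
proof -
  have "real (nq q) \<le> real n" for q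
    using member_le_sum[of q UNIV nq] nq_sum by simp
  then have "(\<Sum>q\<in>UNIV. real (nq q) * (\<Sum>i<n. (b i q)\<^sup>2)) \<le> (\<Sum>q\<in>UNIV. real n * (\<Sum>i<n. (b i q)\<^sup>2))"
    by (intro sum_mono mult_right_mono sum_nonneg) auto
  also have "\<dots> = real n * sq_total b"
    unfolding sq_total_def by (subst sum.swap) (simp add: sum_distrib_left)
  finally show ?thesis .
qed

lemma E_sum_swap_diff_sq_le: "(\<Sum>i<n. \<Sum>j<n. E (\<lambda>Z. (swap_diff b i j Z)\<^sup>2)) \<le> 16 * real n * sq_total b"
proof -
  have four: "(x + y - z - w)\<^sup>2 \<le> 4 * (x\<^sup>2 + y\<^sup>2 + z\<^sup>2 + w\<^sup>2)" for x y z w :: real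
  proof -
    have "4 * (x\<^sup>2 + y\<^sup>2 + z\<^sup>2 + w\<^sup>2) - (x + y - z - w)\<^sup>2
      = (x - y)\<^sup>2 + (x + z)\<^sup>2 + (x + w)\<^sup>2 + (y + z)\<^sup>2 + (y + w)\<^sup>2 + (z - w)\<^sup>2"
      by (simp add: power2_eq_square algebra_simps)
    then show ?thesis by (smt (verit) zero_le_power2)
  qed
  let ?S = "\<Sum>q\<in>UNIV. real (nq q) * (\<Sum>i<n. (b i q)\<^sup>2)"
  let ?b2 = "\<lambda>i q. (b i q)\<^sup>2"
  have "(\<Sum>i<n. \<Sum>j<n. E (\<lambda>Z. (swap_diff b i j Z)\<^sup>2)) = E (\<lambda>Z. \<Sum>i<n. \<Sum>j<n. (swap_diff b i j Z)\<^sup>2)"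
    by (simp add: avg_sum)
  also have "\<dots> \<le> E (\<lambda>Z. 8 * real n * lin ?b2 Z + 8 * ?S)"
  proof (rule avg_mono)
    fix Z assume Z: "Z \<in> assignments n nq"
    have 1: "(\<Sum>i<n. \<Sum>j<n. ?b2 i (Z j)) = ?S"
      by (subst sum.swap) (rule sum_over_units[OF Z])
    have 2: "(\<Sum>i<n. \<Sum>j<n. ?b2 j (Z i)) = (\<Sum>i<n. \<Sum>j<n. ?b2 i (Z j))"
      by (rule sum.swap)
    have "(\<Sum>i<n. \<Sum>j<n. (swap_diff b i j Z)\<^sup>2)
        \<le> (\<Sum>i<n. \<Sum>j<n. 4 * (?b2 i (Z i) + ?b2 j (Z j) + ?b2 i (Z j) + ?b2 j (Z i)))"
      unfolding swap_diff_def by (intro sum_mono four)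
    also have "\<dots> = 4 * (real n * lin ?b2 Z + real n * lin ?b2 Z + ?S + ?S)"
      unfolding sum_distrib_left[symmetric]
      by (simp add: sum.distrib 1 2 lin_def flip: sum_distrib_left)
    finally show "(\<Sum>i<n. \<Sum>j<n. (swap_diff b i j Z)\<^sup>2) \<le> 8 * real n * lin ?b2 Z + 8 * ?S" by simp
  qed
  also have "\<dots> = 8 * real n * (?S / real n) + 8 * ?S"
    by (simp add: avg_add avg_cmult avg_const[OF fin nonempty] E_lin)
  also have "\<dots> \<le> 16 * (real n * sq_total b)"
    using n_pos sum_nq_le[of b] by simp
  finally show ?thesis by simp
qed

lemma E_lin_sq_le:
  assumes cen: "\<And>q. (\<Sum>i<n. b i q) = 0"
  shows "E (\<lambda>Z. (lin b Z)\<^sup>2) \<le> 4 * sq_total b"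
  using E_lin_sq[where b = b, OF cen] E_sum_swap_diff_sq_le[of b] n_pos by (simp add: divide_le_eq mult_ac)

lemma E_abs_lin_dev_le:
  "E (\<lambda>Z. \<bar>lin b Z - (\<Sum>q\<in>UNIV. real (nq q) * (\<Sum>i<n. b i q)) / real n\<bar>) \<le> 2 * sqrt (sq_total b)"
proof -
  define m where "m q = (\<Sum>i<n. b i q) / real n" for q
  define b' where "b' i q = b i q - m q" for i q
  have cen: "(\<Sum>i<n. b' i q) = 0" for q
    using n_pos by (simp add: b'_def m_def sum_subtractf)
  have lin': "lin b' Z = lin b Z - (\<Sum>q\<in>UNIV. real (nq q) * (\<Sum>i<n. b i q)) / real n"
    if "Z \<in> assignments n nq" for Z
    unfolding lin_def b'_def sum_subtractf sum_over_units[OF that, of m]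
    by (simp only: m_def sum_divide_distrib[where A = "UNIV :: 'k set set"] times_divide_eq_right)
  have "(\<Sum>i<n. (b' i q)\<^sup>2) = (\<Sum>i<n. (b i q)\<^sup>2) - real n * (m q)\<^sup>2" for q
  proof -
    have "(\<Sum>i<n. (b' i q)\<^sup>2) = (\<Sum>i<n. (b i q)\<^sup>2 - 2 * m q * b i q + (m q)\<^sup>2)"
      by (intro sum.cong) (auto simp: b'_def power2_diff)
    also have "\<dots> = (\<Sum>i<n. (b i q)\<^sup>2) - 2 * m q * (\<Sum>i<n. b i q) + real n * (m q)\<^sup>2"
      by (simp add: sum.distrib sum_subtractf flip: sum_distrib_left)
    also have "(\<Sum>i<n. b i q) = real n * m q" using n_pos by (simp add: m_def)
    finally show ?thesis by (simp add: power2_eq_square)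
  qed
  then have "(\<Sum>i<n. (b' i q)\<^sup>2) \<le> (\<Sum>i<n. (b i q)\<^sup>2)" for q by simp
  then have "(\<Sum>q\<in>UNIV. \<Sum>i<n. (b' i q)\<^sup>2) \<le> (\<Sum>q\<in>UNIV. \<Sum>i<n. (b i q)\<^sup>2)"
    by (rule sum_mono)
  then have V2': "sq_total b' \<le> sq_total b"
    unfolding sq_total_def by (simp add: sum.swap[of _ "UNIV :: 'k set set" "{..<n}"])
  have "E (\<lambda>Z. \<bar>lin b' Z\<bar>) \<le> sqrt (E (\<lambda>Z. (lin b' Z)\<^sup>2))"
    by (rule avg_abs_le_sqrt[OF fin nonempty])
  also have "\<dots> \<le> sqrt (4 * sq_total b)"
    using E_lin_sq_le[of b', OF cen] V2' by (intro real_sqrt_le_mono) linarith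
  also have "\<dots> = 2 * sqrt (sq_total b)" by (simp add: real_sqrt_mult)
  also have "E (\<lambda>Z. \<bar>lin b' Z\<bar>) = E (\<lambda>Z. \<bar>lin b Z - (\<Sum>q\<in>UNIV. real (nq q) * (\<Sum>i<n. b i q)) / real n\<bar>)"
    by (rule avg_cong) (simp add: lin')
  finally show ?thesis .
qed

definition asyvar :: "(nat \<Rightarrow> 'k set \<Rightarrow> real) \<Rightarrow> real" where
  "asyvar b = ((\<Sum>q\<in>UNIV. real (nq q) * (\<Sum>i<n. (b i q)\<^sup>2))
      - (\<Sum>i<n. (\<Sum>q\<in>UNIV. real (nq q) * b i q)\<^sup>2) / real n) / real n"

lemma sum_swap_diff_sq:
  assumes cen: "\<And>q. (\<Sum>i<n. b i q) = 0" and Z: "Z \<in> assignments n nq"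
  shows "(\<Sum>i<n. \<Sum>j<n. (swap_diff b i j Z)\<^sup>2) =
    2 * real n * lin (\<lambda>i q. (b i q)\<^sup>2) Z + 2 * (\<Sum>q\<in>UNIV. real (nq q) * (\<Sum>i<n. (b i q)\<^sup>2))
    + 2 * (lin b Z)\<^sup>2 + 2 * (\<Sum>i<n. \<Sum>j<n. b i (Z j) * b j (Z i))
    - 4 * lin (\<lambda>i q. b i q * (\<Sum>r\<in>UNIV. real (nq r) * b i r)) Z"
proof -
  have r1: "(\<Sum>i<n. \<Sum>j<n. (b i (Z j))\<^sup>2) = (\<Sum>q\<in>UNIV. real (nq q) * (\<Sum>i<n. (b i q)\<^sup>2))"
    by (subst sum.swap) (rule sum_over_units[OF Z])
  have r2: "(\<Sum>i<n. \<Sum>j<n. (b j (Z i))\<^sup>2) = (\<Sum>q\<in>UNIV. real (nq q) * (\<Sum>i<n. (b i q)\<^sup>2))"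
    by (subst sum.swap) (rule r1)
  have r3: "(\<Sum>i<n. \<Sum>j<n. b i (Z i) * b j (Z j)) = (lin b Z)\<^sup>2"
    by (simp add: lin_def power2_eq_square sum_product)
  have r4: "(\<Sum>i<n. \<Sum>j<n. b i (Z i) * b j (Z i)) = 0"
    by (simp add: cen flip: sum_distrib_left)
  have r5: "(\<Sum>i<n. \<Sum>j<n. b j (Z j) * b i (Z j)) = 0"
    by (subst sum.swap) (rule r4)
  have r6: "(\<Sum>i<n. \<Sum>j<n. b i (Z i) * b i (Z j)) = lin (\<lambda>i q. b i q * (\<Sum>r\<in>UNIV. real (nq r) * b i r)) Z"
    unfolding lin_def by (simp add: sum_over_units[OF Z] flip: sum_distrib_left)
  have r7: "(\<Sum>i<n. \<Sum>j<n. b j (Z j) * b j (Z i)) = lin (\<lambda>i q. b i q * (\<Sum>r\<in>UNIV. real (nq r) * b i r)) Z"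
    by (subst sum.swap) (rule r6)
  have "(swap_diff b i j Z)\<^sup>2 = (b i (Z i))\<^sup>2 + (b j (Z j))\<^sup>2 + (b i (Z j))\<^sup>2 + (b j (Z i))\<^sup>2
      + 2 * (b i (Z i) * b j (Z j)) + 2 * (b i (Z j) * b j (Z i))
      - 2 * (b i (Z i) * b i (Z j)) - 2 * (b i (Z i) * b j (Z i))
      - 2 * (b j (Z j) * b i (Z j)) - 2 * (b j (Z j) * b j (Z i))" for i j
    by (simp add: swap_diff_def power2_eq_square algebra_simps)
  then have "(\<Sum>i<n. \<Sum>j<n. (swap_diff b i j Z)\<^sup>2) =
      (\<Sum>i<n. \<Sum>j<n. (b i (Z i))\<^sup>2 + (b j (Z j))\<^sup>2) + (\<Sum>i<n. \<Sum>j<n. (b i (Z j))\<^sup>2) + (\<Sum>i<n. \<Sum>j<n. (b j (Z i))\<^sup>2)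
      + 2 * (\<Sum>i<n. \<Sum>j<n. b i (Z i) * b j (Z j)) + 2 * (\<Sum>i<n. \<Sum>j<n. b i (Z j) * b j (Z i))
      - 2 * (\<Sum>i<n. \<Sum>j<n. b i (Z i) * b i (Z j)) - 2 * (\<Sum>i<n. \<Sum>j<n. b i (Z i) * b j (Z i))
      - 2 * (\<Sum>i<n. \<Sum>j<n. b j (Z j) * b i (Z j)) - 2 * (\<Sum>i<n. \<Sum>j<n. b j (Z j) * b j (Z i))"
    by (simp add: sum.distrib sum_subtractf flip: sum_distrib_left)
  also have "(\<Sum>i<n. \<Sum>j<n. (b i (Z i))\<^sup>2 + (b j (Z j))\<^sup>2) = 2 * real n * lin (\<lambda>i q. (b i q)\<^sup>2) Z"
    by (simp add: sum.distrib lin_def flip: sum_distrib_left)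
  finally show ?thesis
    unfolding r1 r2 r3 r4 r5 r6 r7 by simp
qed

lemma E_abs_cross_le:
  assumes cen: "\<And>q. (\<Sum>i<n. b i q) = 0"
  shows "E (\<lambda>Z. \<bar>\<Sum>i<n. \<Sum>j<n. b i (Z j) * b j (Z i)\<bar>) \<le> 4 * real (CARD('k set)) * sq_total b"
proof -
  define a where "a q r = (\<lambda>i s. if s = q then b i r else 0 :: real)" for q r :: "'k set"
  have acen: "(\<Sum>i<n. a q r i s) = 0" for q r s
    by (cases "s = q") (simp_all add: a_def cen)
  have "(\<Sum>i<n. \<Sum>j<n. b i (Z j) * b j (Z i)) = (\<Sum>q\<in>UNIV. \<Sum>r\<in>UNIV. lin (a q r) Z * lin (a r q) Z)" for Z
  proof -
    have "(\<Sum>q\<in>UNIV. \<Sum>r\<in>UNIV. lin (a q r) Z * lin (a r q) Z)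
      = (\<Sum>q\<in>UNIV. \<Sum>r\<in>UNIV. \<Sum>i<n. \<Sum>j<n. a q r i (Z i) * a r q j (Z j))"
      by (simp add: lin_def sum_product)
    also have "\<dots> = (\<Sum>i<n. \<Sum>j<n. \<Sum>q\<in>UNIV. \<Sum>r\<in>UNIV. a q r i (Z i) * a r q j (Z j))"
    proof -
      have "(\<Sum>q\<in>UNIV. \<Sum>r\<in>UNIV. \<Sum>i<n. \<Sum>j<n. a q r i (Z i) * a r q j (Z j))
        = (\<Sum>q\<in>UNIV. \<Sum>i<n. \<Sum>r\<in>UNIV. \<Sum>j<n. a q r i (Z i) * a r q j (Z j))"
        by (intro sum.cong refl sum.swap)
      also have "\<dots> = (\<Sum>i<n. \<Sum>q\<in>UNIV. \<Sum>r\<in>UNIV. \<Sum>j<n. a q r i (Z i) * a r q j (Z j))"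
        by (rule sum.swap)
      also have "\<dots> = (\<Sum>i<n. \<Sum>q\<in>UNIV. \<Sum>j<n. \<Sum>r\<in>UNIV. a q r i (Z i) * a r q j (Z j))"
        by (intro sum.cong refl sum.swap)
      also have "\<dots> = (\<Sum>i<n. \<Sum>j<n. \<Sum>q\<in>UNIV. \<Sum>r\<in>UNIV. a q r i (Z i) * a r q j (Z j))"
        by (intro sum.cong refl sum.swap)
      finally show ?thesis .
    qed
    also have "\<dots> = (\<Sum>i<n. \<Sum>j<n. b i (Z j) * b j (Z i))"
    proof (intro sum.cong refl)
      fix i j
      have "(\<Sum>q\<in>UNIV. \<Sum>r\<in>UNIV. a q r i (Z i) * a r q j (Z j))
         = (\<Sum>q\<in>UNIV. if Z i = q then (\<Sum>r\<in>UNIV. if Z j = r then b i r * b j q else 0) else 0)"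
      proof (rule sum.cong[OF refl])
        fix q
        show "(\<Sum>r\<in>UNIV. a q r i (Z i) * a r q j (Z j))
          = (if Z i = q then (\<Sum>r\<in>UNIV. if Z j = r then b i r * b j q else 0) else 0)"
        proof (cases "Z i = q")
          case True
          have "a q r i (Z i) * a r q j (Z j) = (if Z j = r then b i r * b j q else 0)" for r
            by (simp add: a_def True)
          then show ?thesis using True by simp
        qed (simp add: a_def)
      qed
      then show "(\<Sum>q\<in>UNIV. \<Sum>r\<in>UNIV. a q r i (Z i) * a r q j (Z j)) = b i (Z j) * b j (Z i)"
        by (simp only: sum.delta' finite UNIV_I if_True)
    qed
    finally show ?thesis by simp
  qed
  note eq = this
  have "E (\<lambda>Z. \<bar>\<Sum>i<n. \<Sum>j<n. b i (Z j) * b j (Z i)\<bar>)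
      \<le> E (\<lambda>Z. \<Sum>q\<in>UNIV. \<Sum>r\<in>UNIV. (lin (a q r) Z)\<^sup>2 / 2 + (lin (a r q) Z)\<^sup>2 / 2)"
  proof (rule avg_mono)
    fix Z
    have xy: "\<bar>x * y\<bar> \<le> x\<^sup>2 / 2 + y\<^sup>2 / 2" for x y :: real
      using sum_squares_bound[of "\<bar>x\<bar>" "\<bar>y\<bar>"] by (simp add: abs_mult)
    show "\<bar>\<Sum>i<n. \<Sum>j<n. b i (Z j) * b j (Z i)\<bar>
      \<le> (\<Sum>q\<in>UNIV. \<Sum>r\<in>UNIV. (lin (a q r) Z)\<^sup>2 / 2 + (lin (a r q) Z)\<^sup>2 / 2)"
      unfolding eq by (intro order_trans[OF sum_abs] sum_mono order_trans[OF sum_abs] xy)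
  qed
  also have "\<dots> = E (\<lambda>Z. \<Sum>q\<in>UNIV. \<Sum>r\<in>UNIV. (lin (a q r) Z)\<^sup>2)"
  proof (rule avg_cong)
    fix Z
    have "(\<Sum>q\<in>UNIV. \<Sum>r\<in>UNIV. (lin (a r q) Z)\<^sup>2 / 2) = (\<Sum>q\<in>UNIV. \<Sum>r\<in>UNIV. (lin (a q r) Z)\<^sup>2 / 2)"
      by (rule sum.swap)
    then show "(\<Sum>q\<in>UNIV. \<Sum>r\<in>UNIV. (lin (a q r) Z)\<^sup>2 / 2 + (lin (a r q) Z)\<^sup>2 / 2)
      = (\<Sum>q\<in>UNIV. \<Sum>r\<in>UNIV. (lin (a q r) Z)\<^sup>2)"
      by (simp add: sum.distrib flip: sum_divide_distrib)
  qed
  also have "\<dots> \<le> (\<Sum>q\<in>(UNIV::'k set set). \<Sum>r\<in>UNIV. 4 * sq_total (a q r))"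
    unfolding avg_sum by (intro sum_mono E_lin_sq_le acen)
  also have "\<dots> = (\<Sum>q\<in>(UNIV::'k set set). 4 * sq_total b)"
  proof (intro sum.cong refl)
    fix q :: "'k set"
    have "sq_total (a q r) = (\<Sum>i<n. (b i r)\<^sup>2)" for r
      unfolding sq_total_def a_def by (intro sum.cong refl) (simp add: if_distrib[where f = "\<lambda>x. x\<^sup>2"] cong: if_cong)
    then show "(\<Sum>r\<in>UNIV. 4 * sq_total (a q r)) = 4 * sq_total b"
      unfolding sq_total_def by (simp add: sum.swap[of _ "UNIV :: 'k set set" "{..<n}"] flip: sum_distrib_left)
  qed
  also have "\<dots> = 4 * real (CARD('k set)) * sq_total b" by simp
  finally show ?thesis .
qed

lemma E_abs_quad_dev_le:
  assumes cen: "\<And>q. (\<Sum>i<n. b i q) = 0" and bd: "\<And>i q. i < n \<Longrightarrow> \<bar>b i q\<bar> \<le> \<delta>"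
  shows "E (\<lambda>Z. \<bar>(\<Sum>i<n. \<Sum>j<n. (swap_diff b i j Z)\<^sup>2) / (4 * real n) - asyvar b\<bar>)
    \<le> 3 * \<delta> * sqrt (sq_total b) + (2 + 2 * real (CARD('k set))) * sq_total b / real n"
proof -
  have d0: "0 \<le> \<delta>" using bd[OF n_pos] abs_ge_zero order_trans by blast
  define c where "c i = (\<Sum>q\<in>UNIV. real (nq q) * b i q)" for i
  have c_le: "\<bar>c i\<bar> \<le> real n * \<delta>" if "i < n" for i
  proof -
    have "\<bar>c i\<bar> \<le> (\<Sum>q\<in>UNIV. real (nq q) * \<delta>)"
      unfolding c_def using bd[OF that]
      by (intro order_trans[OF sum_abs] sum_mono) (simp add: abs_mult mult_left_mono)
    also have "\<dots> = real n * \<delta>" using nq_sum by (simp flip: sum_distrib_right of_nat_sum)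
    finally show ?thesis .
  qed
  define b1 where "b1 i q = (b i q)\<^sup>2" for i q
  define b2 where "b2 i q = b i q * (c i / real n)" for i q
  define e1 where "e1 = (\<Sum>q\<in>UNIV. real (nq q) * (\<Sum>i<n. b1 i q)) / real n"
  define e2 where "e2 = (\<Sum>q\<in>UNIV. real (nq q) * (\<Sum>i<n. b2 i q)) / real n"
  have V_mult: "sq_total (\<lambda>i q. b i q * d i q) \<le> \<delta>\<^sup>2 * sq_total b"
    if "\<And>i q. i < n \<Longrightarrow> \<bar>d i q\<bar> \<le> \<delta>" for d
    unfolding sq_total_def sum_distrib_left
  proof (intro sum_mono)
    fix i q assume "i \<in> {..<n}"
    then have "(d i q)\<^sup>2 \<le> \<delta>\<^sup>2" using power_mono[OF that[of i q], of 2] by simp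
    then show "(b i q * d i q)\<^sup>2 \<le> \<delta>\<^sup>2 * (b i q)\<^sup>2"
      by (metis power_mult_distrib mult.commute mult_right_mono zero_le_power2)
  qed
  have b1: "2 * sqrt (sq_total b1) \<le> 2 * \<delta> * sqrt (sq_total b)"
  proof -
    have "sq_total b1 \<le> \<delta>\<^sup>2 * sq_total b"
      using V_mult[of b] bd by (simp add: b1_def[abs_def] power2_eq_square)
    then have "sqrt (sq_total b1) \<le> \<delta> * sqrt (sq_total b)"
      using d0 by (metis real_sqrt_le_mono real_sqrt_mult real_sqrt_abs abs_of_nonneg)
    then show ?thesis by simp
  qed
  have b2: "2 * sqrt (sq_total b2) \<le> 2 * \<delta> * sqrt (sq_total b)"
  proof -
    have "\<bar>c i / real n\<bar> \<le> \<delta>" if "i < n" for i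
      using c_le[OF that] n_pos by (simp add: field_simps)
    then have "sq_total b2 \<le> \<delta>\<^sup>2 * sq_total b"
      using V_mult[of "\<lambda>i q. c i / real n"] by (simp add: b2_def[abs_def])
    then have "sqrt (sq_total b2) \<le> \<delta> * sqrt (sq_total b)"
      using d0 by (metis real_sqrt_le_mono real_sqrt_mult real_sqrt_abs abs_of_nonneg)
    then show ?thesis by simp
  qed
  have e2: "e2 = (\<Sum>i<n. (c i)\<^sup>2) / (real n)\<^sup>2"
  proof -
    have "(\<Sum>q\<in>UNIV. real (nq q) * (\<Sum>i<n. b2 i q)) = (\<Sum>i<n. \<Sum>q\<in>UNIV. real (nq q) * b i q * (c i / real n))"
      unfolding sum_distrib_left by (subst sum.swap) (simp add: b2_def mult.assoc)
    also have "\<dots> = (\<Sum>i<n. (c i)\<^sup>2 / real n)"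
      unfolding sum_distrib_right[symmetric] c_def[symmetric] by (simp add: power2_eq_square)
    finally show ?thesis by (simp add: e2_def power2_eq_square flip: sum_divide_distrib)
  qed
  have asy: "asyvar b = e1 - e2"
    unfolding asyvar_def e2 e1_def b1_def c_def[symmetric]
    by (simp add: diff_divide_distrib power2_eq_square)
  have pt: "\<bar>(\<Sum>i<n. \<Sum>j<n. (swap_diff b i j Z)\<^sup>2) / (4 * real n) - asyvar b\<bar>
     \<le> (1/2) * \<bar>lin b1 Z - e1\<bar> + \<bar>lin b2 Z - e2\<bar> + (1 / (2 * real n)) * (lin b Z)\<^sup>2
       + (1 / (2 * real n)) * \<bar>\<Sum>i<n. \<Sum>j<n. b i (Z j) * b j (Z i)\<bar>"
    if Z: "Z \<in> assignments n nq" for Z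
  proof -
    have l: "lin (\<lambda>i q. b i q * (\<Sum>r\<in>UNIV. real (nq r) * b i r)) Z = real n * lin b2 Z"
    proof -
      have "lin (\<lambda>i q. b i q * c i) Z = real n * lin b2 Z"
        unfolding lin_def b2_def sum_distrib_left using n_pos by (intro sum.cong) auto
      then show ?thesis by (simp add: c_def)
    qed
    have s: "(\<Sum>q\<in>UNIV. real (nq q) * (\<Sum>i<n. (b i q)\<^sup>2)) = real n * e1"
      using n_pos by (simp add: e1_def b1_def)
    have eq: "(\<Sum>i<n. \<Sum>j<n. (swap_diff b i j Z)\<^sup>2) / (4 * real n) - asyvar b
      = (1/2) * (lin b1 Z - e1) - (lin b2 Z - e2) + (1 / (2 * real n)) * (lin b Z)\<^sup>2
       + (1 / (2 * real n)) * (\<Sum>i<n. \<Sum>j<n. b i (Z j) * b j (Z i))"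
      unfolding sum_swap_diff_sq[where b = b, OF cen Z] l s asy unfolding b1_def[symmetric]
      using n_pos by (simp add: field_simps)
    have eq2: "(1 / (2 * real n)) * \<bar>\<Sum>i<n. \<Sum>j<n. b i (Z j) * b j (Z i)\<bar>
      = \<bar>(1 / (2 * real n)) * (\<Sum>i<n. \<Sum>j<n. b i (Z j) * b j (Z i))\<bar>"
      by (simp add: abs_mult)
    have bnd: "\<bar>(1/2) * x - y + u + w\<bar> \<le> (1/2) * \<bar>x\<bar> + \<bar>y\<bar> + u + \<bar>w\<bar>" if "0 \<le> u" for x y u w :: real
      using that by linarith
    show ?thesis unfolding eq eq2 by (rule bnd) simp
  qed
  have "E (\<lambda>Z. \<bar>(\<Sum>i<n. \<Sum>j<n. (swap_diff b i j Z)\<^sup>2) / (4 * real n) - asyvar b\<bar>)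
     \<le> E (\<lambda>Z. (1/2) * \<bar>lin b1 Z - e1\<bar> + \<bar>lin b2 Z - e2\<bar> + (1 / (2 * real n)) * (lin b Z)\<^sup>2
       + (1 / (2 * real n)) * \<bar>\<Sum>i<n. \<Sum>j<n. b i (Z j) * b j (Z i)\<bar>)"
    by (rule avg_mono) (rule pt)
  also have "\<dots> = (1/2) * E (\<lambda>Z. \<bar>lin b1 Z - e1\<bar>) + E (\<lambda>Z. \<bar>lin b2 Z - e2\<bar>)
      + (1 / (2 * real n)) * E (\<lambda>Z. (lin b Z)\<^sup>2)
      + (1 / (2 * real n)) * E (\<lambda>Z. \<bar>\<Sum>i<n. \<Sum>j<n. b i (Z j) * b j (Z i)\<bar>)"
    by (simp only: avg_add avg_cmult)
  also have "\<dots> \<le> (1/2) * (2 * \<delta> * sqrt (sq_total b)) + 2 * \<delta> * sqrt (sq_total b)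
      + (1 / (2 * real n)) * (4 * sq_total b) + (1 / (2 * real n)) * (4 * real (CARD('k set)) * sq_total b)"
    using E_abs_lin_dev_le[of b1] E_abs_lin_dev_le[of b2] b1 b2 unfolding e1_def[symmetric] e2_def[symmetric]
    by (intro add_mono mult_left_mono E_lin_sq_le cen E_abs_cross_le) auto
  also have "\<dots> = 3 * \<delta> * sqrt (sq_total b) + (2 + 2 * real (CARD('k set))) * sq_total b / real n"
    using n_pos by (simp add: field_simps)
  finally show ?thesis .
qed

theorem E_cos_lin:
  assumes cen: "\<And>q. (\<Sum>i<n. b i q) = 0" and bd: "\<And>i q. i < n \<Longrightarrow> \<bar>b i q\<bar> \<le> \<delta>"
    and asy_nonneg: "0 \<le> asyvar b"
  shows "\<bar>E (\<lambda>Z. cos (lin b Z + c)) - exp (- asyvar b / 2) * cos c\<bar>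
    \<le> 8 * \<delta> * sq_total b + (3 * \<delta> * sqrt (sq_total b) + (2 + 2 * real (CARD('k set))) * sq_total b / real n)"
    (is "_ \<le> ?e1 + ?e2")
proof -
  have d0: "0 \<le> \<delta>" using bd[OF n_pos] abs_ge_zero order_trans by blast
  define T where "T = lin b"
  define U where "U Z = (\<Sum>i<n. \<Sum>j<n. (swap_diff b i j Z)\<^sup>2) / (4 * real n)" for Z
  define f where "f s = E (\<lambda>Z. cos (s * T Z + c))" for s
  define f' where "f' s = - E (\<lambda>Z. T Z * sin (s * T Z + c))" for s
  have deriv: "(f has_real_derivative f' s) (at s)" for s
    unfolding f_def f'_def avg_def sum_divide_distrib sum_negf[symmetric] minus_divide_left
    by (rule DERIV_sum) (auto intro!: derivative_eq_intros simp: fin nonempty)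
  have swap_diff_le: "\<bar>swap_diff b i j Z\<bar> \<le> 4 * \<delta>" if "i < n" "j < n" for i j Z
    using bd[OF that(1), of "Z i"] bd[OF that(1), of "Z j"] bd[OF that(2), of "Z i"] bd[OF that(2), of "Z j"]
    unfolding swap_diff_def by linarith
  have step1: "\<bar>E (\<lambda>Z. T Z * sin (s * T Z + c)) - s * E (\<lambda>Z. U Z * cos (s * T Z + c))\<bar> \<le> ?e1"
    if s: "0 \<le> s" "s \<le> 1" for s
  proof -
    let ?F = "\<lambda>Z. sin (s * T Z + c)"
    let ?R = "\<lambda>i j Z. swap_diff b i j Z * (?F Z - ?F (swap_units i j Z)) - s * (swap_diff b i j Z)\<^sup>2 * cos (s * T Z + c)"
    have U: "s * E (\<lambda>Z. U Z * cos (s * T Z + c)) = (\<Sum>i<n. \<Sum>j<n. E (\<lambda>Z. s * (swap_diff b i j Z)\<^sup>2 * cos (s * T Z + c))) / (4 * real n)"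
      unfolding avg_sum[symmetric] avg_cmult[symmetric] U_def
      by (simp add: sum_distrib_left sum_distrib_right sum_divide_distrib mult.assoc avg_def)
         (simp add: sum_divide_distrib sum_distrib_left mult_ac)
    have eq: "E (\<lambda>Z. T Z * ?F Z) - s * E (\<lambda>Z. U Z * cos (s * T Z + c))
      = (\<Sum>i<n. \<Sum>j<n. E (?R i j)) / (4 * real n)"
      unfolding U unfolding T_def E_lin_mult[where b = b, OF cen] by (simp add: avg_diff sum_subtractf diff_divide_distrib)
    have "\<bar>(\<Sum>i<n. \<Sum>j<n. E (?R i j)) / (4 * real n)\<bar>
      \<le> (\<Sum>i<n. \<Sum>j<n. E (\<lambda>Z. 2 * \<delta> * (swap_diff b i j Z)\<^sup>2)) / (4 * real n)"
      unfolding abs_divide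
    proof (simp only: abs_of_nonneg[of "4 * real n"] of_nat_0_le_iff zero_le_numeral mult_nonneg_nonneg,
        intro divide_right_mono order_trans[OF sum_abs] sum_mono order_trans[OF abs_avg_le] avg_mono)
      fix i j Z assume ij: "i \<in> {..<n}" "j \<in> {..<n}"
      let ?d = "swap_diff b i j Z" let ?x = "s * T Z + c"
      have "?F (swap_units i j Z) = sin (?x - s * ?d)"
        using ij by (simp add: T_def lin_swap_units algebra_simps)
      then have "?R i j Z = ?d * (sin ?x - sin (?x - s * ?d) - (s * ?d) * cos ?x)"
        by (simp add: power2_eq_square algebra_simps)
      then have "\<bar>?R i j Z\<bar> = \<bar>?d\<bar> * \<bar>sin ?x - sin (?x - s * ?d) - (s * ?d) * cos ?x\<bar>"
        by (simp add: abs_mult)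
      also have "\<dots> \<le> (4 * \<delta>) * ((s * ?d)\<^sup>2 / 2)"
        using ij d0 by (intro mult_mono swap_diff_le sin_diff_taylor) auto
      also have "(s * ?d)\<^sup>2 \<le> ?d\<^sup>2"
        using s by (simp add: power_mult_distrib mult_left_le_one_le power_le_one)
      then have "(4 * \<delta>) * ((s * ?d)\<^sup>2 / 2) \<le> 2 * \<delta> * ?d\<^sup>2"
        using d0 by (simp add: mult_left_mono)
      finally show "\<bar>?R i j Z\<bar> \<le> 2 * \<delta> * ?d\<^sup>2" .
    qed simp
    also have "\<dots> = 2 * \<delta> * ((\<Sum>i<n. \<Sum>j<n. E (\<lambda>Z. (swap_diff b i j Z)\<^sup>2)) / (4 * real n))"
      by (simp only: avg_cmult sum_distrib_left[symmetric] times_divide_eq_right)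
    also have "\<dots> \<le> 2 * \<delta> * (4 * sq_total b)"
      unfolding E_lin_sq[where b = b, OF cen, symmetric] using d0 by (intro mult_left_mono E_lin_sq_le cen) auto
    finally show ?thesis unfolding eq by simp
  qed
  have step2: "\<bar>s * E (\<lambda>Z. U Z * cos (s * T Z + c)) - s * asyvar b * f s\<bar> \<le> ?e2"
    if s: "0 \<le> s" "s \<le> 1" for s
  proof -
    have eq: "s * E (\<lambda>Z. U Z * cos (s * T Z + c)) - s * asyvar b * f s
      = E (\<lambda>Z. s * ((U Z - asyvar b) * cos (s * T Z + c)))"
      unfolding f_def by (simp add: left_diff_distrib right_diff_distrib avg_diff avg_cmult mult.assoc)
    have "\<bar>E (\<lambda>Z. s * ((U Z - asyvar b) * cos (s * T Z + c)))\<bar> \<le> E (\<lambda>Z. \<bar>U Z - asyvar b\<bar>)"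
    proof (intro order_trans[OF abs_avg_le] avg_mono)
      fix Z
      have "\<bar>s\<bar> * (\<bar>U Z - asyvar b\<bar> * \<bar>cos (s * T Z + c)\<bar>) \<le> 1 * (\<bar>U Z - asyvar b\<bar> * 1)"
        using s by (intro mult_mono) auto
      then show "\<bar>s * ((U Z - asyvar b) * cos (s * T Z + c))\<bar> \<le> \<bar>U Z - asyvar b\<bar>"
        by (simp add: abs_mult)
    qed
    also have "\<dots> \<le> ?e2"
      unfolding U_def by (rule E_abs_quad_dev_le[where b = b, OF cen bd])
    finally show ?thesis unfolding eq .
  qed
  have ode: "\<bar>f' s + s * asyvar b * f s\<bar> \<le> ?e1 + ?e2" if "0 \<le> s" "s \<le> 1" for s
    using step1[OF that] step2[OF that] unfolding f'_def by linarith
  define h where "h s = exp (s\<^sup>2 * asyvar b / 2) * f s" for s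
  have hderiv: "(h has_real_derivative exp (s\<^sup>2 * asyvar b / 2) * (f' s + s * asyvar b * f s)) (at s)" for s
    unfolding h_def by (auto intro!: derivative_eq_intros deriv simp: algebra_simps)
  obtain s where s: "0 < s" "s < 1" "h 1 - h 0 = (1 - 0) * (exp (s\<^sup>2 * asyvar b / 2) * (f' s + s * asyvar b * f s))"
    using MVT2[of 0 1 h "\<lambda>s. exp (s\<^sup>2 * asyvar b / 2) * (f' s + s * asyvar b * f s)"] hderiv by auto
  have "\<bar>h 1 - h 0\<bar> = exp (s\<^sup>2 * asyvar b / 2) * \<bar>f' s + s * asyvar b * f s\<bar>"
    unfolding s(3) by (simp add: abs_mult)
  also have "\<dots> \<le> exp (asyvar b / 2) * (?e1 + ?e2)"
    using s(1,2) asy_nonneg by (intro mult_mono ode) (auto simp: mult_left_le_one_le power_le_one)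
  finally have "\<bar>h 1 - h 0\<bar> \<le> exp (asyvar b / 2) * (?e1 + ?e2)" .
  moreover have "h 0 = cos c" by (simp add: h_def f_def avg_const[OF fin nonempty])
  moreover have "h 1 = exp (asyvar b / 2) * E (\<lambda>Z. cos (lin b Z + c))" by (simp add: h_def f_def T_def)
  ultimately have "exp (- asyvar b / 2) * \<bar>exp (asyvar b / 2) * E (\<lambda>Z. cos (lin b Z + c)) - cos c\<bar>
     \<le> exp (- asyvar b / 2) * (exp (asyvar b / 2) * (?e1 + ?e2))"
    by (intro mult_left_mono) auto
  moreover have "exp (- asyvar b / 2) * \<bar>exp (asyvar b / 2) * E (\<lambda>Z. cos (lin b Z + c)) - cos c\<bar>
     = \<bar>E (\<lambda>Z. cos (lin b Z + c)) - exp (- asyvar b / 2) * cos c\<bar>"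
  proof -
    have "exp (- asyvar b / 2) * (exp (asyvar b / 2) * E (\<lambda>Z. cos (lin b Z + c)) - cos c)
      = E (\<lambda>Z. cos (lin b Z + c)) - exp (- asyvar b / 2) * cos c"
      by (simp add: right_diff_distrib mult.assoc[symmetric] exp_add[symmetric])
    then show ?thesis by (metis abs_mult abs_exp_cancel)
  qed
  moreover have "exp (- asyvar b / 2) * (exp (asyvar b / 2) * (?e1 + ?e2)) = ?e1 + ?e2"
    by (simp add: mult.assoc[symmetric] exp_add[symmetric])
  ultimately show ?thesis by linarith
qed

end

lemma (in crfe_design) asyvar_nonneg: "0 \<le> asyvar b"
proof -
  have "(\<Sum>q\<in>UNIV. real (nq q) * b i q)\<^sup>2 / real n \<le> (\<Sum>q\<in>UNIV. real (nq q) * (b i q)\<^sup>2)" for i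
  proof -
    define m where "m = (\<Sum>q\<in>UNIV. real (nq q) * b i q) / real n"
    have s: "(\<Sum>q\<in>UNIV. real (nq q) * b i q) = real n * m"
      using n_pos by (simp add: m_def)
    have "0 \<le> (\<Sum>q\<in>UNIV. real (nq q) * (b i q - m)\<^sup>2)"
      by (intro sum_nonneg) auto
    also have "\<dots> = (\<Sum>q\<in>UNIV. real (nq q) * (b i q)\<^sup>2 - 2 * m * (real (nq q) * b i q) + m\<^sup>2 * real (nq q))"
      by (intro sum.cong refl) (simp add: power2_eq_square algebra_simps)
    also have "\<dots> = (\<Sum>q\<in>UNIV. real (nq q) * (b i q)\<^sup>2) - 2 * m * (real n * m) + m\<^sup>2 * real n"
      unfolding sum.distrib sum_subtractf sum_distrib_left[symmetric] s using nq_sum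
      by (simp flip: of_nat_sum)
    finally show ?thesis unfolding s using n_pos by (simp add: power2_eq_square mult_ac)
  qed
  then have "(\<Sum>i<n. (\<Sum>q\<in>UNIV. real (nq q) * b i q)\<^sup>2 / real n) \<le> (\<Sum>i<n. \<Sum>q\<in>UNIV. real (nq q) * (b i q)\<^sup>2)"
    by (rule sum_mono)
  also have "\<dots> = (\<Sum>q\<in>UNIV. real (nq q) * (\<Sum>i<n. (b i q)\<^sup>2))"
    by (subst sum.swap) (simp add: sum_distrib_left)
  finally show ?thesis
    unfolding asyvar_def by (simp add: sum_divide_distrib)
qed

definition group_dev :: "nat \<Rightarrow> ('k set \<Rightarrow> nat) \<Rightarrow> (nat \<Rightarrow> 'v \<Rightarrow> real) \<Rightarrow> (nat \<Rightarrow> 'k set) \<Rightarrow> 'k set \<Rightarrow> 'v \<Rightarrow> real" where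
  "group_dev n nq P Z q v = sqrt (real n) *
     ((\<Sum>i\<in>{i\<in>{..<n}. Z i = q}. P i v) / real (nq q) - pmean n (\<lambda>i. P i v))"

definition asy_cov :: "('k::finite set \<Rightarrow> real) \<Rightarrow> ('v::finite \<Rightarrow> 'v \<Rightarrow> real) \<Rightarrow> ('k set \<Rightarrow> 'v \<Rightarrow> real) \<Rightarrow> ('k set \<Rightarrow> 'v \<Rightarrow> real) \<Rightarrow> real" where
  "asy_cov e S u w = (\<Sum>q\<in>UNIV. (\<Sum>v\<in>UNIV. \<Sum>v'\<in>UNIV. u q v * w q v' * S v v') / e q)
     - (\<Sum>v\<in>UNIV. \<Sum>v'\<in>UNIV. (\<Sum>q\<in>UNIV. u q v) * (\<Sum>q\<in>UNIV. w q v') * S v v')"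

lemma pmean_centred: "n > 0 \<Longrightarrow> (\<Sum>i<n. u i - pmean n u) = 0"
  by (simp add: pmean_def sum_subtractf)

lemma sum_sq_lincomb_pcov:
  assumes "n \<ge> 2"
  shows "(\<Sum>i<n. (\<Sum>v\<in>(UNIV::'v::finite set). u v * (P i v - pmean n (\<lambda>i. P i v)))\<^sup>2)
    = (real n - 1) * (\<Sum>v\<in>UNIV. \<Sum>v'\<in>UNIV. u v * u v' * pcov n (\<lambda>i. P i v) (\<lambda>i. P i v'))"
proof -
  define d where "d i v = P i v - pmean n (\<lambda>i. P i v)" for i v
  have "(\<Sum>i<n. (\<Sum>v\<in>UNIV. u v * d i v)\<^sup>2) = (\<Sum>i<n. \<Sum>v\<in>UNIV. \<Sum>v'\<in>UNIV. u v * u v' * (d i v * d i v'))"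
    by (simp add: power2_eq_square sum_product mult_ac)
  also have "\<dots> = (\<Sum>v\<in>UNIV. \<Sum>v'\<in>UNIV. \<Sum>i<n. u v * u v' * (d i v * d i v'))"
    by (subst sum.swap, intro sum.cong refl, subst sum.swap) simp
  also have "\<dots> = (\<Sum>v\<in>UNIV. \<Sum>v'\<in>UNIV. (real n - 1) * (u v * u v' * pcov n (\<lambda>i. P i v) (\<lambda>i. P i v')))"
    using assms by (intro sum.cong refl) (simp add: pcov_def d_def flip: sum_distrib_left)
  finally show ?thesis by (simp add: d_def sum_distrib_left)
qed

locale crfe_seq =
  fixes nq :: "nat \<Rightarrow> 'k::finite set \<Rightarrow> nat" and P :: "nat \<Rightarrow> nat \<Rightarrow> 'v::finite \<Rightarrow> real"
    and e :: "'k set \<Rightarrow> real" and S :: "'v \<Rightarrow> 'v \<Rightarrow> real" and m :: "nat \<Rightarrow> real"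
  assumes design: "\<forall>\<^sub>F n in sequentially. (\<forall>q. nq n q \<ge> 1) \<and> (\<Sum>q\<in>UNIV. nq n q) = n"
    and e_pos: "\<And>q. e q > 0"
    and nq_lim: "\<And>q. (\<lambda>n. real (nq n q) / real n) \<longlonglongrightarrow> e q"
    and S_lim: "\<And>v v'. (\<lambda>n. pcov n (\<lambda>i. P n i v) (\<lambda>i. P n i v')) \<longlonglongrightarrow> S v v'"
    and m_lim: "m \<longlonglongrightarrow> 0"
    and m_bound: "\<forall>\<^sub>F n in sequentially. \<forall>i<n. \<forall>v. (P n i v - pmean n (\<lambda>i. P n i v))\<^sup>2 \<le> real n * m n"
begin

abbreviation "EE n \<equiv> avg (assignments n (nq n))"
abbreviation "X n \<equiv> group_dev n (nq n) (P n)"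

definition coef :: "('k set \<Rightarrow> 'v \<Rightarrow> real) \<Rightarrow> nat \<Rightarrow> nat \<Rightarrow> 'k set \<Rightarrow> real" where
  "coef u n i q = sqrt (real n) / real (nq n q) * (\<Sum>v\<in>UNIV. u q v * (P n i v - pmean n (\<lambda>i. P n i v)))"

lemma good: "\<forall>\<^sub>F n in sequentially. n \<ge> 2 \<and> (\<forall>q. nq n q \<ge> 1) \<and> crfe_design n (nq n)"
  using design eventually_ge_at_top[of 2] by eventually_elim (auto simp: crfe_design_def)

lemma inv_lim: "(\<lambda>n. real n / real (nq n q)) \<longlonglongrightarrow> 1 / e q"
  using tendsto_inverse[OF nq_lim[of q]] e_pos[of q] by (simp add: inverse_eq_divide)

lemma coef_centred: "n \<ge> 2 \<Longrightarrow> (\<Sum>i<n. coef u n i q) = 0"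
  unfolding coef_def sum_distrib_left[symmetric]
  by (subst sum.swap) (simp add: pmean_centred flip: sum_distrib_left)

lemma sum_group_dev_eq_lin:
  assumes d: "crfe_design n (nq n)" and pos: "\<And>q. nq n q \<ge> 1" and Z: "Z \<in> assignments n (nq n)"
  shows "(\<Sum>q\<in>UNIV. \<Sum>v\<in>UNIV. u q v * X n Z q v) = crfe_design.lin n (coef u n) Z"
proof -
  interpret crfe_design n "nq n" by fact
  have "lin (coef u n) Z = (\<Sum>q\<in>UNIV. \<Sum>i\<in>{i\<in>{..<n}. Z i = q}. coef u n i (Z i))"
    unfolding lin_def by (rule sum.group[symmetric]) auto
  also have "\<dots> = (\<Sum>q\<in>UNIV. \<Sum>v\<in>UNIV. u q v * X n Z q v)"
  proof (rule sum.cong[OF refl])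
    fix q
    have c: "card {i\<in>{..<n}. Z i = q} = nq n q" using Z by (simp add: assignments_def)
    have X: "X n Z q v = sqrt (real n) / real (nq n q) * (\<Sum>i\<in>{i\<in>{..<n}. Z i = q}. P n i v - pmean n (\<lambda>i. P n i v))" for v
      using pos[of q] by (simp add: group_dev_def sum_subtractf c[simplified] right_diff_distrib diff_divide_distrib)
    have "(\<Sum>i\<in>{i\<in>{..<n}. Z i = q}. coef u n i (Z i)) = (\<Sum>i\<in>{i\<in>{..<n}. Z i = q}. coef u n i q)"
      by (rule sum.cong) auto
    also have "\<dots> = (\<Sum>v\<in>UNIV. u q v * X n Z q v)"
      unfolding coef_def X sum_distrib_left
      by (subst sum.swap) (simp add: mult_ac)
    finally show "(\<Sum>i\<in>{i\<in>{..<n}. Z i = q}. coef u n i (Z i)) = (\<Sum>v\<in>UNIV. u q v * X n Z q v)" .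
  qed
  finally show ?thesis by simp
qed

lemma quad_lim:
  "(\<lambda>n. \<Sum>v\<in>UNIV. \<Sum>v'\<in>UNIV. (a v :: real) * b v' * pcov n (\<lambda>i. P n i v) (\<lambda>i. P n i v'))
     \<longlonglongrightarrow> (\<Sum>v\<in>UNIV. \<Sum>v'\<in>UNIV. a v * b v' * S v v')"
  by (intro tendsto_intros S_lim)

lemma sq_total_coef_lim:
  "(\<lambda>n. crfe_design.sq_total n (coef u n)) \<longlonglongrightarrow>
     (\<Sum>q\<in>UNIV. (\<Sum>v\<in>UNIV. \<Sum>v'\<in>UNIV. u q v * u q v' * S v v') / (e q)\<^sup>2)"
proof -
  have n1: "(\<lambda>n. (real n - 1) / real n) \<longlonglongrightarrow> 1"
    by real_asymp
  let ?s = "\<lambda>n q. \<Sum>v\<in>UNIV. \<Sum>v'\<in>UNIV. u q v * u q v' * pcov n (\<lambda>i. P n i v) (\<lambda>i. P n i v')"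
  have "(\<lambda>n. \<Sum>q\<in>UNIV. (real n / real (nq n q))\<^sup>2 * ((real n - 1) / real n * ?s n q)) \<longlonglongrightarrow>
    (\<Sum>q\<in>UNIV. (1 / e q)\<^sup>2 * (1 * (\<Sum>v\<in>UNIV. \<Sum>v'\<in>UNIV. u q v * u q v' * S v v')))"
    by (intro tendsto_intros inv_lim n1 quad_lim)
  moreover have "\<forall>\<^sub>F n in sequentially. (\<Sum>q\<in>UNIV. (real n / real (nq n q))\<^sup>2 * ((real n - 1) / real n * ?s n q))
     = crfe_design.sq_total n (coef u n)"
    using good
  proof eventually_elim
    case (elim n)
    then interpret crfe_design n "nq n" by simp
    have "sq_total (coef u n) = (\<Sum>q\<in>UNIV. \<Sum>i<n. (coef u n i q)\<^sup>2)"
      unfolding sq_total_def by (rule sum.swap)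
    also have "\<dots> = (\<Sum>q\<in>UNIV. (sqrt (real n) / real (nq n q))\<^sup>2 * ((real n - 1) * ?s n q))"
      unfolding coef_def power_mult_distrib sum_distrib_left[symmetric]
      using elim by (subst sum_sq_lincomb_pcov) auto
    also have "\<dots> = (\<Sum>q\<in>UNIV. (real n / real (nq n q))\<^sup>2 * ((real n - 1) / real n * ?s n q))"
      using elim by (intro sum.cong refl) (simp add: power_divide power2_eq_square)
    finally show ?case by simp
  qed
  ultimately show ?thesis
    by (simp add: power_divide tendsto_cong cong: sum.cong)
qed

lemma asyvar_coef_lim:
  "(\<lambda>n. crfe_design.asyvar n (nq n) (coef u n)) \<longlonglongrightarrow> asy_cov e S u u"
proof -
  have n1: "(\<lambda>n. (real n - 1) / real n) \<longlonglongrightarrow> 1"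
    by real_asymp
  let ?s = "\<lambda>n q. \<Sum>v\<in>UNIV. \<Sum>v'\<in>UNIV. u q v * u q v' * pcov n (\<lambda>i. P n i v) (\<lambda>i. P n i v')"
  define U where "U v = (\<Sum>q\<in>UNIV. u q v)" for v
  let ?t = "\<lambda>n. \<Sum>v\<in>UNIV. \<Sum>v'\<in>UNIV. U v * U v' * pcov n (\<lambda>i. P n i v) (\<lambda>i. P n i v')"
  have "(\<lambda>n. (real n - 1) / real n * ((\<Sum>q\<in>UNIV. (real n / real (nq n q)) * ?s n q) - ?t n)) \<longlonglongrightarrow>
    1 * ((\<Sum>q\<in>UNIV. (1 / e q) * (\<Sum>v\<in>UNIV. \<Sum>v'\<in>UNIV. u q v * u q v' * S v v'))
       - (\<Sum>v\<in>UNIV. \<Sum>v'\<in>UNIV. U v * U v' * S v v'))"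
    by (intro tendsto_intros inv_lim n1 quad_lim)
  moreover have "\<forall>\<^sub>F n in sequentially. (real n - 1) / real n * ((\<Sum>q\<in>UNIV. (real n / real (nq n q)) * ?s n q) - ?t n)
     = crfe_design.asyvar n (nq n) (coef u n)"
    using good
  proof eventually_elim
    case (elim n)
    then interpret crfe_design n "nq n" by simp
    define d where "d i v = P n i v - pmean n (\<lambda>i. P n i v)" for i v
    have nz: "real (nq n q) \<noteq> 0" for q
      using elim by (metis of_nat_eq_0_iff not_one_le_zero)
    have 1: "(\<Sum>i<n. (coef u n i q)\<^sup>2) = (sqrt (real n) / real (nq n q))\<^sup>2 * ((real n - 1) * ?s n q)" for q
      unfolding coef_def power_mult_distrib sum_distrib_left[symmetric]
      using elim by (subst sum_sq_lincomb_pcov) auto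
    have "(\<Sum>q\<in>UNIV. real (nq n q) * coef u n i q) = sqrt (real n) * (\<Sum>v\<in>UNIV. U v * d i v)" for i
    proof -
      have "real (nq n q) * coef u n i q = sqrt (real n) * (\<Sum>v\<in>UNIV. u q v * d i v)" for q
        using nz[of q] by (simp add: coef_def d_def)
      then have "(\<Sum>q\<in>UNIV. real (nq n q) * coef u n i q) = sqrt (real n) * (\<Sum>q\<in>UNIV. \<Sum>v\<in>UNIV. u q v * d i v)"
        by (simp add: sum_distrib_left)
      also have "(\<Sum>q\<in>UNIV. \<Sum>v\<in>UNIV. u q v * d i v) = (\<Sum>v\<in>UNIV. U v * d i v)"
        by (subst sum.swap) (simp add: U_def sum_distrib_right)
      finally show ?thesis .
    qed
    then have 2: "(\<Sum>i<n. (\<Sum>q\<in>UNIV. real (nq n q) * coef u n i q)\<^sup>2) = real n * ((real n - 1) * ?t n)"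
      using elim by (simp add: power_mult_distrib d_def sum_sq_lincomb_pcov flip: sum_distrib_left)
    have 3: "(\<Sum>q\<in>UNIV. real (nq n q) * (\<Sum>i<n. (coef u n i q)\<^sup>2)) = (real n - 1) * (\<Sum>q\<in>UNIV. (real n / real (nq n q)) * ?s n q)"
      unfolding 1 sum_distrib_left[where A = "UNIV :: 'k set set"]
    proof (intro sum.cong refl)
      fix q
      have "real (nq n q) * (sqrt (real n) / real (nq n q))\<^sup>2 = real n / real (nq n q)"
        using elim by (simp add: power_divide power2_eq_square)
      then show "real (nq n q) * ((sqrt (real n) / real (nq n q))\<^sup>2 * ((real n - 1) * ?s n q))
         = (real n - 1) * (real n / real (nq n q) * ?s n q)"
        by (simp only: mult.assoc[symmetric]) (simp only: mult_ac)
    qed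
    have alg: "(real n - 1) / real n * (x - y) = ((real n - 1) * x - real n * ((real n - 1) * y) / real n) / real n" for x y
      using elim by (simp add: field_simps)
    show ?case
      unfolding asyvar_def 2 3 by (rule alg)
  qed
  ultimately show ?thesis
    by (simp add: asy_cov_def U_def tendsto_cong cong: sum.cong)
qed

lemma coef_bound:
  "\<exists>\<delta>. \<delta> \<longlonglongrightarrow> 0 \<and> (\<forall>\<^sub>F n in sequentially. \<forall>i<n. \<forall>q. \<bar>coef u n i q\<bar> \<le> \<delta> n)"
proof (intro exI conjI)
  let ?A = "\<lambda>q. \<Sum>v\<in>UNIV. \<bar>u q v\<bar>"
  let ?\<delta> = "\<lambda>n. (\<Sum>q\<in>UNIV. real n / real (nq n q) * ?A q) * sqrt (m n)"
  have "?\<delta> \<longlonglongrightarrow> (\<Sum>q\<in>UNIV. (1 / e q) * ?A q) * sqrt 0"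
    by (intro tendsto_intros inv_lim m_lim)
  then show "?\<delta> \<longlonglongrightarrow> 0" by simp
  show "\<forall>\<^sub>F n in sequentially. \<forall>i<n. \<forall>q. \<bar>coef u n i q\<bar> \<le> ?\<delta> n"
    using good m_bound
  proof eventually_elim
    case (elim n)
    show ?case
    proof (intro allI impI)
      fix i q assume i: "i < n"
      have d: "\<bar>P n i v - pmean n (\<lambda>i. P n i v)\<bar> \<le> sqrt (real n) * sqrt (m n)" for v
        using elim(2) i by (metis real_sqrt_le_mono real_sqrt_abs real_sqrt_mult)
      then have d0: "0 \<le> sqrt (real n) * sqrt (m n)"
        using abs_ge_zero order_trans by blast
      then have m0: "0 \<le> sqrt (m n)" using elim(1) by (simp add: zero_le_mult_iff)
      have "\<bar>coef u n i q\<bar> \<le> sqrt (real n) / real (nq n q) * (\<Sum>v\<in>UNIV. \<bar>u q v\<bar> * (sqrt (real n) * sqrt (m n)))"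
        unfolding coef_def abs_mult
        by (intro mult_mono order_trans[OF sum_abs] sum_mono) (auto simp: abs_mult intro!: mult_left_mono d)
      also have "\<dots> = real n / real (nq n q) * ?A q * sqrt (m n)"
        unfolding sum_distrib_right[symmetric] by simp
      also have "\<dots> \<le> ?\<delta> n"
        by (intro mult_right_mono member_le_sum m0) (auto intro!: mult_nonneg_nonneg sum_nonneg)
      finally show "\<bar>coef u n i q\<bar> \<le> ?\<delta> n" .
    qed
  qed
qed

theorem finite_population_CLT:
  "(\<lambda>n. EE n (\<lambda>Z. cos ((\<Sum>q\<in>UNIV. \<Sum>v\<in>UNIV. u q v * X n Z q v) + c)))
     \<longlonglongrightarrow> exp (- asy_cov e S u u / 2) * cos c"
proof -
  obtain \<delta> where \<delta>: "\<delta> \<longlonglongrightarrow> 0" "\<forall>\<^sub>F n in sequentially. \<forall>i<n. \<forall>q. \<bar>coef u n i q\<bar> \<le> \<delta> n"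
    using coef_bound by blast
  let ?V = "\<lambda>n. crfe_design.sq_total n (coef u n)"
  let ?s = "\<lambda>n. crfe_design.asyvar n (nq n) (coef u n)"
  let ?err = "\<lambda>n. 8 * \<delta> n * ?V n + (3 * \<delta> n * sqrt (?V n) + (2 + 2 * real (CARD('k set))) * (?V n * (1 / real n)))"
  let ?Vl = "\<Sum>q\<in>UNIV. (\<Sum>v\<in>UNIV. \<Sum>v'\<in>UNIV. u q v * u q v' * S v v') / (e q)\<^sup>2"
  have "?err \<longlonglongrightarrow> 8 * 0 * ?Vl + (3 * 0 * sqrt ?Vl + (2 + 2 * real (CARD('k set))) * (?Vl * 0))"
    by (intro tendsto_intros \<delta> sq_total_coef_lim lim_1_over_n)
  then have err: "?err \<longlonglongrightarrow> 0" by simp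
  let ?f = "\<lambda>n. EE n (\<lambda>Z. cos ((\<Sum>q\<in>UNIV. \<Sum>v\<in>UNIV. u q v * X n Z q v) + c))"
  have "\<forall>\<^sub>F n in sequentially. \<bar>?f n - exp (- ?s n / 2) * cos c\<bar> \<le> ?err n"
    using good \<delta>(2)
  proof eventually_elim
    case (elim n)
    then interpret crfe_design n "nq n" by simp
    have "?f n = E (\<lambda>Z. cos (lin (coef u n) Z + c))"
      using elim by (intro avg_cong) (simp add: sum_group_dev_eq_lin)
    then show ?case
      using E_cos_lin[of "coef u n" "\<delta> n" c] elim coef_centred asyvar_nonneg by (simp add: mult_ac)
  qed
  then have "(\<lambda>n. ?f n - exp (- ?s n / 2) * cos c) \<longlonglongrightarrow> 0"
    by (intro Lim_null_comparison[OF _ err]) simp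
  moreover have "(\<lambda>n. exp (- ?s n / 2) * cos c) \<longlonglongrightarrow> exp (- asy_cov e S u u / 2) * cos c"
    by (intro tendsto_intros asyvar_coef_lim) simp
  ultimately show ?thesis
    using tendsto_add by fastforce
qed

lemma second_moment_bounded:
  "\<exists>C. \<forall>\<^sub>F n in sequentially. EE n (\<lambda>Z. (\<Sum>q\<in>UNIV. \<Sum>v\<in>UNIV. u q v * X n Z q v)\<^sup>2) \<le> C"
proof -
  let ?V = "\<lambda>n. crfe_design.sq_total n (coef u n)"
  let ?Vl = "\<Sum>q\<in>UNIV. (\<Sum>v\<in>UNIV. \<Sum>v'\<in>UNIV. u q v * u q v' * S v v') / (e q)\<^sup>2"
  have "\<forall>\<^sub>F n in sequentially. ?V n < ?Vl + 1"
    using sq_total_coef_lim by (rule order_tendstoD) simp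
  then have "\<forall>\<^sub>F n in sequentially. EE n (\<lambda>Z. (\<Sum>q\<in>UNIV. \<Sum>v\<in>UNIV. u q v * X n Z q v)\<^sup>2) \<le> 4 * (?Vl + 1)"
    using good
  proof eventually_elim
    case (elim n)
    then interpret crfe_design n "nq n" by simp
    have "EE n (\<lambda>Z. (\<Sum>q\<in>UNIV. \<Sum>v\<in>UNIV. u q v * X n Z q v)\<^sup>2) = E (\<lambda>Z. (lin (coef u n) Z)\<^sup>2)"
      using elim by (intro avg_cong) (simp add: sum_group_dev_eq_lin)
    also have "\<dots> \<le> 4 * sq_total (coef u n)"
      using elim by (intro E_lin_sq_le coef_centred) auto
    finally show ?case using elim by simp
  qed
  then show ?thesis by blast
qed

end

section \<open>Weak convergence from trigonometric moments\<close>

inductive_set trig :: "(('j::finite \<Rightarrow> real) \<Rightarrow> real) set" where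
  cosine: "(\<lambda>x. a * cos ((\<Sum>j\<in>UNIV. t j * x j) + c)) \<in> trig"
| plus: "f \<in> trig \<Longrightarrow> g \<in> trig \<Longrightarrow> (\<lambda>x. f x + g x) \<in> trig"

lemma trig_mult_cosine:
  assumes "g \<in> trig"
  shows "(\<lambda>x. (a * cos ((\<Sum>j\<in>UNIV. t j * x j) + c)) * g x) \<in> trig"
  using assms
proof (induction rule: trig.induct)
  case (cosine b s d)
  have "(\<lambda>x. (a * cos ((\<Sum>j\<in>UNIV. t j * x j) + c)) * (b * cos ((\<Sum>j\<in>UNIV. s j * x j) + d)))
    = (\<lambda>x. (a * b / 2) * cos ((\<Sum>j\<in>UNIV. (t j - s j) * x j) + (c - d))
       + (a * b / 2) * cos ((\<Sum>j\<in>UNIV. (t j + s j) * x j) + (c + d)))" (is "?l = ?r")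
  proof
    fix x
    let ?u = "(\<Sum>j\<in>UNIV. t j * x j) + c" and ?v = "(\<Sum>j\<in>UNIV. s j * x j) + d"
    have 1: "(\<Sum>j\<in>UNIV. (t j - s j) * x j) + (c - d) = ?u - ?v"
      by (simp add: left_diff_distrib sum_subtractf)
    have 2: "(\<Sum>j\<in>UNIV. (t j + s j) * x j) + (c + d) = ?u + ?v"
      by (simp add: distrib_right sum.distrib)
    have "a * cos u * (b * cos v) = a * b / 2 * cos (u - v) + a * b / 2 * cos (u + v)" for u v
      by (simp add: cos_diff cos_add field_simps)
    then show "?l x = ?r x"
      unfolding 1 2 by blast
  qed
  then show ?case by (simp only: trig.intros)
next
  case (plus f g)
  then show ?case by (simp only: distrib_left trig.plus)
qed

lemma trig_mult:
  assumes "f \<in> trig" "g \<in> trig"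
  shows "(\<lambda>x. f x * g x) \<in> trig"
  using assms
proof (induction rule: trig.induct)
  case (cosine a t c)
  then show ?case by (rule trig_mult_cosine)
next
  case (plus f1 f2)
  then show ?case by (simp only: distrib_right trig.plus)
qed

lemma trig_const: "(\<lambda>_. c) \<in> trig"
  using trig.cosine[of c "\<lambda>_. 0" 0] by simp

lemma compact_cube: "compact {s :: 'j::finite \<Rightarrow> real. \<forall>j. s j \<in> {-1..1}}"
proof -
  have "compactin (product_topology (\<lambda>_. euclidean) UNIV) (PiE UNIV (\<lambda>_::'j. {-1..1::real}))"
    by (simp add: compactin_PiE)
  then show ?thesis
    by (simp add: euclidean_product_topology compactin_euclidean_iff PiE_UNIV_domain Pi_def)
qed

text \<open>The triangle wave \<open>arcsin \<circ> sin\<close> folds the whole space into the cube of side \<open>2 * R\<close>, so that a continuous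
  function can be approximated there by trigonometric polynomials that stay bounded everywhere.\<close>

definition fold_wave :: "real \<Rightarrow> real \<Rightarrow> real" where
  "fold_wave R y = 2 * R / pi * arcsin (sin (pi / (2 * R) * y))"

lemma fold_wave_id:
  assumes "R > 0" "\<bar>y\<bar> \<le> R"
  shows "fold_wave R y = y"
proof -
  have "\<bar>pi / (2 * R) * y\<bar> \<le> pi / 2"
    using assms by (simp add: abs_mult field_simps)
  then have "arcsin (sin (pi / (2 * R) * y)) = pi / (2 * R) * y"
    by (intro arcsin_sin) linarith+
  then show ?thesis using assms by (simp add: fold_wave_def)
qed

lemma trig_approx:
  fixes g :: "('j::finite \<Rightarrow> real) \<Rightarrow> real"
  assumes g: "continuous_on UNIV g" and \<epsilon>: "\<epsilon> > 0"
  obtains p where "p \<in> trig" "\<And>x. \<bar>g (\<lambda>j. fold_wave R (x j)) - p x\<bar> \<le> \<epsilon>"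
proof -
  let ?S = "{s :: 'j \<Rightarrow> real. \<forall>j. s j \<in> {-1..1}}"
  let ?\<sigma> = "\<lambda>x j. sin (pi / (2 * R) * x j)"
  let ?A = "{f. continuous_on ?S f \<and> (\<exists>p\<in>trig. \<forall>x. p x = f (?\<sigma> x))}"
  interpret function_ring_on ?A ?S
  proof
    fix f g assume "f \<in> ?A" "g \<in> ?A"
    then obtain p r where "continuous_on ?S f" "continuous_on ?S g" "p \<in> trig" "r \<in> trig"
      "\<forall>x. p x = f (?\<sigma> x)" "\<forall>x. r x = g (?\<sigma> x)"
      by blast
    then show "(\<lambda>x. f x + g x) \<in> ?A" "(\<lambda>x. f x * g x) \<in> ?A"
      using trig.plus[of p r] trig_mult[of p r] by (auto intro!: continuous_intros)
  next
    fix c show "(\<lambda>_. c) \<in> ?A" using trig_const[of c] by auto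
  next
    fix x y :: "'j \<Rightarrow> real" assume "x \<noteq> y"
    then obtain j where j: "x j \<noteq> y j" by blast
    have "(\<lambda>s. s j) \<in> ?A"
    proof (intro CollectI conjI bexI allI)
      show "continuous_on ?S (\<lambda>s. s j)"
        by (rule continuous_on_subset[OF continuous_on_product_coordinates]) auto
      let ?p = "\<lambda>x. 1 * cos ((\<Sum>i\<in>UNIV. (if i = j then pi / (2 * R) else 0) * x i) + (- (pi / 2)))"
      show "?p \<in> trig" by (rule trig.cosine)
      fix x :: "'j \<Rightarrow> real"
      have "(\<Sum>i\<in>UNIV. (if i = j then pi / (2 * R) else 0) * x i) = pi / (2 * R) * x j"
        by (simp add: if_distrib[where f = "\<lambda>z. z * _"] cong: if_cong)
      then show "?p x = sin (pi / (2 * R) * x j)"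
        by (simp only: mult_1) (simp add: cos_diff)
    qed
    then show "\<exists>f\<in>?A. f x \<noteq> f y" using j by (intro bexI[where x = "\<lambda>s. s j"])
  qed (use compact_cube in auto)
  let ?f = "\<lambda>s. g (\<lambda>j. 2 * R / pi * arcsin (s j))"
  have "continuous_on ?S ?f"
  proof (rule continuous_on_compose2[OF g])
    show "continuous_on ?S (\<lambda>s j. 2 * R / pi * arcsin (s j))"
      by (intro continuous_on_coordinatewise_then_product continuous_intros
          continuous_on_subset[OF continuous_on_product_coordinates]) auto
  qed auto
  from Stone_Weierstrass_basic[OF this \<epsilon>] obtain h p where
    h: "\<forall>s\<in>?S. \<bar>?f s - h s\<bar> < \<epsilon>" and p: "p \<in> trig" "\<And>x. p x = h (?\<sigma> x)" by blast
  have "\<bar>g (\<lambda>j. fold_wave R (x j)) - p x\<bar> \<le> \<epsilon>" for x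
    using h[rule_format, of "?\<sigma> x"] by (simp add: p(2) fold_wave_def)
  with p(1) show ?thesis by (rule that)
qed

lemma trig_continuous: "f \<in> trig \<Longrightarrow> continuous_on UNIV f"
  by (induction rule: trig.induct) (intro continuous_intros continuous_on_product_coordinates; simp)+

lemma trig_bounded: "f \<in> trig \<Longrightarrow> \<exists>B. \<forall>x. \<bar>f x\<bar> \<le> B"
proof (induction rule: trig.induct)
  case (cosine a t c)
  have "\<bar>a * cos y\<bar> \<le> \<bar>a\<bar>" for y
    using mult_left_mono[OF abs_cos_le_one[of y], of "\<bar>a\<bar>"] by (simp add: abs_mult)
  then show ?case by blast
next
  case (plus f g)
  then obtain B C where "\<forall>x. \<bar>f x\<bar> \<le> B" "\<forall>x. \<bar>g x\<bar> \<le> C" by blast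
  then have "\<forall>x. \<bar>f x + g x\<bar> \<le> B + C" by (meson abs_triangle_ineq add_mono order_trans)
  then show ?case by blast
qed

lemma fold_wave_error:
  fixes g :: "('j::finite \<Rightarrow> real) \<Rightarrow> real"
  assumes B: "\<And>x. \<bar>g x\<bar> \<le> B" and R: "R > 0"
  shows "\<bar>g x - g (\<lambda>j. fold_wave R (x j))\<bar> \<le> 2 * B / R\<^sup>2 * (\<Sum>j\<in>UNIV. (x j)\<^sup>2)"
proof (cases "\<forall>j. \<bar>x j\<bar> \<le> R")
  case True
  then have "(\<lambda>j. fold_wave R (x j)) = x" by (simp add: fold_wave_id[OF R])
  moreover have "0 \<le> B" using B[of x] by linarith
  ultimately show ?thesis by (simp add: sum_nonneg)
next
  case False
  then obtain j where "R < \<bar>x j\<bar>" by (auto simp: not_le)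
  then have "R\<^sup>2 \<le> (x j)\<^sup>2" using R by (simp add: abs_le_square_iff[symmetric])
  also have "\<dots> \<le> (\<Sum>j\<in>UNIV. (x j)\<^sup>2)" by (intro member_le_sum) auto
  finally have "1 \<le> (\<Sum>j\<in>UNIV. (x j)\<^sup>2) / R\<^sup>2" using R by simp
  moreover have B0: "0 \<le> 2 * B" using B[of x] by linarith
  ultimately have "2 * B * 1 \<le> 2 * B * ((\<Sum>j\<in>UNIV. (x j)\<^sup>2) / R\<^sup>2)" by (rule mult_left_mono)
  moreover have "\<bar>g x - g (\<lambda>j. fold_wave R (x j))\<bar> \<le> 2 * B"
    using B[of x] B[of "\<lambda>j. fold_wave R (x j)"] by linarith
  ultimately show ?thesis by simp
qed

lemma (in prob_space) bounded_integrable: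
  fixes f :: "'a \<Rightarrow> real"
  assumes "f \<in> borel_measurable M" "\<And>x. \<bar>f x\<bar> \<le> B"
  shows "integrable M f"
  using assms by (intro integrable_const_bound[of _ B]) auto

locale weak_limit = prob_space M for M :: "'b measure" +
  fixes \<Omega> :: "nat \<Rightarrow> 'a set" and X :: "nat \<Rightarrow> 'a \<Rightarrow> 'j::finite \<Rightarrow> real" and Xl :: "'b \<Rightarrow> 'j \<Rightarrow> real"
  assumes finite_\<Omega>: "\<forall>\<^sub>F n in sequentially. finite (\<Omega> n) \<and> \<Omega> n \<noteq> {}"
    and Xl_meas [measurable]: "Xl \<in> borel_measurable M"
    and second_moments: "\<And>j. \<exists>C. \<forall>\<^sub>F n in sequentially. avg (\<Omega> n) (\<lambda>Z. (X n Z j)\<^sup>2) \<le> C"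
    and second_moments_lim: "\<And>j. integrable M (\<lambda>\<omega>. (Xl \<omega> j)\<^sup>2)"
    and cos_lim: "\<And>t c. (\<lambda>n. avg (\<Omega> n) (\<lambda>Z. cos ((\<Sum>j\<in>UNIV. t j * X n Z j) + c)))
      \<longlonglongrightarrow> (\<integral>\<omega>. cos ((\<Sum>j\<in>UNIV. t j * Xl \<omega> j) + c) \<partial>M)"
begin

lemma comp_measurable:
  "continuous_on UNIV g \<Longrightarrow> (\<lambda>\<omega>. g (Xl \<omega>) :: real) \<in> borel_measurable M"
  using measurable_compose[OF Xl_meas borel_measurable_continuous_onI] by blast

lemma comp_integrable:
  fixes g :: "('j \<Rightarrow> real) \<Rightarrow> real"
  assumes "continuous_on UNIV g" "\<And>x. \<bar>g x\<bar> \<le> B"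
  shows "integrable M (\<lambda>\<omega>. g (Xl \<omega>))"
  using assms by (intro bounded_integrable comp_measurable)

lemma trig_lim:
  "p \<in> trig \<Longrightarrow> (\<lambda>n. avg (\<Omega> n) (\<lambda>Z. p (X n Z))) \<longlonglongrightarrow> (\<integral>\<omega>. p (Xl \<omega>) \<partial>M)"
proof (induction rule: trig.induct)
  case (cosine a t c)
  show ?case unfolding avg_cmult by (simp add: tendsto_mult_left cos_lim)
next
  case (plus f g)
  have "integrable M (\<lambda>\<omega>. f (Xl \<omega>))" "integrable M (\<lambda>\<omega>. g (Xl \<omega>))"
    using plus trig_bounded trig_continuous comp_integrable by metis+
  then show ?case using plus by (simp add: avg_add tendsto_add)
qed

theorem levy:
  fixes g :: "('j \<Rightarrow> real) \<Rightarrow> real"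
  assumes g: "continuous_on UNIV g" and B: "\<And>x. \<bar>g x\<bar> \<le> B"
  shows "(\<lambda>n. avg (\<Omega> n) (\<lambda>Z. g (X n Z))) \<longlonglongrightarrow> (\<integral>\<omega>. g (Xl \<omega>) \<partial>M)"
proof (rule LIMSEQ_I)
  fix \<epsilon> :: real assume \<epsilon>: "\<epsilon> > 0"
  have "\<exists>C. \<forall>j. \<forall>\<^sub>F n in sequentially. avg (\<Omega> n) (\<lambda>Z. (X n Z j)\<^sup>2) \<le> C j"
    by (rule choice) (simp add: second_moments)
  then obtain C where C: "\<And>j. \<forall>\<^sub>F n in sequentially. avg (\<Omega> n) (\<lambda>Z. (X n Z j)\<^sup>2) \<le> C j"
    by blast
  define K where "K = \<bar>\<Sum>j\<in>UNIV. C j\<bar> + \<bar>\<Sum>j\<in>UNIV. \<integral>\<omega>. (Xl \<omega> j)\<^sup>2 \<partial>M\<bar>"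
  have B0: "0 \<le> B" using B[of undefined] by linarith
  define R where "R = 1 + 10 * B * K / \<epsilon>"
  have K0: "0 \<le> 10 * B * K / \<epsilon>" using B0 \<epsilon> by (simp add: K_def)
  then have "R\<^sup>2 \<ge> 1 + 10 * B * K / \<epsilon>"
    using self_le_power[of R 2] by (simp add: R_def)
  then have "10 * B * K < \<epsilon> * R\<^sup>2"
    using \<epsilon> by (simp add: field_simps)
  moreover have "R > 0" using K0 by (simp add: R_def)
  ultimately have R: "R > 0" "2 * B / R\<^sup>2 * K < \<epsilon> / 5"
    by (simp_all add: field_simps)
  obtain p where p: "p \<in> trig" "\<And>x. \<bar>g (\<lambda>j. fold_wave R (x j)) - p x\<bar> \<le> \<epsilon> / 5"
    using trig_approx[OF g, of "\<epsilon> / 5" R] \<epsilon> by auto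
  have gp: "\<bar>g x - p x\<bar> \<le> \<epsilon> / 5 + 2 * B / R\<^sup>2 * (\<Sum>j\<in>UNIV. (x j)\<^sup>2)" for x
    using p(2)[of x] fold_wave_error[of g B R x, OF B R(1)] by linarith
  have pint: "integrable M (\<lambda>\<omega>. p (Xl \<omega>))"
    using p(1) trig_bounded trig_continuous comp_integrable by metis
  have gint: "integrable M (\<lambda>\<omega>. g (Xl \<omega>))" by (rule comp_integrable[OF g B])
  have le_K: "2 * B / R\<^sup>2 * x \<le> \<epsilon> / 5" if "x \<le> K" for x
    using mult_left_mono[OF that, of "2 * B / R\<^sup>2"] B0 R by simp
  have lim: "\<bar>(\<integral>\<omega>. g (Xl \<omega>) \<partial>M) - (\<integral>\<omega>. p (Xl \<omega>) \<partial>M)\<bar> \<le> 2 * \<epsilon> / 5"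
  proof -
    have "\<bar>(\<integral>\<omega>. g (Xl \<omega>) \<partial>M) - (\<integral>\<omega>. p (Xl \<omega>) \<partial>M)\<bar> = \<bar>\<integral>\<omega>. g (Xl \<omega>) - p (Xl \<omega>) \<partial>M\<bar>"
      using pint gint by simp
    also have "\<dots> \<le> (\<integral>\<omega>. \<bar>g (Xl \<omega>) - p (Xl \<omega>)\<bar> \<partial>M)" by (rule integral_abs_bound)
    also have "\<dots> \<le> (\<integral>\<omega>. \<epsilon> / 5 + 2 * B / R\<^sup>2 * (\<Sum>j\<in>UNIV. (Xl \<omega> j)\<^sup>2) \<partial>M)"
      using pint gint second_moments_lim by (intro integral_mono gp) auto
    also have "\<dots> = \<epsilon> / 5 + 2 * B / R\<^sup>2 * (\<Sum>j\<in>UNIV. \<integral>\<omega>. (Xl \<omega> j)\<^sup>2 \<partial>M)"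
      using second_moments_lim by (simp add: prob_space)
    also have "\<dots> \<le> \<epsilon> / 5 + \<epsilon> / 5"
      by (intro add_left_mono le_K) (simp add: K_def)
    finally show ?thesis by simp
  qed
  have "\<forall>\<^sub>F n in sequentially. \<forall>j. avg (\<Omega> n) (\<lambda>Z. (X n Z j)\<^sup>2) \<le> C j"
    using C by (rule eventually_all_finite)
  moreover have "\<forall>\<^sub>F n in sequentially. \<bar>avg (\<Omega> n) (\<lambda>Z. p (X n Z)) - (\<integral>\<omega>. p (Xl \<omega>) \<partial>M)\<bar> < \<epsilon> / 5"
    using tendstoD[OF trig_lim[OF p(1)], of "\<epsilon> / 5"] \<epsilon> by (simp add: dist_real_def)
  ultimately have "\<forall>\<^sub>F n in sequentially. \<bar>avg (\<Omega> n) (\<lambda>Z. g (X n Z)) - (\<integral>\<omega>. g (Xl \<omega>) \<partial>M)\<bar> < \<epsilon>"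
    using finite_\<Omega>
  proof eventually_elim
    case (elim n)
    have "\<bar>avg (\<Omega> n) (\<lambda>Z. g (X n Z)) - avg (\<Omega> n) (\<lambda>Z. p (X n Z))\<bar> \<le> avg (\<Omega> n) (\<lambda>Z. \<bar>g (X n Z) - p (X n Z)\<bar>)"
      unfolding avg_diff[symmetric] by (rule abs_avg_le)
    also have "\<dots> \<le> avg (\<Omega> n) (\<lambda>Z. \<epsilon> / 5 + 2 * B / R\<^sup>2 * (\<Sum>j\<in>UNIV. (X n Z j)\<^sup>2))"
      by (intro avg_mono gp)
    also have "\<dots> = \<epsilon> / 5 + 2 * B / R\<^sup>2 * (\<Sum>j\<in>UNIV. avg (\<Omega> n) (\<lambda>Z. (X n Z j)\<^sup>2))"
      unfolding avg_add avg_cmult avg_sum using elim by (simp add: avg_const)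
    also have "\<dots> \<le> \<epsilon> / 5 + \<epsilon> / 5"
    proof (intro add_left_mono le_K)
      have "(\<Sum>j\<in>UNIV. avg (\<Omega> n) (\<lambda>Z. (X n Z j)\<^sup>2)) \<le> (\<Sum>j\<in>UNIV. C j)"
        using elim by (intro sum_mono) auto
      then show "(\<Sum>j\<in>UNIV. avg (\<Omega> n) (\<lambda>Z. (X n Z j)\<^sup>2)) \<le> K" by (simp add: K_def)
    qed
    finally show ?case using lim elim by linarith
  qed
  then show "\<exists>n0. \<forall>n\<ge>n0. norm (avg (\<Omega> n) (\<lambda>Z. g (X n Z)) - (\<integral>\<omega>. g (Xl \<omega>) \<partial>M)) < \<epsilon>"
    by (simp add: eventually_sequentially)
qed

text \<open>Conditioning on an event with negligible limiting boundary: the indicators are sandwiched between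
  continuous functions.\<close>

theorem levy_restricted:
  fixes g :: "('j \<Rightarrow> real) \<Rightarrow> real" and stat :: "nat \<Rightarrow> 'h \<Rightarrow> 'a \<Rightarrow> real" and s :: "'h \<Rightarrow> ('j \<Rightarrow> real) \<Rightarrow> real"
  assumes g: "continuous_on UNIV g" and B: "\<And>x. \<bar>g x\<bar> \<le> B"
    and I: "finite I"
    and s: "\<And>h. h \<in> I \<Longrightarrow> continuous_on UNIV (s h)"
    and stat: "\<And>h. h \<in> I \<Longrightarrow> (\<lambda>n. avg (\<Omega> n) (\<lambda>Z. \<bar>stat n h Z - s h (X n Z)\<bar>)) \<longlonglongrightarrow> 0"
    and null: "\<And>h. h \<in> I \<Longrightarrow> AE \<omega> in M. s h (Xl \<omega>) \<noteq> a h"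
  shows "(\<lambda>n. avg (\<Omega> n) (\<lambda>Z. g (X n Z) * (if \<forall>h\<in>I. stat n h Z \<le> a h then 1 else 0)))
    \<longlonglongrightarrow> (\<integral>\<omega>. g (Xl \<omega>) * (if \<forall>h\<in>I. s h (Xl \<omega>) \<le> a h then 1 else 0) \<partial>M)"
proof (rule LIMSEQ_I)
  fix \<epsilon> :: real assume \<epsilon>: "\<epsilon> > 0"
  define \<phi> where "\<phi> d b y = max 0 (min 1 (1 + (b - y) / d))" for d b y :: real
  define \<psi> where "\<psi> d b y = max 0 (min 1 (2 - \<bar>y - b\<bar> / d))" for d b y :: real
  have \<phi>01: "0 \<le> \<phi> d b y" "\<phi> d b y \<le> 1" for d b y by (auto simp: \<phi>_def)
  have \<psi>01: "0 \<le> \<psi> d b y" "\<psi> d b y \<le> 1" for d b y by (auto simp: \<psi>_def)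
  have one: "\<bar>(if y' \<le> b then 1 else 0) - \<phi> d b y\<bar> \<le> \<psi> d b y + \<bar>y' - y\<bar> / d" if d: "d > 0" for d b y y' :: real
  proof (cases "\<bar>y' - y\<bar> \<le> d")
    case False
    then have "1 \<le> \<bar>y' - y\<bar> / d" using d by simp
    moreover have "\<bar>(if y' \<le> b then 1 else 0) - \<phi> d b y\<bar> \<le> 1" using \<phi>01[of d b y] by auto
    ultimately show ?thesis using \<psi>01(1)[of d b y] by linarith
  next
    case True
    have 0: "0 \<le> \<bar>y' - y\<bar> / d" using d by simp
    show ?thesis
    proof (cases "\<bar>y - b\<bar> \<le> d")
      case True
      then have "\<bar>y - b\<bar> / d \<le> 1" using d by simp
      then have "\<psi> d b y = 1" by (simp add: \<psi>_def)
      moreover have "\<bar>(if y' \<le> b then 1 else 0) - \<phi> d b y\<bar> \<le> 1" using \<phi>01[of d b y] by auto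
      ultimately show ?thesis using 0 by linarith
    next
      case far: False
      show ?thesis
      proof (cases "y < b")
        case y: True
        then have "\<phi> d b y = 1" using d by (simp add: \<phi>_def)
        moreover have "y' \<le> b" using y far True by linarith
        ultimately show ?thesis using 0 \<psi>01(1)[of d b y] by simp
      next
        case y: False
        then have "(b - y) / d \<le> - 1" using d far by (simp add: field_simps)
        then have "\<phi> d b y = 0" by (simp add: \<phi>_def)
        moreover have "\<not> y' \<le> b" using y far True by linarith
        ultimately show ?thesis using 0 \<psi>01(1)[of d b y] by simp
      qed
    qed
  qed
  have many: "\<bar>(if \<forall>h\<in>I. y' h \<le> a h then 1 else 0) - (\<Prod>h\<in>I. \<phi> d (a h) (y h))\<bar>
      \<le> (\<Sum>h\<in>I. \<psi> d (a h) (y h) + \<bar>y' h - y h\<bar> / d)" if d: "d > 0" for d y y'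
  proof -
    have "(if \<forall>h\<in>I. y' h \<le> a h then 1 else 0) = (\<Prod>h\<in>I. if y' h \<le> a h then 1 else (0::real))"
      using I by (induction I rule: finite_induct) auto
    also have "\<bar>\<dots> - (\<Prod>h\<in>I. \<phi> d (a h) (y h))\<bar> \<le> (\<Sum>h\<in>I. \<bar>(if y' h \<le> a h then 1 else 0) - \<phi> d (a h) (y h)\<bar>)"
      using norm_prod_diff[of I "\<lambda>h. if y' h \<le> a h then 1 else (0::real)" "\<lambda>h. \<phi> d (a h) (y h)"] \<phi>01
      by (simp add: abs_of_nonneg)
    also have "\<dots> \<le> (\<Sum>h\<in>I. \<psi> d (a h) (y h) + \<bar>y' h - y h\<bar> / d)"
      by (intro sum_mono one d)
    finally show ?thesis .
  qed
  have \<psi>_cont: "continuous_on UNIV (\<lambda>x. \<psi> d (a h) (s h x))" if "h \<in> I" "d > 0" for h d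
    unfolding \<psi>_def using that by (intro continuous_intros s) auto
  have \<phi>_cont: "continuous_on UNIV (\<lambda>x. \<phi> d (a h) (s h x))" if "h \<in> I" "d > 0" for h d
    unfolding \<phi>_def using that by (intro continuous_intros s) auto
  have B0: "0 \<le> B" using B[of undefined] by linarith
  have \<psi>_int: "integrable M (\<lambda>\<omega>. \<psi> d (a h) (s h (Xl \<omega>)))" if "h \<in> I" "d > 0" for h d
    by (rule comp_integrable[OF \<psi>_cont[OF that], of 1]) (use \<psi>01 in \<open>simp add: abs_of_nonneg\<close>)
  define d where "d k = 1 / real (Suc k)" for k
  have d: "d k > 0" for k by (simp add: d_def)
  have \<psi>_small: "(\<lambda>k. \<integral>\<omega>. \<psi> (d k) (a h) (s h (Xl \<omega>)) \<partial>M) \<longlonglongrightarrow> 0" if h: "h \<in> I" for h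
  proof -
    have "(\<lambda>k. \<integral>\<omega>. \<psi> (d k) (a h) (s h (Xl \<omega>)) \<partial>M) \<longlonglongrightarrow> (\<integral>\<omega>. 0 \<partial>M)"
    proof (rule integral_dominated_convergence[where w = "\<lambda>_. 1"])
      show "AE \<omega> in M. (\<lambda>k. \<psi> (d k) (a h) (s h (Xl \<omega>))) \<longlonglongrightarrow> 0"
        using null[OF h]
      proof eventually_elim
        case (elim \<omega>)
        let ?y = "\<bar>s h (Xl \<omega>) - a h\<bar>"
        have y: "?y > 0" using elim by simp
        obtain k0 :: nat where k0: "2 / ?y < real k0" using reals_Archimedean2 by blast
        have "\<psi> (d k) (a h) (s h (Xl \<omega>)) = 0" if "k \<ge> k0" for k
        proof -
          have "2 < ?y * real k0" using k0 y by (simp add: field_simps)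
          also have "\<dots> \<le> ?y * real (Suc k)" using that y by (intro mult_left_mono) auto
          finally show ?thesis by (simp add: \<psi>_def d_def)
        qed
        then show ?case
          by (intro tendsto_eventually eventually_sequentiallyI[of k0])
      qed
      show "AE x in M. norm (\<psi> (d k) (a h) (s h (Xl x))) \<le> 1" for k
        using \<psi>01 by (simp add: abs_of_nonneg)
    qed (use \<psi>_int[OF h d] in auto)
    then show ?thesis by simp
  qed
  have "(\<lambda>k. 2 * B * (\<Sum>h\<in>I. \<integral>\<omega>. \<psi> (d k) (a h) (s h (Xl \<omega>)) \<partial>M)) \<longlonglongrightarrow> 2 * B * (\<Sum>h\<in>I. 0)"
    by (intro tendsto_intros \<psi>_small)
  then have "\<forall>\<^sub>F k in sequentially. 2 * B * (\<Sum>h\<in>I. \<integral>\<omega>. \<psi> (d k) (a h) (s h (Xl \<omega>)) \<partial>M) < \<epsilon> / 2"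
    using \<epsilon> by (intro order_tendstoD) auto
  then obtain k where k: "2 * B * (\<Sum>h\<in>I. \<integral>\<omega>. \<psi> (d k) (a h) (s h (Xl \<omega>)) \<partial>M) < \<epsilon> / 2"
    using eventually_happens trivial_limit_sequentially by blast
  let ?\<delta> = "d k"
  define G where "G x = g x * (\<Prod>h\<in>I. \<phi> ?\<delta> (a h) (s h x))" for x
  have G_cont: "continuous_on UNIV G"
    unfolding G_def using d by (intro continuous_intros g \<phi>_cont) auto
  have G_B: "\<bar>G x\<bar> \<le> B" for x
  proof -
    have "\<bar>\<Prod>h\<in>I. \<phi> ?\<delta> (a h) (s h x)\<bar> \<le> 1"
      using \<phi>01 by (simp add: abs_prod prod_le_1 abs_of_nonneg)
    then show ?thesis using mult_mono[OF B[of x]] B0 by (fastforce simp: G_def abs_mult)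
  qed
  let ?E1 = "\<lambda>n. \<Sum>h\<in>I. avg (\<Omega> n) (\<lambda>Z. \<psi> ?\<delta> (a h) (s h (X n Z))) + avg (\<Omega> n) (\<lambda>Z. \<bar>stat n h Z - s h (X n Z)\<bar>) / ?\<delta>"
  let ?P = "\<Sum>h\<in>I. \<integral>\<omega>. \<psi> ?\<delta> (a h) (s h (Xl \<omega>)) \<partial>M"
  let ?L = "\<integral>\<omega>. g (Xl \<omega>) * (if \<forall>h\<in>I. s h (Xl \<omega>) \<le> a h then 1 else 0) \<partial>M"
  let ?f = "\<lambda>n. avg (\<Omega> n) (\<lambda>Z. g (X n Z) * (if \<forall>h\<in>I. stat n h Z \<le> a h then 1 else 0))"
  have E1_lim: "?E1 \<longlonglongrightarrow> (\<Sum>h\<in>I. (\<integral>\<omega>. \<psi> ?\<delta> (a h) (s h (Xl \<omega>)) \<partial>M) + 0 / ?\<delta>)"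
    using d[of k] \<psi>01 by (intro tendsto_intros stat levy[where B = 1] \<psi>_cont) (auto simp: abs_of_nonneg)
  have G_lim: "(\<lambda>n. avg (\<Omega> n) (\<lambda>Z. G (X n Z))) \<longlonglongrightarrow> (\<integral>\<omega>. G (Xl \<omega>) \<partial>M)"
    by (rule levy[OF G_cont G_B])
  have "(\<lambda>n. \<bar>avg (\<Omega> n) (\<lambda>Z. G (X n Z)) - (\<integral>\<omega>. G (Xl \<omega>) \<partial>M)\<bar> + B * ?E1 n)
      \<longlonglongrightarrow> \<bar>(\<integral>\<omega>. G (Xl \<omega>) \<partial>M) - (\<integral>\<omega>. G (Xl \<omega>) \<partial>M)\<bar> + B * (\<Sum>h\<in>I. (\<integral>\<omega>. \<psi> ?\<delta> (a h) (s h (Xl \<omega>)) \<partial>M) + 0 / ?\<delta>)"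
    by (rule tendsto_add[OF tendsto_rabs[OF tendsto_diff[OF G_lim tendsto_const]] tendsto_mult[OF tendsto_const E1_lim]])
  then have "(\<lambda>n. \<bar>avg (\<Omega> n) (\<lambda>Z. G (X n Z)) - (\<integral>\<omega>. G (Xl \<omega>) \<partial>M)\<bar> + B * ?E1 n) \<longlonglongrightarrow> B * ?P"
    by simp
  then have close: "\<forall>\<^sub>F n in sequentially. \<bar>avg (\<Omega> n) (\<lambda>Z. G (X n Z)) - (\<integral>\<omega>. G (Xl \<omega>) \<partial>M)\<bar> + B * ?E1 n < B * ?P + \<epsilon> / 2"
    using \<epsilon> by (intro order_tendstoD) auto
  have s_meas: "(\<lambda>\<omega>. s h (Xl \<omega>)) \<in> borel_measurable M" if "h \<in> I" for h
    by (rule comp_measurable[OF s[OF that]])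
  have ind_meas: "(\<lambda>\<omega>. if \<forall>h\<in>I. s h (Xl \<omega>) \<le> a h then 1 else 0 :: real) \<in> borel_measurable M"
  proof (rule measurable_If)
    show "{\<omega> \<in> space M. \<forall>h\<in>I. s h (Xl \<omega>) \<le> a h} \<in> sets M"
      using I s_meas by (intro sets.sets_Collect_finite_All) (auto intro!: borel_measurable_le)
  qed auto
  have Lint: "integrable M (\<lambda>\<omega>. g (Xl \<omega>) * (if \<forall>h\<in>I. s h (Xl \<omega>) \<le> a h then 1 else 0))"
    using B B0 by (intro bounded_integrable[where B = B] borel_measurable_times comp_measurable g ind_meas) auto
  have "\<bar>(\<integral>\<omega>. G (Xl \<omega>) \<partial>M) - ?L\<bar> \<le> B * ?P"
  proof -
    have Gint: "integrable M (\<lambda>\<omega>. G (Xl \<omega>))" by (rule comp_integrable[OF G_cont G_B])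
    have "\<bar>(\<integral>\<omega>. G (Xl \<omega>) \<partial>M) - ?L\<bar>
        = \<bar>\<integral>\<omega>. G (Xl \<omega>) - g (Xl \<omega>) * (if \<forall>h\<in>I. s h (Xl \<omega>) \<le> a h then 1 else 0) \<partial>M\<bar>"
      using Gint Lint by simp
    also have "\<dots> \<le> (\<integral>\<omega>. \<bar>G (Xl \<omega>) - g (Xl \<omega>) * (if \<forall>h\<in>I. s h (Xl \<omega>) \<le> a h then 1 else 0)\<bar> \<partial>M)"
      by (rule integral_abs_bound)
    also have "\<dots> \<le> (\<integral>\<omega>. B * (\<Sum>h\<in>I. \<psi> ?\<delta> (a h) (s h (Xl \<omega>))) \<partial>M)"
    proof (rule integral_mono)
      fix \<omega>
      let ?i = "if \<forall>h\<in>I. s h (Xl \<omega>) \<le> a h then 1 else 0 :: real"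
      have "\<bar>G (Xl \<omega>) - g (Xl \<omega>) * ?i\<bar> = \<bar>g (Xl \<omega>)\<bar> * \<bar>?i - (\<Prod>h\<in>I. \<phi> ?\<delta> (a h) (s h (Xl \<omega>)))\<bar>"
        unfolding G_def by (simp only: right_diff_distrib[symmetric] abs_mult abs_minus_commute)
      also have "\<dots> \<le> B * (\<Sum>h\<in>I. \<psi> ?\<delta> (a h) (s h (Xl \<omega>)) + \<bar>s h (Xl \<omega>) - s h (Xl \<omega>)\<bar> / ?\<delta>)"
        by (intro mult_mono B many d B0) auto
      finally show "\<bar>G (Xl \<omega>) - g (Xl \<omega>) * ?i\<bar> \<le> B * (\<Sum>h\<in>I. \<psi> ?\<delta> (a h) (s h (Xl \<omega>)))" by simp
    qed (use Gint Lint \<psi>_int d in auto)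
    also have "\<dots> = B * ?P"
      using \<psi>_int d by simp
    finally show ?thesis .
  qed
  note lim = this
  have "\<forall>\<^sub>F n in sequentially. \<bar>?f n - ?L\<bar> < \<epsilon>"
    using close
  proof eventually_elim
    case (elim n)
    have "\<bar>?f n - avg (\<Omega> n) (\<lambda>Z. G (X n Z))\<bar>
      \<le> avg (\<Omega> n) (\<lambda>Z. \<bar>g (X n Z) * (if \<forall>h\<in>I. stat n h Z \<le> a h then 1 else 0) - G (X n Z)\<bar>)"
      unfolding avg_diff[symmetric] by (rule abs_avg_le)
    also have "\<dots> \<le> avg (\<Omega> n) (\<lambda>Z. B * (\<Sum>h\<in>I. \<psi> ?\<delta> (a h) (s h (X n Z)) + (1 / ?\<delta>) * \<bar>stat n h Z - s h (X n Z)\<bar>))"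
    proof (rule avg_mono)
      fix Z
      let ?i = "if \<forall>h\<in>I. stat n h Z \<le> a h then 1 else 0 :: real"
      have "\<bar>g (X n Z) * ?i - G (X n Z)\<bar> = \<bar>g (X n Z)\<bar> * \<bar>?i - (\<Prod>h\<in>I. \<phi> ?\<delta> (a h) (s h (X n Z)))\<bar>"
        unfolding G_def by (simp only: right_diff_distrib[symmetric] abs_mult)
      also have "\<dots> \<le> B * (\<Sum>h\<in>I. \<psi> ?\<delta> (a h) (s h (X n Z)) + \<bar>stat n h Z - s h (X n Z)\<bar> / ?\<delta>)"
        by (intro mult_mono B many d B0) auto
      finally show "\<bar>g (X n Z) * ?i - G (X n Z)\<bar> \<le> B * (\<Sum>h\<in>I. \<psi> ?\<delta> (a h) (s h (X n Z)) + (1 / ?\<delta>) * \<bar>stat n h Z - s h (X n Z)\<bar>)"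
        by simp
    qed
    also have "\<dots> = B * ?E1 n"
      unfolding avg_cmult avg_sum avg_add by simp
    finally show ?case using elim lim k by linarith
  qed
  then show "\<exists>n0. \<forall>n\<ge>n0. norm (?f n - ?L) < \<epsilon>"
    by (simp add: eventually_sequentially)
qed

end

section \<open>Gaussian blocks truncated to balls\<close>

abbreviation std_normal :: "real measure" where
  "std_normal \<equiv> density lborel std_normal_density"

abbreviation gauss :: "'j set \<Rightarrow> ('j \<Rightarrow> real) measure" where
  "gauss J \<equiv> Pi\<^sub>M J (\<lambda>_. std_normal)"

lemma prob_space_std_normal: "prob_space std_normal"
  by (rule prob_space_normal_density) simp

lemma product_prob_space_gauss: "product_prob_space (\<lambda>_. std_normal)"
  by (intro product_prob_spaceI prob_space_std_normal)

lemma product_sigma_finite_gauss: "product_sigma_finite (\<lambda>_. std_normal)"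
  by (rule product_prob_space.axioms(1)[OF product_prob_space_gauss])

lemma prob_space_gauss: "prob_space (gauss J)"
  by (intro prob_space_PiM prob_space_std_normal)

lemma gauss_cos:
  fixes t :: "'j::finite \<Rightarrow> real"
  shows "(\<integral>\<omega>. cos ((\<Sum>j\<in>UNIV. t j * \<omega> j) + c) \<partial>gauss UNIV) = exp (- (\<Sum>j\<in>UNIV. (t j)\<^sup>2) / 2) * cos c"
proof -
  let ?G = "gauss (UNIV :: 'j set)"
  interpret G: prob_space ?G by (rule prob_space_gauss)
  have ch: "(\<integral>y. iexp (s * y) \<partial>std_normal) = complex_of_real (exp (- (s\<^sup>2) / 2))" for s
    using char_std_normal_distribution unfolding char_def fun_eq_iff by (simp add: of_real_exp)
  have int1: "integrable std_normal (\<lambda>y. iexp (s * y))" for s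
    by (intro prob_space.finite_measure[OF prob_space_std_normal, THEN finite_measure.integrable_const_bound, of _ 1]) auto
  have "(\<integral>\<omega>. (\<Prod>j\<in>UNIV. iexp (t j * \<omega> j)) \<partial>?G) = (\<Prod>j\<in>UNIV. \<integral>y. iexp (t j * y) \<partial>std_normal)"
    by (rule product_sigma_finite.product_integral_prod[OF product_sigma_finite_gauss finite_class.finite_UNIV int1])
  also have "\<dots> = of_real (\<Prod>j\<in>UNIV. exp (- ((t j)\<^sup>2) / 2))"
    by (simp only: ch of_real_prod)
  also have "(\<Prod>j\<in>UNIV. exp (- ((t j)\<^sup>2) / 2)) = exp (- (\<Sum>j\<in>UNIV. (t j)\<^sup>2) / 2)"
    by (simp add: exp_sum[symmetric] sum_negf sum_divide_distrib)
  finally have I: "(\<integral>\<omega>. (\<Prod>j\<in>UNIV. iexp (t j * \<omega> j)) \<partial>?G) = of_real (exp (- (\<Sum>j\<in>UNIV. (t j)\<^sup>2) / 2))" .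
  have intp: "integrable ?G (\<lambda>\<omega>. \<Prod>j\<in>UNIV. iexp (t j * \<omega> j))"
    by (rule product_sigma_finite.product_integrable_prod[OF product_sigma_finite_gauss finite_class.finite_UNIV int1])
  have cos_eq: "cos ((\<Sum>j\<in>UNIV. t j * \<omega> j) + c) = Re (iexp c * (\<Prod>j\<in>UNIV. iexp (t j * \<omega> j)))" for \<omega>
  proof -
    have "iexp c * (\<Prod>j\<in>UNIV. iexp (t j * \<omega> j)) = iexp ((\<Sum>j\<in>UNIV. t j * \<omega> j) + c)"
      by (simp add: exp_sum[symmetric] exp_add[symmetric] sum_distrib_left distrib_left add.commute)
    then show ?thesis by (simp add: Re_exp)
  qed
  have "(\<integral>\<omega>. cos ((\<Sum>j\<in>UNIV. t j * \<omega> j) + c) \<partial>?G) = Re (\<integral>\<omega>. iexp c * (\<Prod>j\<in>UNIV. iexp (t j * \<omega> j)) \<partial>?G)"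
    unfolding cos_eq by (rule integral_Re) (intro integrable_mult_right intp)
  also have "\<dots> = Re (iexp c * of_real (exp (- (\<Sum>j\<in>UNIV. (t j)\<^sup>2) / 2)))"
    using intp I by simp
  also have "\<dots> = exp (- (\<Sum>j\<in>UNIV. (t j)\<^sup>2) / 2) * cos c"
    by (simp add: Re_exp)
  finally show ?thesis .
qed

lemma gauss_sq_integrable:
  assumes "finite J" "i \<in> J"
  shows "integrable (gauss J) (\<lambda>\<omega>. (\<omega> i)\<^sup>2)" "(\<integral>\<omega>. (\<omega> i)\<^sup>2 \<partial>gauss J) = 1"
proof -
  have d: "distr (gauss J) std_normal (\<lambda>\<omega>. \<omega> i) = std_normal"
    using assms by (intro distr_PiM_component prob_space_std_normal) auto
  have m: "(\<lambda>\<omega>. \<omega> i) \<in> gauss J \<rightarrow>\<^sub>M std_normal" using assms by measurable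
  have i2: "integrable std_normal (\<lambda>y. y\<^sup>2)" and v2: "(\<integral>y. y\<^sup>2 \<partial>std_normal) = 1"
    using integrable_std_normal_moment[of 2] std_normal_moment_even[of 1]
    by (auto simp: has_bochner_integral_iff integrable_density integral_density)
  show "integrable (gauss J) (\<lambda>\<omega>. (\<omega> i)\<^sup>2)"
    using i2 integrable_distr_eq[OF m, of "\<lambda>y. y\<^sup>2 :: real"] by (simp add: d)
  show "(\<integral>\<omega>. (\<omega> i)\<^sup>2 \<partial>gauss J) = 1"
    using v2 integral_distr[OF m, of "\<lambda>y. y\<^sup>2 :: real"] by (simp add: d)
qed

lemma integral_odd_std_normal:
  fixes f :: "real \<Rightarrow> real"
  assumes "\<And>y. f (- y) = - f y" "f \<in> borel_measurable borel"
  shows "(\<integral>y. f y \<partial>std_normal) = 0"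
proof -
  have "(\<integral>y. f y \<partial>std_normal) = (\<integral>y. std_normal_density y * f y \<partial>lborel)"
    using assms(2) by (simp add: integral_density)
  moreover have "(\<integral>y. std_normal_density y * f y \<partial>lborel) = (\<integral>y. std_normal_density (- y) * f (- y) \<partial>lborel)"
    using lborel_integral_real_affine[of "-1" "\<lambda>y. std_normal_density y * f y" 0] by simp
  moreover have "(\<integral>y. std_normal_density (- y) * f (- y) \<partial>lborel) = (\<integral>y. - (std_normal_density y * f y) \<partial>lborel)"
    by (intro Bochner_Integration.integral_cong) (simp_all add: assms(1) normal_density_def)
  moreover have "(\<integral>y. - (std_normal_density y * f y) \<partial>lborel) = - (\<integral>y. std_normal_density y * f y \<partial>lborel)"
    by (rule Bochner_Integration.integral_minus)
  ultimately show ?thesis by linarith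
qed

lemma integral_odd_gauss:
  fixes f :: "('j::finite \<Rightarrow> real) \<Rightarrow> real"
  assumes f: "integrable (gauss UNIV) f" and odd: "\<And>x. f (x(i := - x i)) = - f x"
  shows "(\<integral>\<omega>. f \<omega> \<partial>gauss UNIV) = 0"
proof -
  have U: "insert i (UNIV - {i}) = UNIV" by auto
  have "(\<integral>\<omega>. f \<omega> \<partial>gauss UNIV) = (\<integral>x. (\<integral>y. f (x(i := y)) \<partial>std_normal) \<partial>gauss (UNIV - {i}))"
    using product_sigma_finite.product_integral_insert[OF product_sigma_finite_gauss, of "UNIV - {i}" i f] f unfolding U by simp
  also have "\<dots> = (\<integral>x. 0 \<partial>gauss (UNIV - {i}))"
  proof (rule Bochner_Integration.integral_cong[OF refl])
    fix x assume x: "x \<in> space (gauss (UNIV - {i}))"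
    have fm: "f \<in> borel_measurable (gauss (insert i (UNIV - {i})))"
      using f unfolding U by simp
    have "(\<lambda>y. f (x(i := y))) \<in> borel_measurable std_normal"
      using measurable_comp[OF measurable_component_update[OF x] fm] by (simp add: comp_def)
    then show "(\<integral>y. f (x(i := y)) \<partial>std_normal) = 0"
      using odd[of "x(i := _)"] by (intro integral_odd_std_normal) auto
  qed
  finally show ?thesis by simp
qed

lemma gauss_eq_density:
  assumes J: "finite J"
  shows "gauss J = density (Pi\<^sub>M J (\<lambda>_. lborel)) (\<lambda>y. ennreal (\<Prod>j\<in>J. std_normal_density (y j)))"
proof (rule product_sigma_finite.PiM_eqI[OF product_sigma_finite_gauss J, symmetric])
  interpret L: product_sigma_finite "\<lambda>_::'a. lborel :: real measure" ..
  show "sets (density (Pi\<^sub>M J (\<lambda>_. lborel)) (\<lambda>y. ennreal (\<Prod>j\<in>J. std_normal_density (y j)))) = sets (gauss J)"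
    by (auto intro!: sets_PiM_cong)
  fix A :: "'a \<Rightarrow> real set" assume A: "\<And>i. i \<in> J \<Longrightarrow> A i \<in> sets std_normal"
  then have [measurable]: "\<And>i. i \<in> J \<Longrightarrow> A i \<in> sets borel" by simp
  have "emeasure (density (Pi\<^sub>M J (\<lambda>_. lborel)) (\<lambda>y. ennreal (\<Prod>j\<in>J. std_normal_density (y j)))) (Pi\<^sub>E J A)
    = (\<integral>\<^sup>+y. ennreal (\<Prod>j\<in>J. std_normal_density (y j)) * indicator (Pi\<^sub>E J A) y \<partial>Pi\<^sub>M J (\<lambda>_. lborel))"
    using A J by (intro emeasure_density) (auto intro!: sets_PiM_I_finite)
  also have "\<dots> = (\<integral>\<^sup>+y. (\<Prod>j\<in>J. ennreal (std_normal_density (y j)) * indicator (A j) (y j)) \<partial>Pi\<^sub>M J (\<lambda>_. lborel))"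
  proof (rule nn_integral_cong)
    fix y assume y: "y \<in> space (Pi\<^sub>M J (\<lambda>_. lborel :: real measure))"
    have "(indicator (Pi\<^sub>E J A) y :: ennreal) = (\<Prod>j\<in>J. indicator (A j) (y j))"
      using y J by (auto simp: indicator_def space_PiM PiE_iff prod_zero_iff)
    then show "ennreal (\<Prod>j\<in>J. std_normal_density (y j)) * indicator (Pi\<^sub>E J A) y
       = (\<Prod>j\<in>J. ennreal (std_normal_density (y j)) * indicator (A j) (y j))"
      by (simp add: prod.distrib prod_ennreal)
  qed
  also have "\<dots> = (\<Prod>j\<in>J. \<integral>\<^sup>+y. ennreal (std_normal_density y) * indicator (A j) y \<partial>lborel)"
    using J by (intro L.product_nn_integral_prod) auto
  also have "\<dots> = (\<Prod>j\<in>J. emeasure std_normal (A j))"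
    using A by (intro prod.cong refl) (simp add: emeasure_density)
  finally show "emeasure (density (Pi\<^sub>M J (\<lambda>_. lborel)) (\<lambda>y. ennreal (\<Prod>j\<in>J. std_normal_density (y j)))) (Pi\<^sub>E J A)
    = (\<Prod>j\<in>J. emeasure std_normal (A j))" .
qed

lemma distr_sq_norm_lborel:
  assumes J: "finite J" "J \<noteq> {}"
  shows "distr (Pi\<^sub>M J (\<lambda>_. lborel)) borel (\<lambda>y. \<Sum>j\<in>J. (y j)\<^sup>2)
    = density lborel (\<lambda>r. ennreal (if r > 0 then unit_ball_vol (real (card J)) * (real (card J) / 2) * r powr (real (card J) / 2 - 1) else 0))"
    (is "?D = density lborel (\<lambda>r. ennreal (?k r))")
proof (rule measure_eqI_generator_eq[where E = "range (\<lambda>a. {..a})" and \<Omega> = UNIV and A = "\<lambda>i. {..real i}"])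
  interpret L: product_sigma_finite "\<lambda>_::'a. lborel :: real measure" ..
  let ?N = "Pi\<^sub>M J (\<lambda>_. lborel :: real measure)"
  let ?C = "unit_ball_vol (real (card J))"
  define p where "p = real (card J) / 2"
  have card: "card J > 0" using J by (simp add: card_gt_0_iff)
  have p: "p > 0" using card by (simp add: p_def)
  have meas [measurable]: "(\<lambda>y. \<Sum>j\<in>J. (y j)\<^sup>2) \<in> borel_measurable ?N" by measurable
  have D: "emeasure ?D {..x} = (if x > 0 then ennreal (?C * x powr p) else 0)" for x
  proof -
    have e: "emeasure ?D {..x} = emeasure ?N ({y. (\<Sum>j\<in>J. (y j)\<^sup>2) \<le> x} \<inter> space ?N)"
      by (subst emeasure_distr) (auto intro!: arg_cong[where f = "emeasure ?N"])
    consider "x > 0" | "x = 0" | "x < 0" by linarith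
    then show ?thesis
    proof cases
      case 1
      have "{y. (\<Sum>j\<in>J. (y j)\<^sup>2) \<le> x} = {y. sqrt (\<Sum>j\<in>J. (y j)\<^sup>2) \<le> sqrt x}" by simp
      then have "emeasure ?D {..x} = ennreal (?C * sqrt x ^ card J)"
        using emeasure_cball_aux[OF J(1), of "sqrt x"] 1 by (simp only: e) simp
      also have "sqrt x ^ card J = x powr p"
        using 1 by (simp add: p_def powr_half_sqrt[symmetric] powr_powr powr_realpow[symmetric] del: powr_half_sqrt)
      finally show ?thesis using 1 by simp
    next
      case 2
      have "{y. (\<Sum>j\<in>J. (y j)\<^sup>2) \<le> 0} \<inter> space ?N = Pi\<^sub>E J (\<lambda>_. {0})"
      proof -
        have "(\<Sum>j\<in>J. (y j)\<^sup>2) \<le> 0 \<longleftrightarrow> (\<forall>j\<in>J. y j = 0)" for y :: "'a \<Rightarrow> real"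
          using J sum_nonneg_eq_0_iff[of J "\<lambda>j. (y j)\<^sup>2"] sum_nonneg[of J "\<lambda>j. (y j)\<^sup>2"] by auto
        then show ?thesis by (auto simp: space_PiM PiE_iff intro!: extensionalityI[of _ J])
      qed
      then have "emeasure ?D {..x} = emeasure ?N (Pi\<^sub>E J (\<lambda>_. {0}))" using 2 e by simp
      also have "\<dots> = (\<Prod>j\<in>J. emeasure lborel {0::real})"
        using J by (intro L.emeasure_PiM) auto
      also have "\<dots> = 0" using J by auto
      finally show ?thesis using 2 by simp
    next
      case 3
      have "\<not> (\<Sum>j\<in>J. (y j)\<^sup>2) \<le> x" for y :: "'a \<Rightarrow> real"
        using 3 sum_nonneg[of J "\<lambda>j. (y j)\<^sup>2"] by auto
      then show ?thesis using 3 e by simp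
    qed
  qed
  have K: "emeasure (density lborel (\<lambda>r. ennreal (?k r))) {..x} = (if x > 0 then ennreal (?C * x powr p) else 0)" for x
  proof -
    have "emeasure (density lborel (\<lambda>r. ennreal (?k r))) {..x} = (\<integral>\<^sup>+r. ennreal (?k r) * indicator {..x} r \<partial>lborel)"
      by (intro emeasure_density) auto
    also have "\<dots> = (if x > 0 then ennreal (?C * x powr p) else 0)"
    proof (cases "x > 0")
      case True
      have "((\<lambda>r. r powr (p - 1)) has_integral (x powr (p - 1 + 1) / (p - 1 + 1))) {0..x}"
        using True p by (intro has_integral_powr_from_0) auto
      then have "((\<lambda>r. ?C * p * r powr (p - 1)) has_integral (?C * p * (x powr (p - 1 + 1) / (p - 1 + 1)))) {0..x}"
        by (rule has_integral_mult_right)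
      then have hi: "((\<lambda>r. ?C * p * r powr (p - 1)) has_integral (?C * x powr p)) {0..x}"
        using p by simp
      have "(\<integral>\<^sup>+r. ennreal (?C * p * r powr (p - 1)) * indicator {0..x} r \<partial>lborel) = ennreal (?C * x powr p)"
        using p by (intro nn_integral_has_integral_lebesgue'[OF _ hi]) auto
      moreover have "(\<integral>\<^sup>+r. ennreal (?k r) * indicator {..x} r \<partial>lborel)
         = (\<integral>\<^sup>+r. ennreal (?C * p * r powr (p - 1)) * indicator {0..x} r \<partial>lborel)"
        by (intro nn_integral_cong) (auto simp: p_def indicator_def)
      ultimately show ?thesis using True by simp
    next
      case False
      then have "(\<integral>\<^sup>+r. ennreal (?k r) * indicator {..x} r \<partial>lborel) = (\<integral>\<^sup>+r. 0 \<partial>(lborel :: real measure))"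
        by (intro nn_integral_cong) (auto simp: indicator_def)
      then show ?thesis using False by simp
    qed
    finally show ?thesis .
  qed
  show "emeasure ?D X = emeasure (density lborel (\<lambda>r. ennreal (?k r))) X" if "X \<in> range (\<lambda>a. {..a})" for X
    using that D K by auto
  show "emeasure ?D {..real i} \<noteq> \<infinity>" for i
    unfolding D by auto
  show "sets ?D = sigma_sets UNIV (range (\<lambda>a. {..a}))"
    by (simp add: borel_eq_atMost)
  show "sets (density lborel (\<lambda>r. ennreal (?k r))) = sigma_sets UNIV (range (\<lambda>a. {..a}))"
    by (simp add: borel_eq_atMost)
  show "(\<Union>i. {..real i}) = UNIV"
    by (auto simp: real_arch_simple)
qed (auto simp: Int_stable_def)

lemma chi2_density_nonneg: "0 \<le> chi2_density m r"
  by (cases "m = 0") (auto simp: chi2_density_def intro!: divide_nonneg_nonneg mult_nonneg_nonneg Gamma_real_nonneg)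

lemma chi2_density_measurable [measurable]: "chi2_density m \<in> borel_measurable borel"
  unfolding chi2_density_def by measurable

lemma distr_sq_norm_gauss:
  assumes J: "finite J" "J \<noteq> {}"
  shows "distr (gauss J) borel (\<lambda>y. \<Sum>j\<in>J. (y j)\<^sup>2) = density lborel (\<lambda>r. ennreal (chi2_density (card J) r))"
proof -
  let ?N = "Pi\<^sub>M J (\<lambda>_. lborel :: real measure)"
  let ?q = "\<lambda>y. \<Sum>j\<in>J. (y j)\<^sup>2 :: real"
  define c where "c = (1 / sqrt (2 * pi)) ^ card J"
  let ?k = "\<lambda>r. if r > 0 then unit_ball_vol (real (card J)) * (real (card J) / 2) * r powr (real (card J) / 2 - 1) else 0"
  have card: "card J > 0" using J by (simp add: card_gt_0_iff)
  have pr: "(\<Prod>j\<in>J. std_normal_density (y j)) = c * exp (- ?q y / 2)" for y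
    by (simp add: std_normal_density_def prod_dividef power_divide c_def exp_sum[symmetric] J sum_negf sum_divide_distrib)
  have "distr (gauss J) borel ?q = distr (density ?N (\<lambda>y. ennreal (c * exp (- ?q y / 2)))) borel ?q"
    unfolding gauss_eq_density[OF J(1)] pr ..
  also have "\<dots> = density (distr ?N borel ?q) (\<lambda>r. ennreal (c * exp (- r / 2)))"
    by (subst density_distr) auto
  also have "\<dots> = density (density lborel (\<lambda>r. ennreal (?k r))) (\<lambda>r. ennreal (c * exp (- r / 2)))"
    by (simp only: distr_sq_norm_lborel[OF J])
  also have "\<dots> = density lborel (\<lambda>r. ennreal (?k r) * ennreal (c * exp (- r / 2)))"
    by (intro density_density_eq) auto
  also have "\<dots> = density lborel (\<lambda>r. ennreal (chi2_density (card J) r))"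
  proof (intro arg_cong[where f = "density lborel"] ext)
    fix r :: real
    have c: "c = (2 * pi) powr (- (real (card J) / 2))"
    proof -
      have "(2 * pi) powr (- (1/2)) = inverse ((2 * pi) powr (1/2))" by (rule powr_minus)
      also have "\<dots> = 1 / sqrt (2 * pi)" by (subst powr_half_sqrt) (auto simp: inverse_eq_divide)
      finally have "c = ((2 * pi) powr (- (1/2))) powr real (card J)"
        unfolding c_def by (subst powr_realpow) auto
      then show ?thesis by (simp only: powr_powr) simp
    qed
    have const: "unit_ball_vol (real (card J)) * (real (card J) / 2) * c = 1 / (2 powr (real (card J) / 2) * Gamma (real (card J) / 2))"
    proof -
      have G: "Gamma (real (card J) / 2 + 1) = real (card J) / 2 * Gamma (real (card J) / 2)"
        using card by (intro Gamma_plus1) (auto elim!: nonpos_Ints_cases)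
      have "pi powr (real (card J) / 2) * (2 * pi) powr (- (real (card J) / 2)) = 1 / 2 powr (real (card J) / 2)"
        by (simp add: powr_mult powr_minus field_simps)
      note pq = this
      have alg: "P / (k * g) * k * Q = P * Q / g" if "k \<noteq> 0" for P Q k g :: real
        using that by simp
      show ?thesis
        unfolding unit_ball_vol_def c G using card by (subst alg) (auto simp: pq)
    qed
    have "?k r * (c * exp (- r / 2)) = chi2_density (card J) r"
    proof (cases "r > 0")
      case True
      have "?k r * (c * exp (- r / 2))
        = (unit_ball_vol (real (card J)) * (real (card J) / 2) * c) * (r powr (real (card J) / 2 - 1) * exp (- r / 2))"
        using True by simp
      then show ?thesis unfolding const using True by (simp add: chi2_density_def)
    qed (simp add: chi2_density_def)
    moreover have "0 \<le> ?k r" by simp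
    ultimately show "ennreal (?k r) * ennreal (c * exp (- r / 2)) = ennreal (chi2_density (card J) r)"
      by (metis ennreal_mult')
  qed
  finally show ?thesis .
qed

lemma sq_norm_gauss_measurable [measurable]:
  "finite J \<Longrightarrow> J \<subseteq> K \<Longrightarrow> (\<lambda>y. \<Sum>j\<in>J. (y j)\<^sup>2 :: real) \<in> borel_measurable (gauss K)"
  by (intro borel_measurable_sum borel_measurable_power) (auto intro!: measurable_component_singleton[THEN measurable_compose])

lemma integral_sq_norm_gauss:
  fixes f :: "real \<Rightarrow> real"
  assumes J: "finite J" "J \<noteq> {}" and f [measurable]: "f \<in> borel_measurable borel"
  shows "(\<integral>y. f (\<Sum>j\<in>J. (y j)\<^sup>2) \<partial>gauss J) = (\<integral>r. chi2_density (card J) r * f r \<partial>lborel)"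
proof -
  have "(\<integral>y. f (\<Sum>j\<in>J. (y j)\<^sup>2) \<partial>gauss J) = (\<integral>r. f r \<partial>distr (gauss J) borel (\<lambda>y. \<Sum>j\<in>J. (y j)\<^sup>2))"
    using J by (subst integral_distr) auto
  also have "\<dots> = (\<integral>r. f r \<partial>density lborel (\<lambda>r. ennreal (chi2_density (card J) r)))"
    by (simp only: distr_sq_norm_gauss[OF J])
  also have "\<dots> = (\<integral>r. chi2_density (card J) r * f r \<partial>lborel)"
    by (subst integral_density) (auto simp: chi2_density_nonneg)
  finally show ?thesis .
qed

lemma prob_sq_norm_le:
  assumes J: "finite J" "J \<noteq> {}"
  shows "(\<integral>y. (if (\<Sum>j\<in>J. (y j)\<^sup>2) \<le> a then 1 else 0) \<partial>gauss J) = chi2_cdf (card J) a"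
proof -
  have "(\<integral>y. (if (\<Sum>j\<in>J. (y j)\<^sup>2) \<le> a then 1 else 0) \<partial>gauss J) = (\<integral>r. chi2_density (card J) r * (if r \<le> a then 1 else 0) \<partial>lborel)"
    by (rule integral_sq_norm_gauss[OF J]) measurable
  also have "\<dots> = chi2_cdf (card J) a"
    unfolding chi2_cdf_def set_lebesgue_integral_def
    by (intro Bochner_Integration.integral_cong refl) (auto simp: indicator_def chi2_density_def)
  finally show ?thesis .
qed

lemma chi2_density_shift:
  assumes "m > 0"
  shows "chi2_density m r * r = real m * chi2_density (m + 2) r"
proof (cases "r > 0")
  case True
  have G: "Gamma (real m / 2 + 1) = real m / 2 * Gamma (real m / 2)"
    using assms by (intro Gamma_plus1) (auto elim!: nonpos_Ints_cases)
  have e: "real (m + 2) / 2 = real m / 2 + 1" by simp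
  have p1: "r powr (real m / 2 - 1) * r = r powr (real m / 2)"
    using True powr_add[of r "real m / 2 - 1" 1] by simp
  have p2: "2 powr (real m / 2 + 1) = 2 * 2 powr (real m / 2)"
    by (simp add: powr_add)
  have "chi2_density m r * r = (r powr (real m / 2 - 1) * r) * exp (- r / 2) / (2 powr (real m / 2) * Gamma (real m / 2))"
    using True by (simp add: chi2_density_def)
  also have "\<dots> = real m * (r powr (real m / 2) * exp (- r / 2) / (2 * 2 powr (real m / 2) * (real m / 2 * Gamma (real m / 2))))"
    unfolding p1 using assms by simp
  also have "\<dots> = real m * chi2_density (m + 2) r"
    unfolding chi2_density_def e p2 G using True by simp
  finally show ?thesis .
qed (simp add: chi2_density_def)

lemma truncated_sq_norm:
  assumes J: "finite J" "J \<noteq> {}"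
  shows "(\<integral>y. (\<Sum>j\<in>J. (y j)\<^sup>2) * (if (\<Sum>j\<in>J. (y j)\<^sup>2) \<le> a then 1 else 0) \<partial>gauss J) = real (card J) * chi2_cdf (card J + 2) a"
proof -
  have card: "card J > 0" using J by (simp add: card_gt_0_iff)
  have "(\<integral>y. (\<Sum>j\<in>J. (y j)\<^sup>2) * (if (\<Sum>j\<in>J. (y j)\<^sup>2) \<le> a then 1 else 0) \<partial>gauss J)
     = (\<integral>r. chi2_density (card J) r * (r * (if r \<le> a then 1 else 0)) \<partial>lborel)"
    by (rule integral_sq_norm_gauss[OF J]) measurable
  also have "\<dots> = (\<integral>r. real (card J) * (chi2_density (card J + 2) r * (if r \<le> a then 1 else 0)) \<partial>lborel)"
    by (simp only: mult.assoc[symmetric] chi2_density_shift[OF card])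
  also have "\<dots> = real (card J) * (\<integral>r. chi2_density (card J + 2) r * (if r \<le> a then 1 else 0) \<partial>lborel)"
    by simp
  also have "(\<integral>r. chi2_density (card J + 2) r * (if r \<le> a then 1 else 0) \<partial>lborel) = chi2_cdf (card J + 2) a"
    unfolding chi2_cdf_def set_lebesgue_integral_def
    by (intro Bochner_Integration.integral_cong refl) (auto simp: indicator_def chi2_density_def)
  finally show ?thesis .
qed

lemma AE_sq_norm_neq:
  assumes J: "finite J" "J \<noteq> {}"
  shows "AE y in gauss J. (\<Sum>j\<in>J. (y j)\<^sup>2) \<noteq> a"
proof -
  have "AE r in distr (gauss J) borel (\<lambda>y. \<Sum>j\<in>J. (y j)\<^sup>2). r \<noteq> a"
    unfolding distr_sq_norm_gauss[OF J] using AE_lborel_singleton[of a]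
    by (subst AE_density) auto
  then show ?thesis
    using J by (subst (asm) AE_distr_iff) auto
qed

lemma chi2_cdf_pos:
  assumes "m > 0" "a > 0"
  shows "chi2_cdf m a > 0"
proof -
  let ?J = "{..<m}"
  interpret prob_space "gauss ?J" by (rule prob_space_gauss)
  have J: "finite ?J" "?J \<noteq> {}" using assms by auto
  have p: "chi2_density m r > 0" if "r > 0" for r
    using that assms by (auto simp: chi2_density_def intro!: divide_pos_pos mult_pos_pos Gamma_real_pos)
  have int: "integrable lborel (\<lambda>r. chi2_density m r * (if r \<le> a then 1 else 0))"
  proof -
    have "integrable (gauss ?J) (\<lambda>y. if (\<Sum>j\<in>?J. (y j)\<^sup>2) \<le> a then 1 else 0 :: real)"
      using J by (intro integrable_const_bound[of _ 1]) auto
    then have "integrable (distr (gauss ?J) borel (\<lambda>y. \<Sum>j\<in>?J. (y j)\<^sup>2)) (\<lambda>r. if r \<le> a then 1 else 0 :: real)"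
      using J by (subst integrable_distr_eq) auto
    then show ?thesis
      unfolding distr_sq_norm_gauss[OF J] by (subst (asm) integrable_density) (auto simp: chi2_density_nonneg)
  qed
  have eq: "chi2_cdf m a = (\<integral>r. chi2_density m r * (if r \<le> a then 1 else 0) \<partial>lborel)"
    unfolding chi2_cdf_def set_lebesgue_integral_def
    by (intro Bochner_Integration.integral_cong refl) (auto simp: indicator_def chi2_density_def)
  have "chi2_cdf m a \<noteq> 0"
  proof
    assume "chi2_cdf m a = 0"
    then have "AE r in lborel. chi2_density m r * (if r \<le> a then 1 else 0) = 0"
      using integral_nonneg_eq_0_iff_AE[OF int] chi2_density_nonneg unfolding eq by auto
    then have "AE r in lborel. r \<notin> {0<..<a}"
      by eventually_elim (use p in force)
    then have "emeasure lborel {0<..<a} = 0"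
      by (subst (asm) AE_iff_measurable[of "{0<..<a}"]) auto
    then show False using assms by simp
  qed
  moreover have "0 \<le> chi2_cdf m a"
    unfolding eq by (intro integral_nonneg_AE) (auto simp: chi2_density_nonneg)
  ultimately show ?thesis by simp
qed

lemma truncated_coordinate:
  assumes J: "finite J" "J \<noteq> {}" and i: "i \<in> J"
  shows "integrable (gauss J) (\<lambda>y. (y i)\<^sup>2 * (if (\<Sum>j\<in>J. (y j)\<^sup>2) \<le> a then 1 else 0))" (is ?int)
    and "(\<integral>y. (y i)\<^sup>2 * (if (\<Sum>j\<in>J. (y j)\<^sup>2) \<le> a then 1 else 0) \<partial>gauss J) = chi2_cdf (card J + 2) a" (is ?eq)
proof -
  let ?f = "\<lambda>i y. (y i)\<^sup>2 * (if (\<Sum>j\<in>J. (y j)\<^sup>2) \<le> a then 1 else 0 :: real)"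
  have coord [measurable]: "(\<lambda>y. y k) \<in> borel_measurable (gauss J)" if "k \<in> J" for k
    using measurable_component_singleton[OF that, of "\<lambda>_. std_normal"] by simp
  have int: "integrable (gauss J) (?f k)" if k: "k \<in> J" for k
    by (rule Bochner_Integration.integrable_bound[OF gauss_sq_integrable(1)[OF J(1) k]])
       (use J k in \<open>auto intro!: borel_measurable_times borel_measurable_power coord\<close>)
  then show ?int using i .
  have same: "(\<integral>y. ?f k y \<partial>gauss J) = (\<integral>y. ?f i y \<partial>gauss J)" if k: "k \<in> J" for k
  proof -
    let ?t = "Transposition.transpose i k"
    let ?T = "\<lambda>\<omega>. \<lambda>n\<in>J. \<omega> (?t n) :: real"
    have tJ: "?t n \<in> J" if "n \<in> J" for n using that i k by (auto simp: Transposition.transpose_def)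
    have bij: "bij_betw ?t J J" using i k by (intro bij_betw_byWitness[where f' = ?t]) (auto simp: tJ)
    have D: "distr (gauss J) (gauss J) ?T = gauss J"
      using distr_PiM_reindex[of J "\<lambda>_. std_normal" ?t J] prob_space_std_normal tJ by (auto simp: Pi_iff)
    have "(\<integral>y. ?f k y \<partial>gauss J) = (\<integral>y. ?f k y \<partial>distr (gauss J) (gauss J) ?T)" by (simp only: D)
    also have "\<dots> = (\<integral>y. ?f k (?T y) \<partial>gauss J)"
      using int[OF k] tJ by (intro integral_distr) (auto intro!: measurable_restrict measurable_component_singleton)
    also have "\<dots> = (\<integral>y. ?f i y \<partial>gauss J)"
    proof (intro Bochner_Integration.integral_cong refl)
      fix y :: "'a \<Rightarrow> real"
      have "(\<Sum>j\<in>J. (?T y j)\<^sup>2) = (\<Sum>j\<in>J. (y (?t j))\<^sup>2)" by (intro sum.cong) auto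
      also have "\<dots> = (\<Sum>j\<in>J. (y j)\<^sup>2)"
        using bij by (rule sum.reindex_bij_betw)
      finally show "?f k (?T y) = ?f i y" using k by simp
    qed
    finally show ?thesis .
  qed
  have "real (card J) * (\<integral>y. ?f i y \<partial>gauss J) = (\<Sum>k\<in>J. \<integral>y. ?f k y \<partial>gauss J)"
    by (simp add: same)
  also have "\<dots> = (\<integral>y. (\<Sum>k\<in>J. ?f k y) \<partial>gauss J)"
    by (rule Bochner_Integration.integral_sum[symmetric]) (rule int)
  also have "\<dots> = real (card J) * chi2_cdf (card J + 2) a"
    unfolding truncated_sq_norm[OF J, symmetric] by (simp add: sum_distrib_right)
  finally show ?eq using J by simp
qed

lemma v_const_le_1:
  assumes m: "m > 0" and a: "a > 0"
  shows "v_const m a \<le> 1"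
proof -
  let ?J = "{..<m}" let ?q = "\<lambda>y. \<Sum>j<m. (y j)\<^sup>2 :: real" let ?i = "\<lambda>y. if ?q y \<le> a then 1 else 0 :: real"
  interpret prob_space "gauss ?J" by (rule prob_space_gauss)
  have J: "finite ?J" "?J \<noteq> {}" using m by auto
  have q_int: "integrable (gauss ?J) ?q"
    using gauss_sq_integrable(1)[OF J(1)] by auto
  have i_int: "integrable (gauss ?J) ?i"
    using J by (intro integrable_const_bound[of _ 1]) auto
  have qi_int: "integrable (gauss ?J) (\<lambda>y. ?q y * ?i y)"
    by (rule Bochner_Integration.integrable_bound[OF q_int]) (use J in \<open>auto intro!: borel_measurable_times\<close>)
  have q1: "(\<integral>y. ?q y \<partial>gauss ?J) = real m"
    using gauss_sq_integrable[OF J(1)] by (subst Bochner_Integration.integral_sum) auto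
  have pr: "(\<integral>y. ?i y \<partial>gauss ?J) = chi2_cdf m a"
    using prob_sq_norm_le[OF J] by simp
  have tr: "(\<integral>y. ?q y * ?i y \<partial>gauss ?J) = real m * chi2_cdf (m + 2) a"
    using truncated_sq_norm[OF J] by simp
  have "(\<integral>y. ?q y * ?i y \<partial>gauss ?J) \<le> real m * (\<integral>y. ?i y \<partial>gauss ?J)"
  proof (cases "a \<le> real m")
    case True
    have "(\<integral>y. ?q y * ?i y \<partial>gauss ?J) \<le> (\<integral>y. real m * ?i y \<partial>gauss ?J)"
      using True qi_int i_int by (intro integral_mono) auto
    then show ?thesis by simp
  next
    case False
    have "(\<integral>y. real m * (1 - ?i y) \<partial>gauss ?J) \<le> (\<integral>y. ?q y - ?q y * ?i y \<partial>gauss ?J)"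
      using False qi_int i_int q_int by (intro integral_mono) auto
    then show ?thesis using qi_int i_int q_int by (simp add: q1 right_diff_distrib prob_space)
  qed
  then have "chi2_cdf (m + 2) a \<le> chi2_cdf m a"
    unfolding tr pr using m by simp
  then show ?thesis
    unfolding v_const_def using chi2_cdf_pos[OF m a] by simp
qed

definition in_balls :: "('h \<Rightarrow> 'j set) \<Rightarrow> ('h \<Rightarrow> real) \<Rightarrow> 'h set \<Rightarrow> ('j \<Rightarrow> real) \<Rightarrow> real" where
  "in_balls J a H x = (if \<forall>h\<in>H. (\<Sum>j\<in>J h. (x j)\<^sup>2) \<le> a h then 1 else 0)"

lemma in_balls_bounds: "0 \<le> in_balls J a H x" "in_balls J a H x \<le> 1"
  by (auto simp: in_balls_def)

lemma in_balls_insert: "in_balls J a (insert h H) x = in_balls J a H x * in_balls J a {h} x"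
  by (simp add: in_balls_def)

lemma in_balls_empty [simp]: "in_balls J a {} x = 1"
  by (simp add: in_balls_def)

lemma coord_measurable: "k \<in> K \<Longrightarrow> (\<lambda>y. y k :: real) \<in> borel_measurable (gauss K)"
  using measurable_component_singleton[of k K "\<lambda>_. std_normal"] by simp

lemma in_balls_measurable:
  fixes J :: "'h \<Rightarrow> 'j::finite set"
  assumes "finite H" "\<And>h. h \<in> H \<Longrightarrow> J h \<subseteq> K"
  shows "in_balls J a H \<in> borel_measurable (gauss K)"
  unfolding in_balls_def
proof (rule measurable_If)
  show "{x \<in> space (gauss K). \<forall>h\<in>H. (\<Sum>j\<in>J h. (x j)\<^sup>2) \<le> a h} \<in> sets (gauss K)"
    using assms by (intro sets.sets_Collect_finite_All borel_measurable_le sq_norm_gauss_measurable) auto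
qed (rule borel_measurable_const)+

lemma in_balls_merge:
  assumes "\<And>h. h \<in> H \<Longrightarrow> J h \<inter> D = {}"
  shows "in_balls J a H (merge (- D) D (x, y)) = in_balls J a H x"
proof -
  have "(\<Sum>j\<in>J h. (merge (- D) D (x, y) j)\<^sup>2) = (\<Sum>j\<in>J h. (x j)\<^sup>2)" if "h \<in> H" for h
    using assms[OF that] by (intro sum.cong) (auto simp: merge_def)
  then show ?thesis by (simp add: in_balls_def)
qed

lemma in_balls_single_merge:
  assumes "J h \<subseteq> D"
  shows "in_balls J a {h} (merge (- D) D (x, y)) = in_balls J a {h} y"
proof -
  have "(\<Sum>j\<in>J h. (merge (- D) D (x, y) j)\<^sup>2) = (\<Sum>j\<in>J h. (y j)\<^sup>2)"
    using assms by (intro sum.cong) (auto simp: merge_def)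
  then show ?thesis by (simp add: in_balls_def)
qed

lemma gauss_factor:
  fixes u w :: "('j::finite \<Rightarrow> real) \<Rightarrow> real"
  assumes int: "integrable (gauss UNIV) (\<lambda>x. u x * w x)"
    and u: "\<And>x y. u (merge (- D) D (x, y)) = u x" and w: "\<And>x y. w (merge (- D) D (x, y)) = w y"
  shows "(\<integral>x. u x * w x \<partial>gauss UNIV) = (\<integral>x. u x \<partial>gauss (- D)) * (\<integral>y. w y \<partial>gauss D)"
proof -
  have U: "- D \<union> D = UNIV" by auto
  have "(\<integral>x. u x * w x \<partial>gauss UNIV)
      = (\<integral>x. (\<integral>y. u (merge (- D) D (x, y)) * w (merge (- D) D (x, y)) \<partial>gauss D) \<partial>gauss (- D))"
    using product_sigma_finite.product_integral_fold[OF product_sigma_finite_gauss, of "- D" D "\<lambda>x. u x * w x"] int unfolding U by simp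
  also have "\<dots> = (\<integral>x. (\<integral>y. u x * w y \<partial>gauss D) \<partial>gauss (- D))"
    by (simp only: u w)
  also have "\<dots> = (\<integral>x. u x * (\<integral>y. w y \<partial>gauss D) \<partial>gauss (- D))"
    by simp
  also have "\<dots> = (\<integral>x. u x \<partial>gauss (- D)) * (\<integral>y. w y \<partial>gauss D)"
    by (rule integral_mult_left_zero)
  finally show ?thesis .
qed

lemma integrable_times_in_balls:
  fixes J :: "'h \<Rightarrow> 'j::finite set"
  assumes "integrable (gauss UNIV) f" "finite H"
  shows "integrable (gauss UNIV) (\<lambda>x. f x * in_balls J a H x :: real)"
proof (rule Bochner_Integration.integrable_bound[OF assms(1)])
  show "AE x in gauss UNIV. norm (f x * in_balls J a H x) \<le> norm (f x)"
    using in_balls_bounds[of J a H] by (auto simp: abs_mult intro!: mult_left_le)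
qed (intro borel_measurable_times borel_measurable_integrable in_balls_measurable assms subset_UNIV)

lemma integrable_in_balls:
  fixes J :: "'h \<Rightarrow> 'j::finite set"
  assumes "finite H"
  shows "integrable (gauss UNIV) (in_balls J a H)"
proof -
  interpret prob_space "gauss (UNIV :: 'j set)" by (rule prob_space_gauss)
  show ?thesis using integrable_times_in_balls[of "\<lambda>_. 1" H J a] assms by simp
qed

lemma coord_prod_integrable:
  "integrable (gauss (UNIV :: 'j::finite set)) (\<lambda>x. x i * x k)"
proof (rule Bochner_Integration.integrable_bound)
  show "integrable (gauss (UNIV :: 'j set)) (\<lambda>x. (x i)\<^sup>2 + (x k)\<^sup>2)"
    by (intro Bochner_Integration.integrable_add gauss_sq_integrable) auto
  show "AE x in gauss (UNIV :: 'j set). norm (x i * x k) \<le> norm ((x i)\<^sup>2 + (x k)\<^sup>2)"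
    using abs_mult_le_sum_squares by (auto simp: abs_of_nonneg)
qed (intro borel_measurable_times coord_measurable UNIV_I)

lemma coord_integrable: "integrable (gauss (UNIV :: 'j::finite set)) (\<lambda>x. x i)"
proof -
  interpret prob_space "gauss (UNIV :: 'j set)" by (rule prob_space_gauss)
  show ?thesis
  proof (rule Bochner_Integration.integrable_bound)
    show "integrable (gauss (UNIV :: 'j set)) (\<lambda>x. 1 + (x i)\<^sup>2)"
      by (intro Bochner_Integration.integrable_add gauss_sq_integrable) auto
    have "\<bar>y\<bar> \<le> 1 + y\<^sup>2" for y :: real
      using sum_squares_bound[of "\<bar>y\<bar>" 1] by simp
    then show "AE x in gauss (UNIV :: 'j set). norm (x i) \<le> norm (1 + (x i)\<^sup>2)"
      by (auto simp: abs_of_nonneg)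
  qed (intro coord_measurable UNIV_I)
qed

lemma in_balls_flip: "in_balls J a H (x(i := - x i)) = in_balls J a H x"
proof -
  have "(\<Sum>j\<in>J h. ((x(i := - x i)) j)\<^sup>2) = (\<Sum>j\<in>J h. (x j)\<^sup>2)" for h
    by (intro sum.cong) auto
  then show ?thesis by (simp add: in_balls_def)
qed

lemma truncated_odd:
  fixes J :: "'h \<Rightarrow> 'j::finite set"
  assumes "finite H"
  shows "(\<integral>x. x i * in_balls J a H x \<partial>gauss UNIV) = 0"
    and "i \<noteq> k \<Longrightarrow> (\<integral>x. x i * x k * in_balls J a H x \<partial>gauss UNIV) = 0"
proof -
  show "(\<integral>x. x i * in_balls J a H x \<partial>gauss UNIV) = 0"
    by (rule integral_odd_gauss[where i = i]) (auto simp: in_balls_flip intro!: integrable_times_in_balls coord_integrable assms)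
  show "(\<integral>x. x i * x k * in_balls J a H x \<partial>gauss UNIV) = 0" if "i \<noteq> k"
    using that
    by (intro integral_odd_gauss[where i = i]) (auto simp: in_balls_flip intro!: integrable_times_in_balls coord_prod_integrable assms)
qed

lemma in_balls_single_integral:
  assumes "finite (J h)" "J h \<noteq> {}"
  shows "(\<integral>y. in_balls J a {h} y \<partial>gauss (J h)) = chi2_cdf (card (J h)) (a h)"
  using prob_sq_norm_le[OF assms, of "a h"] by (simp add: in_balls_def)

lemma in_balls_integral_insert:
  fixes J :: "'h \<Rightarrow> 'j::finite set"
  assumes H: "finite H" and ne: "J h \<noteq> {}" and disj: "\<And>h'. h' \<in> H \<Longrightarrow> J h' \<inter> J h = {}"
  shows "(\<integral>x. in_balls J a (insert h H) x \<partial>gauss UNIV) = (\<integral>x. in_balls J a H x \<partial>gauss (- J h)) * chi2_cdf (card (J h)) (a h)"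
proof -
  have "(\<integral>x. in_balls J a H x * in_balls J a {h} x \<partial>gauss UNIV) = (\<integral>x. in_balls J a H x \<partial>gauss (- J h)) * (\<integral>y. in_balls J a {h} y \<partial>gauss (J h))"
    by (rule gauss_factor) (auto intro!: integrable_times_in_balls integrable_in_balls H in_balls_merge disj in_balls_single_merge)
  then show ?thesis using ne by (simp add: in_balls_insert[of J a h H] in_balls_single_integral)
qed

lemma in_balls_integral_pos:
  fixes J :: "'h \<Rightarrow> 'j::finite set"
  assumes "finite H" "\<And>h. h \<in> H \<Longrightarrow> J h \<noteq> {} \<and> a h > 0"
    "\<And>h h'. h \<in> H \<Longrightarrow> h' \<in> H \<Longrightarrow> h \<noteq> h' \<Longrightarrow> J h \<inter> J h' = {}"
  shows "(\<integral>x. in_balls J a H x \<partial>gauss UNIV) > 0"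
  using assms
proof (induction H rule: finite_induct)
  case empty
  show ?case using prob_space.prob_space[OF prob_space_gauss[of "UNIV :: 'j set"]] by simp
next
  case (insert h H)
  note one = prob_space.prob_space[OF prob_space_gauss]
  have disj: "J h' \<inter> J h = {}" if "h' \<in> H" for h'
    using insert.prems(2)[of h' h] insert.hyps that by auto
  have "(\<integral>x. in_balls J a H x * 1 \<partial>gauss UNIV) = (\<integral>x. in_balls J a H x \<partial>gauss (- J h)) * (\<integral>y. 1 \<partial>gauss (J h))"
    by (rule gauss_factor) (use insert.hyps in \<open>auto intro!: integrable_in_balls in_balls_merge disj\<close>)
  then have "(\<integral>x. in_balls J a H x \<partial>gauss (- J h)) > 0"
    using insert by (simp add: one)
  moreover have "chi2_cdf (card (J h)) (a h) > 0"
    using insert.prems(1)[of h] by (intro chi2_cdf_pos) (auto simp: card_gt_0_iff)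
  ultimately show ?case
    using insert disj by (subst in_balls_integral_insert) auto
qed

lemma truncated_sq_in:
  fixes J :: "'h \<Rightarrow> 'j::finite set"
  assumes H: "finite H" "h \<in> H" and a: "a h > 0"
    and disj: "\<And>h'. h' \<in> H \<Longrightarrow> h' \<noteq> h \<Longrightarrow> J h' \<inter> J h = {}" and i: "i \<in> J h"
  shows "(\<integral>x. (x i)\<^sup>2 * in_balls J a H x \<partial>gauss UNIV) = v_const (card (J h)) (a h) * (\<integral>x. in_balls J a H x \<partial>gauss UNIV)"
proof -
  let ?H = "H - {h}"
  have ins: "insert h ?H = H" using H by auto
  have split: "in_balls J a H x = in_balls J a ?H x * in_balls J a {h} x" for x
    using in_balls_insert[of J a h ?H x] by (simp only: ins)
  have ne: "J h \<noteq> {}" using i by auto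
  have "(\<integral>x. (x i)\<^sup>2 * in_balls J a H x \<partial>gauss UNIV) = (\<integral>x. in_balls J a ?H x * ((x i)\<^sup>2 * in_balls J a {h} x) \<partial>gauss UNIV)"
    by (simp add: split mult_ac)
  also have "\<dots> = (\<integral>x. in_balls J a ?H x \<partial>gauss (- J h)) * (\<integral>y. (y i)\<^sup>2 * in_balls J a {h} y \<partial>gauss (J h))"
  proof (rule gauss_factor)
    have "integrable (gauss UNIV) (\<lambda>x. (x i)\<^sup>2 * in_balls J a {h} x * in_balls J a ?H x)"
      using H by (intro integrable_times_in_balls gauss_sq_integrable) auto
    then show "integrable (gauss UNIV) (\<lambda>x. in_balls J a ?H x * ((x i)\<^sup>2 * in_balls J a {h} x))"
      by (simp add: mult_ac)
    show "(merge (- J h) (J h) (x, y) i)\<^sup>2 * in_balls J a {h} (merge (- J h) (J h) (x, y)) = (y i)\<^sup>2 * in_balls J a {h} y" for x y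
      using i by (subst in_balls_single_merge) (auto simp: merge_def)
  qed (use disj in \<open>auto intro!: in_balls_merge\<close>)
  also have "(\<integral>y. (y i)\<^sup>2 * in_balls J a {h} y \<partial>gauss (J h)) = chi2_cdf (card (J h) + 2) (a h)"
    using truncated_coordinate(2)[of "J h" i "a h"] i ne by (simp add: in_balls_def)
  also have "(\<integral>x. in_balls J a ?H x \<partial>gauss (- J h)) * chi2_cdf (card (J h) + 2) (a h)
     = v_const (card (J h)) (a h) * ((\<integral>x. in_balls J a ?H x \<partial>gauss (- J h)) * chi2_cdf (card (J h)) (a h))"
    using chi2_cdf_pos[of "card (J h)" "a h"] a ne by (simp add: v_const_def card_gt_0_iff)
  also have "(\<integral>x. in_balls J a ?H x \<partial>gauss (- J h)) * chi2_cdf (card (J h)) (a h) = (\<integral>x. in_balls J a H x \<partial>gauss UNIV)"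
    using in_balls_integral_insert[of ?H J h a] H ne disj by (simp add: insert_absorb)
  finally show ?thesis .
qed

lemma truncated_sq_out:
  fixes J :: "'h \<Rightarrow> 'j::finite set"
  assumes H: "finite H" and i: "\<And>h. h \<in> H \<Longrightarrow> i \<notin> J h"
  shows "(\<integral>x. (x i)\<^sup>2 * in_balls J a H x \<partial>gauss UNIV) = (\<integral>x. in_balls J a H x \<partial>gauss UNIV)"
proof -
  note one = prob_space.prob_space[OF prob_space_gauss]
  have "(\<integral>x. in_balls J a H x * (x i)\<^sup>2 \<partial>gauss UNIV) = (\<integral>x. in_balls J a H x \<partial>gauss (- {i})) * (\<integral>y. (y i)\<^sup>2 \<partial>gauss {i})"
  proof (rule gauss_factor)
    show "integrable (gauss UNIV) (\<lambda>x. in_balls J a H x * (x i)\<^sup>2)"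
      using integrable_times_in_balls[OF gauss_sq_integrable(1)[of UNIV i] H] by (simp add: mult.commute)
    show "in_balls J a H (merge (- {i}) {i} (x, y)) = in_balls J a H x" for x y
      by (rule in_balls_merge) (use i in auto)
  qed (simp add: merge_def)
  moreover have "(\<integral>x. in_balls J a H x * 1 \<partial>gauss UNIV) = (\<integral>x. in_balls J a H x \<partial>gauss (- {i})) * (\<integral>y. 1 \<partial>gauss {i})"
  proof (rule gauss_factor)
    show "in_balls J a H (merge (- {i}) {i} (x, y)) = in_balls J a H x" for x y
      by (rule in_balls_merge) (use i in auto)
  qed (use integrable_in_balls[OF H] in auto)
  moreover have "(\<integral>y. (y i)\<^sup>2 \<partial>gauss {i}) = 1" "(\<integral>y. 1 \<partial>gauss {i}) = (1::real)"
    by (simp_all add: gauss_sq_integrable one)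
  moreover have "(\<lambda>x. (x i)\<^sup>2 * in_balls J a H x) = (\<lambda>x. in_balls J a H x * (x i)\<^sup>2)"
    by (simp add: mult.commute)
  ultimately show ?thesis by simp
qed

lemma lin_prod_integrable:
  "integrable (gauss (UNIV :: 'j::finite set)) (\<lambda>x. (\<Sum>j\<in>UNIV. c j * x j) * (\<Sum>k\<in>UNIV. d k * x k))"
proof -
  have "(\<Sum>j\<in>UNIV. c j * x j) * (\<Sum>k\<in>UNIV. d k * x k) = (\<Sum>j\<in>UNIV. \<Sum>k\<in>UNIV. c j * d k * (x j * x k))" for x :: "'j \<Rightarrow> real"
    by (simp add: sum_product mult_ac)
  then show ?thesis
    by (simp only:) (intro Bochner_Integration.integrable_sum integrable_mult_right coord_prod_integrable)
qed

lemma AE_block_neq: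
  fixes J :: "'j::finite set"
  assumes "J \<noteq> {}"
  shows "AE x in gauss UNIV. (\<Sum>j\<in>J. (x j)\<^sup>2) \<noteq> a"
proof -
  have eq: "gauss J = distr (gauss UNIV) (gauss J) (\<lambda>f. restrict f J)"
    by (rule product_prob_space.distr_restrict[OF product_prob_space_gauss, of J UNIV, OF subset_UNIV finite_class.finite_UNIV])
  have "AE y in distr (gauss UNIV) (gauss J) (\<lambda>f. restrict f J). (\<Sum>j\<in>J. (y j)\<^sup>2) \<noteq> a"
    by (subst eq[symmetric]) (rule AE_sq_norm_neq[OF finite_class.finite assms])
  then have "AE x in gauss UNIV. (\<Sum>j\<in>J. (restrict x J j)\<^sup>2) \<noteq> a"
    by (rule AE_distrD[rotated]) (auto intro!: measurable_restrict_subset)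
  then show ?thesis by (simp cong: sum.cong)
qed

lemma truncated_linear_mean:
  fixes J :: "'h \<Rightarrow> 'j::finite set" and c :: "'j \<Rightarrow> real"
  assumes H: "finite H"
  shows "(\<integral>x. (\<Sum>j\<in>UNIV. c j * x j) * in_balls J a H x \<partial>gauss UNIV) = 0"
proof -
  have eq: "(\<lambda>x. (\<Sum>j\<in>UNIV. c j * x j) * in_balls J a H x) = (\<lambda>x. \<Sum>j\<in>UNIV. c j * (x j * in_balls J a H x))"
    by (simp add: sum_distrib_right mult.assoc)
  have int: "integrable (gauss UNIV) (\<lambda>x. c j * (x j * in_balls J a H x))" for j
    by (rule integrable_mult_right) (rule integrable_times_in_balls[OF coord_integrable H])
  have "(\<integral>x. (\<Sum>j\<in>UNIV. c j * (x j * in_balls J a H x)) \<partial>gauss UNIV) = (\<Sum>j\<in>UNIV. \<integral>x. c j * (x j * in_balls J a H x) \<partial>gauss UNIV)"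
    by (rule Bochner_Integration.integral_sum) (rule int)
  then show ?thesis
    unfolding eq by (simp add: truncated_odd(1)[OF H])
qed

lemma truncated_linear_prod:
  fixes J :: "'h \<Rightarrow> 'j::finite set" and c d :: "'j \<Rightarrow> real"
  assumes H: "finite H"
  shows "(\<integral>x. (\<Sum>j\<in>UNIV. c j * x j) * (\<Sum>k\<in>UNIV. d k * x k) * in_balls J a H x \<partial>gauss UNIV)
      = (\<Sum>j\<in>UNIV. c j * d j * (\<integral>x. (x j)\<^sup>2 * in_balls J a H x \<partial>gauss UNIV))"
proof -
  let ?f = "\<lambda>j k x. c j * d k * (x j * x k * in_balls J a H x)"
  have eq: "(\<lambda>x. (\<Sum>j\<in>UNIV. c j * x j) * (\<Sum>k\<in>UNIV. d k * x k) * in_balls J a H x) = (\<lambda>x. \<Sum>j\<in>UNIV. \<Sum>k\<in>UNIV. ?f j k x)"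
    unfolding sum_product unfolding sum_distrib_right by (simp only: mult_ac)
  have int: "integrable (gauss UNIV) (?f j k)" for j k
    by (rule integrable_mult_right) (rule integrable_times_in_balls[OF coord_prod_integrable H])
  have int2: "integrable (gauss UNIV) (\<lambda>x. \<Sum>k\<in>UNIV. ?f j k x)" for j
    by (rule Bochner_Integration.integrable_sum) (rule int)
  have 1: "(\<integral>x. (\<Sum>j\<in>UNIV. \<Sum>k\<in>UNIV. ?f j k x) \<partial>gauss UNIV) = (\<Sum>j\<in>UNIV. \<integral>x. (\<Sum>k\<in>UNIV. ?f j k x) \<partial>gauss UNIV)"
    by (rule Bochner_Integration.integral_sum) (rule int2)
  have 2: "(\<integral>x. (\<Sum>k\<in>UNIV. ?f j k x) \<partial>gauss UNIV) = (\<Sum>k\<in>UNIV. \<integral>x. ?f j k x \<partial>gauss UNIV)" for j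
    by (rule Bochner_Integration.integral_sum) (rule int)
  have 3: "(\<integral>x. ?f j k x \<partial>gauss UNIV)
      = (if k = j then c j * d j * (\<integral>x. (x j)\<^sup>2 * in_balls J a H x \<partial>gauss UNIV) else 0)" for j k
    using truncated_odd(2)[OF H, of j k J a] by (auto simp: power2_eq_square)
  show ?thesis unfolding eq 1 2 3 by simp
qed

section \<open>The limit of the factorial design\<close>

definition pairing :: "('q::finite \<Rightarrow> 'v::finite \<Rightarrow> real) \<Rightarrow> ('q \<Rightarrow> 'v \<Rightarrow> real) \<Rightarrow> real" where
  "pairing u X = (\<Sum>q\<in>UNIV. \<Sum>v\<in>UNIV. u q v * X q v)"

lemma pairing_sum:
  "pairing (\<lambda>q v. \<Sum>i\<in>I. a i * u i q v) X = (\<Sum>i\<in>I. a i * pairing (u i) X)"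
proof -
  have "pairing (\<lambda>q v. \<Sum>i\<in>I. a i * u i q v) X = (\<Sum>q\<in>UNIV. \<Sum>v\<in>UNIV. \<Sum>i\<in>I. a i * (u i q v * X q v))"
    unfolding pairing_def sum_distrib_right by (simp only: mult.assoc)
  also have "\<dots> = (\<Sum>q\<in>UNIV. \<Sum>i\<in>I. \<Sum>v\<in>UNIV. a i * (u i q v * X q v))"
    by (intro sum.cong refl sum.swap)
  also have "\<dots> = (\<Sum>i\<in>I. \<Sum>q\<in>UNIV. \<Sum>v\<in>UNIV. a i * (u i q v * X q v))"
    by (rule sum.swap)
  finally show ?thesis unfolding pairing_def sum_distrib_left .
qed

lemma asy_cov_alt:
  fixes e :: "'k::finite set \<Rightarrow> real"
  shows "asy_cov e S u z = pairing u (\<lambda>q v. \<Sum>v'\<in>UNIV. (z q v' / e q - (\<Sum>q\<in>UNIV. z q v')) * S v v')"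
proof -
  define Zc where "Zc v = (\<Sum>q\<in>UNIV. z q v)" for v
  have "(\<Sum>v'\<in>UNIV. (\<Sum>q\<in>UNIV. u q v) * Zc v' * S v v') = (\<Sum>q\<in>UNIV. \<Sum>v'\<in>UNIV. u q v * (Zc v' * S v v'))" for v
    by (subst sum.swap) (simp add: sum_distrib_right mult.assoc)
  then have 1: "(\<Sum>v\<in>UNIV. \<Sum>v'\<in>UNIV. (\<Sum>q\<in>UNIV. u q v) * Zc v' * S v v')
     = (\<Sum>q\<in>UNIV. \<Sum>v\<in>UNIV. \<Sum>v'\<in>UNIV. u q v * (Zc v' * S v v'))"
    by (subst sum.swap) simp
  have 2: "(\<Sum>v\<in>UNIV. \<Sum>v'\<in>UNIV. u q v * z q v' * S v v') / e q = (\<Sum>v\<in>UNIV. \<Sum>v'\<in>UNIV. u q v * (z q v' / e q * S v v'))" for q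
    by (simp add: sum_divide_distrib mult.assoc)
  show ?thesis
    unfolding asy_cov_def pairing_def Zc_def[symmetric] 1 2
    by (simp add: sum_distrib_left left_diff_distrib right_diff_distrib sum_subtractf)
qed

lemma asy_cov_sum_left:
  fixes e :: "'k::finite set \<Rightarrow> real"
  shows "asy_cov e S (\<lambda>q v. \<Sum>i\<in>I. a i * u i q v) z = (\<Sum>i\<in>I. a i * asy_cov e S (u i) z)"
  unfolding asy_cov_alt by (rule pairing_sum)

lemma asy_cov_commute:
  fixes e :: "'k::finite set \<Rightarrow> real"
  assumes S: "\<And>v v'. S v v' = S v' v"
  shows "asy_cov e S u z = asy_cov e S z u"
proof -
  have 1: "(\<Sum>v\<in>UNIV. \<Sum>v'\<in>UNIV. a v * b v' * S v v') = (\<Sum>v\<in>UNIV. \<Sum>v'\<in>UNIV. b v * a v' * S v v')" for a b :: "_ \<Rightarrow> real"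
    by (subst sum.swap) (simp add: S[of _ "_"] mult_ac)
  show ?thesis unfolding asy_cov_def by (simp only: 1[of "u _" "z _"] 1[of "\<lambda>v. \<Sum>q\<in>UNIV. u q v"])
qed

lemma asy_cov_sum_right:
  fixes e :: "'k::finite set \<Rightarrow> real"
  assumes S: "\<And>v v'. S v v' = S v' v"
  shows "asy_cov e S z (\<lambda>q v. \<Sum>i\<in>I. a i * u i q v) = (\<Sum>i\<in>I. a i * asy_cov e S z (u i))"
  unfolding asy_cov_commute[where S = S, OF S, of e z] by (rule asy_cov_sum_left)

lemma asy_cov_col_zero:
  assumes "\<And>v. (\<Sum>q\<in>UNIV. z q v) = 0"
  shows "asy_cov e S u z = (\<Sum>q\<in>UNIV. (\<Sum>v\<in>UNIV. \<Sum>v'\<in>UNIV. u q v * z q v' * S v v') / e q)"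
  by (simp add: asy_cov_def assms)

lemma sum_UNIV_Plus:
  "(\<Sum>v\<in>(UNIV :: ('a::finite + 'b::finite) set). f v) = (\<Sum>a\<in>UNIV. f (Inl a)) + (\<Sum>b\<in>UNIV. f (Inr b) :: real)"
  unfolding UNIV_Plus_UNIV[symmetric] by (subst sum.Plus) (auto simp: comp_def)

lemma (in crfe_seq) asy_cov_nonneg: "0 \<le> asy_cov e S u u"
proof (rule tendsto_lowerbound[OF asyvar_coef_lim])
  show "\<forall>\<^sub>F n in sequentially. 0 \<le> crfe_design.asyvar n (nq n) (coef u n)"
    using good by eventually_elim (auto intro: crfe_design.asyvar_nonneg)
qed simp

lemma complete_square:
  fixes C :: "'a::finite \<Rightarrow> 'a \<Rightarrow> real" and \<beta> :: "'a \<Rightarrow> 'b \<Rightarrow> real"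
  assumes sym: "\<And>A B. C A B = C B A"
    and psd: "\<And>t s. 0 \<le> (\<Sum>A\<in>UNIV. \<Sum>B\<in>UNIV. t A * t B * C A B) + 2 * (\<Sum>j\<in>J. s j * (\<Sum>A\<in>UNIV. t A * \<beta> A j)) + (\<Sum>j\<in>J. (s j)\<^sup>2)"
  obtains L :: "'a \<Rightarrow> 'a \<Rightarrow> real" where "\<And>A B. C A B = (\<Sum>k\<in>UNIV. L k A * L k B) + (\<Sum>j\<in>J. \<beta> A j * \<beta> B j)"
proof -
  define W where "W A B = C A B - (\<Sum>j\<in>J. \<beta> A j * \<beta> B j)" for A B
  have "psd_on UNIV W" unfolding psd_on_def
  proof
    fix t
    define b where "b j = (\<Sum>A\<in>UNIV. t A * \<beta> A j)" for j
    have "(\<Sum>A\<in>UNIV. \<Sum>B\<in>UNIV. \<Sum>j\<in>J. (t A * \<beta> A j) * (t B * \<beta> B j)) = (\<Sum>j\<in>J. (b j)\<^sup>2)"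
    proof -
      have "(\<Sum>A\<in>UNIV. \<Sum>B\<in>UNIV. \<Sum>j\<in>J. (t A * \<beta> A j) * (t B * \<beta> B j)) = (\<Sum>A\<in>UNIV. \<Sum>j\<in>J. \<Sum>B\<in>UNIV. (t A * \<beta> A j) * (t B * \<beta> B j))"
        by (intro sum.cong refl sum.swap)
      also have "\<dots> = (\<Sum>j\<in>J. \<Sum>A\<in>UNIV. \<Sum>B\<in>UNIV. (t A * \<beta> A j) * (t B * \<beta> B j))"
        by (rule sum.swap)
      finally show ?thesis by (simp add: b_def power2_eq_square sum_product)
    qed
    moreover have "(\<Sum>A\<in>UNIV. \<Sum>B\<in>UNIV. t A * W A B * t B)
       = (\<Sum>A\<in>UNIV. \<Sum>B\<in>UNIV. t A * t B * C A B) - (\<Sum>A\<in>UNIV. \<Sum>B\<in>UNIV. \<Sum>j\<in>J. (t A * \<beta> A j) * (t B * \<beta> B j))"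
      unfolding W_def sum_subtractf[symmetric]
      by (intro sum.cong refl) (simp add: right_diff_distrib left_diff_distrib sum_distrib_left sum_distrib_right mult_ac)
    moreover have "0 \<le> (\<Sum>A\<in>UNIV. \<Sum>B\<in>UNIV. t A * t B * C A B) - (\<Sum>j\<in>J. (b j)\<^sup>2)"
      using psd[of t "\<lambda>j. - b j"] by (simp add: b_def[symmetric] power2_eq_square sum_negf)
    ultimately show "0 \<le> (\<Sum>A\<in>UNIV. \<Sum>B\<in>UNIV. t A * W A B * t B)" by simp
  qed
  moreover have "W A B = W B A" for A B unfolding W_def by (simp add: sym mult.commute)
  ultimately obtain L :: "'a \<Rightarrow> 'a \<Rightarrow> real" where "\<forall>A\<in>UNIV. \<forall>B\<in>UNIV. W A B = (\<Sum>k\<in>UNIV. L k A * L k B)"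
    using psd_sum_squares[of UNIV W] by auto
  then show ?thesis by (intro that[of L]) (auto simp: W_def algebra_simps)
qed

locale refmt = crfe_seq nq P e S m
  for nq :: "nat \<Rightarrow> 'k::finite set \<Rightarrow> nat" and P :: "nat \<Rightarrow> nat \<Rightarrow> ('k set + 'l::finite) \<Rightarrow> real"
    and e S m +
  fixes H :: nat and T :: "nat \<Rightarrow> 'k set set" and a :: "nat \<Rightarrow> real"
  assumes tiers: "\<And>h. h \<in> {1..H} \<Longrightarrow> T h \<noteq> {} \<and> T h \<subseteq> effects"
    and tiers_disj: "\<And>h h'. h \<in> {1..H} \<Longrightarrow> h' \<in> {1..H} \<Longrightarrow> h \<noteq> h' \<Longrightarrow> T h \<inter> T h' = {}"
    and tiers_cover: "(\<Union>h\<in>{1..H}. T h) = effects"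
    and a_pos: "\<And>h. h \<in> {1..H} \<Longrightarrow> a h > 0"
    and S_sym: "\<And>v v'. S v v' = S v' v"
    and Sxx_psd: "psd_on UNIV (\<lambda>l l'. S (Inr l) (Inr l'))"
    and Sxx_pos: "\<And>u l. (\<Sum>l\<in>UNIV. \<Sum>l'\<in>UNIV. u l * S (Inr l) (Inr l') * u l') = 0 \<Longrightarrow> u l = 0"
begin

abbreviation "Y n \<equiv> (\<lambda>i q. P n i (Inl q))"
abbreviation "x n \<equiv> (\<lambda>i l. P n i (Inr l))"

definition w :: "'k set \<Rightarrow> real" where "w q = 1 / e q"
definition wn :: "nat \<Rightarrow> 'k set \<Rightarrow> real" where "wn n q = real n / real (nq n q)"

lemma w_pos: "w q > 0" using e_pos by (simp add: w_def)

lemma wn_lim: "(\<lambda>n. wn n q) \<longlonglongrightarrow> w q"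
  unfolding wn_def w_def by (rule inv_lim)

definition tau_coef :: "'k set \<Rightarrow> 'k set \<Rightarrow> 'k set + 'l \<Rightarrow> real" where
  "tau_coef A q v = (case v of Inl q' \<Rightarrow> if A \<noteq> {} \<and> q' = q then cK TYPE('k) * gval A q else 0 | Inr _ \<Rightarrow> 0)"

definition theta_coef :: "('k set \<Rightarrow> real) \<Rightarrow> nat \<Rightarrow> 'k set \<times> 'l \<Rightarrow> 'k set \<Rightarrow> 'k set + 'l \<Rightarrow> real" where
  "theta_coef w' h i q v = (case v of Inl _ \<Rightarrow> 0 | Inr l \<Rightarrow> if l = snd i then cK TYPE('k) * cvecw w' T h q (fst i) else 0)"

lemma tiers_upto_sub: "h \<in> {1..H} \<Longrightarrow> {} \<notin> tiers_upto T (h - 1)"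
  using tiers by (fastforce simp: tiers_upto_def effects_def)

lemma cvecw_zero: "h \<in> {1..H} \<Longrightarrow> A \<in> T h \<Longrightarrow> (\<Sum>q\<in>UNIV. cvecw w' T h q A) = 0"
  using tiers[of h] tiers_upto_sub by (intro cvecw_sum_zero) (auto simp: effects_def)

lemma pairing_theta_coef: "pairing (theta_coef w' h i) X' = (\<Sum>q\<in>UNIV. cK TYPE('k) * cvecw w' T h q (fst i) * X' q (Inr (snd i)))"
proof -
  have "(\<Sum>l\<in>UNIV. (if l = snd i then cK TYPE('k) * cvecw w' T h q (fst i) else 0) * X' q (Inr l)) = cK TYPE('k) * cvecw w' T h q (fst i) * X' q (Inr (snd i))" for q
    by (simp add: if_distrib[where f = "\<lambda>z. z * _"] cong: if_cong)
  then show ?thesis by (simp add: pairing_def theta_coef_def sum_UNIV_Plus)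
qed

lemma pairing_tau_coef: "pairing (tau_coef A) X' = (if A = {} then 0 else \<Sum>q\<in>UNIV. cK TYPE('k) * gval A q * X' q (Inl q))"
proof -
  have "(\<Sum>q'\<in>UNIV. (if A \<noteq> {} \<and> q' = q then cK TYPE('k) * gval A q else 0) * X' q (Inl q')) = (if A = {} then 0 else cK TYPE('k) * gval A q * X' q (Inl q))" for q
    by (simp add: if_distrib[where f = "\<lambda>z. z * _"] cong: if_cong)
  then show ?thesis by (simp add: pairing_def tau_coef_def sum_UNIV_Plus)
qed

lemma asy_cov_theta_coef_right:
  assumes h: "h \<in> {1..H}" "A \<in> T h"
  shows "asy_cov e S u (theta_coef w h (A, l)) = pairing u (\<lambda>q v. cK TYPE('k) * cvecw w T h q A * w q * S v (Inr l))"
proof -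
  have z: "(\<Sum>q\<in>UNIV. theta_coef w h (A, l) q v) = 0" for v
  proof (cases v)
    case (Inr b)
    then show ?thesis
      by (cases "b = l") (auto simp: theta_coef_def cvecw_zero[OF h] simp flip: sum_distrib_left)
  qed (simp add: theta_coef_def)
  have "(\<Sum>v'\<in>UNIV. theta_coef w h (A, l) q v' * S v v') = cK TYPE('k) * cvecw w T h q A * S v (Inr l)" for q v
    by (simp add: theta_coef_def sum_UNIV_Plus if_distrib[where f = "\<lambda>z. z * _"] cong: if_cong)
  then have "(\<Sum>v\<in>UNIV. \<Sum>v'\<in>UNIV. u q v * theta_coef w h (A, l) q v' * S v v') / e q
      = (\<Sum>v\<in>UNIV. u q v * (cK TYPE('k) * cvecw w T h q A * w q * S v (Inr l)))" for q
    unfolding mult.assoc[of "u _ _"] sum_distrib_left[symmetric]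
    by (simp add: w_def sum_divide_distrib)
  then show ?thesis unfolding asy_cov_col_zero[OF z] pairing_def by simp
qed

lemma asy_cov_theta_coef_theta_coef:
  assumes "h' \<in> {1..H}" "A' \<in> T h'"
  shows "asy_cov e S (theta_coef w h (A, l)) (theta_coef w h' (A', l'))
    = (cK TYPE('k))\<^sup>2 * (\<Sum>q\<in>UNIV. cvecw w T h q A * cvecw w T h' q A' * w q) * S (Inr l) (Inr l')"
  unfolding asy_cov_theta_coef_right[OF assms] pairing_theta_coef sum_distrib_left sum_distrib_right
  by (simp add: power2_eq_square mult_ac)

lemma asy_cov_tau_coef_theta_coef:
  assumes "h \<in> {1..H}" "A \<in> T h" "B \<in> effects"
  shows "asy_cov e S (tau_coef B) (theta_coef w h (A, l)) = (cK TYPE('k))\<^sup>2 * (\<Sum>q\<in>UNIV. gval B q * cvecw w T h q A * S (Inl q) (Inr l) * w q)"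
  unfolding asy_cov_theta_coef_right[OF assms(1,2)] pairing_tau_coef sum_distrib_left using assms(3)
  by (simp add: effects_def power2_eq_square mult_ac)

lemma asy_cov_tau_coef_tau_coef:
  assumes A: "A \<in> effects" and B: "B \<in> effects"
  shows "asy_cov e S (tau_coef A) (tau_coef B) = (cK TYPE('k))\<^sup>2 * (\<Sum>q\<in>UNIV. gval A q * gval B q * S (Inl q) (Inl q) * w q)
     - (cK TYPE('k))\<^sup>2 * (\<Sum>q\<in>UNIV. \<Sum>q'\<in>UNIV. gval A q * gval B q' * S (Inl q) (Inl q'))"
proof -
  let ?D = "\<lambda>q v. \<Sum>v'\<in>UNIV. (tau_coef B q v' / e q - (\<Sum>q\<in>UNIV. tau_coef B q v')) * S v v'"
  have col: "(\<Sum>q\<in>UNIV. tau_coef B q (Inl q')) = cK TYPE('k) * gval B q'" for q'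
    using B by (simp add: tau_coef_def effects_def if_distrib cong: if_cong)
  have Inr0: "tau_coef B q (Inr l) = 0" for q l by (simp add: tau_coef_def)
  have "?D q v = (\<Sum>q'\<in>UNIV. (tau_coef B q (Inl q') / e q - cK TYPE('k) * gval B q') * S v (Inl q'))" for q v
    by (simp add: sum_UNIV_Plus col Inr0)
  moreover have "(\<Sum>q'\<in>UNIV. (tau_coef B q (Inl q') / e q - cK TYPE('k) * gval B q') * S v (Inl q'))
     = (\<Sum>q'\<in>UNIV. (if q' = q then cK TYPE('k) * gval B q * w q * S v (Inl q) else 0) - cK TYPE('k) * gval B q' * S v (Inl q'))" for q v
    using B by (intro sum.cong refl) (auto simp: tau_coef_def effects_def w_def left_diff_distrib)
  ultimately have "?D q v = (\<Sum>q'\<in>UNIV. (if q' = q then cK TYPE('k) * gval B q * w q * S v (Inl q) else 0) - cK TYPE('k) * gval B q' * S v (Inl q'))" for q v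
    by simp
  then have D: "?D q v = cK TYPE('k) * gval B q * w q * S v (Inl q) - cK TYPE('k) * (\<Sum>q'\<in>UNIV. gval B q' * S v (Inl q'))" for q v
    by (simp add: sum_subtractf sum_distrib_left mult.assoc)
  show ?thesis
    unfolding asy_cov_alt pairing_tau_coef D using A
    by (simp add: effects_def right_diff_distrib sum_subtractf sum_distrib_left power2_eq_square mult_ac)
qed

lemma W_xx_lim:
  assumes h: "h \<in> {1..H}" and i: "i \<in> kidx T h" and j: "j \<in> kidx T h"
  shows "(\<lambda>n. real n * W_xx n (nq n) T (x n) h i j) \<longlonglongrightarrow> asy_cov e S (theta_coef w h i) (theta_coef w h j)"
proof -
  obtain A l A' l' where ij: "i = (A, l)" "j = (A', l')" "A' \<in> T h" using i j by (auto simp: kidx_def)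
  have "(\<lambda>n. (cK TYPE('k))\<^sup>2 * (\<Sum>q\<in>UNIV. cvecw (wn n) T h q A * cvecw (wn n) T h q A' * wn n q) * pcov n (\<lambda>i. P n i (Inr l)) (\<lambda>i. P n i (Inr l')))
     \<longlonglongrightarrow> (cK TYPE('k))\<^sup>2 * (\<Sum>q\<in>UNIV. cvecw w T h q A * cvecw w T h q A' * w q) * S (Inr l) (Inr l')"
    by (intro tendsto_intros tendsto_cvecw wn_lim w_pos S_lim)
  moreover have "\<forall>\<^sub>F n in sequentially. (cK TYPE('k))\<^sup>2 * (\<Sum>q\<in>UNIV. cvecw (wn n) T h q A * cvecw (wn n) T h q A' * wn n q) * pcov n (\<lambda>i. P n i (Inr l)) (\<lambda>i. P n i (Inr l'))
     = real n * W_xx n (nq n) T (x n) h i j"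
    using good
  proof eventually_elim
    case (elim n)
    have c: "cvec (nq n) T h q A = cvecw (wn n) T h q A" for q A
      unfolding wn_def using elim h by (intro cvec_eq_cvecw) auto
    show ?case
      unfolding W_xx_def ij prod.case c S_xx_def sum_distrib_left sum_distrib_right
      by (intro sum.cong refl) (simp add: wn_def)
  qed
  ultimately show ?thesis
    unfolding ij asy_cov_theta_coef_theta_coef[OF h ij(3)] by (rule Lim_transform_eventually)
qed

lemma W_taux_lim:
  assumes h: "h \<in> {1..H}" and j: "j \<in> kidx T h" and B: "B \<in> effects"
  shows "(\<lambda>n. real n * W_taux n (nq n) T (Y n) (x n) h B j) \<longlonglongrightarrow> asy_cov e S (tau_coef B) (theta_coef w h j)"
proof -
  obtain A l where ij: "j = (A, l)" "A \<in> T h" using j by (auto simp: kidx_def)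
  have "(\<lambda>n. (cK TYPE('k))\<^sup>2 * (\<Sum>q\<in>UNIV. gval B q * cvecw (wn n) T h q A * pcov n (\<lambda>i. P n i (Inl q)) (\<lambda>i. P n i (Inr l)) * wn n q))
     \<longlonglongrightarrow> (cK TYPE('k))\<^sup>2 * (\<Sum>q\<in>UNIV. gval B q * cvecw w T h q A * S (Inl q) (Inr l) * w q)"
    by (intro tendsto_intros tendsto_cvecw wn_lim w_pos S_lim)
  moreover have "\<forall>\<^sub>F n in sequentially. (cK TYPE('k))\<^sup>2 * (\<Sum>q\<in>UNIV. gval B q * cvecw (wn n) T h q A * pcov n (\<lambda>i. P n i (Inl q)) (\<lambda>i. P n i (Inr l)) * wn n q)
     = real n * W_taux n (nq n) T (Y n) (x n) h B j"
    using good
  proof eventually_elim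
    case (elim n)
    have c: "cvec (nq n) T h q A = cvecw (wn n) T h q A" for q A
      unfolding wn_def using elim h by (intro cvec_eq_cvecw) auto
    show ?case
      unfolding W_taux_def ij prod.case c S_qx_def sum_distrib_left
      by (intro sum.cong refl) (simp add: wn_def)
  qed
  ultimately show ?thesis
    unfolding ij asy_cov_tau_coef_theta_coef[OF h ij(2) B] by (rule Lim_transform_eventually)
qed

lemma pcov_lincomb:
  "pcov n (\<lambda>i. c * (\<Sum>q\<in>(UNIV::'q::finite set). f q * U i q)) (\<lambda>i. c * (\<Sum>q\<in>(UNIV::'q set). g q * U i q))
    = c\<^sup>2 * (\<Sum>q\<in>UNIV. \<Sum>q'\<in>UNIV. f q * g q' * pcov n (\<lambda>i. U i q) (\<lambda>i. U i q'))"
proof -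
  have m: "pmean n (\<lambda>i. c * (\<Sum>q\<in>UNIV. f q * U i q)) = c * (\<Sum>q\<in>UNIV. f q * pmean n (\<lambda>i. U i q))" for f
    unfolding pmean_def sum_distrib_left[symmetric] times_divide_eq_right[symmetric]
    by (subst sum.swap) (simp add: sum_distrib_left sum_divide_distrib)
  define d where "d i q = U i q - pmean n (\<lambda>i. U i q)" for i q
  have dd: "c * (\<Sum>q\<in>UNIV. f q * U i q) - c * (\<Sum>q\<in>UNIV. f q * pmean n (\<lambda>i. U i q)) = c * (\<Sum>q\<in>UNIV. f q * d i q)" for i f
    by (simp add: d_def right_diff_distrib sum_subtractf)
  have "(\<Sum>i<n. (c * (\<Sum>q\<in>UNIV. f q * d i q)) * (c * (\<Sum>q\<in>UNIV. g q * d i q)))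
    = (\<Sum>i<n. \<Sum>q\<in>UNIV. \<Sum>q'\<in>UNIV. c\<^sup>2 * (f q * g q' * (d i q * d i q')))"
  proof (rule sum.cong[OF refl])
    fix i
    have "(c * (\<Sum>q\<in>UNIV. f q * d i q)) * (c * (\<Sum>q\<in>UNIV. g q * d i q)) = c\<^sup>2 * ((\<Sum>q\<in>UNIV. f q * d i q) * (\<Sum>q\<in>UNIV. g q * d i q))"
      by (simp add: power2_eq_square)
    also have "\<dots> = (\<Sum>q\<in>UNIV. \<Sum>q'\<in>UNIV. c\<^sup>2 * (f q * g q' * (d i q * d i q')))"
      unfolding sum_product unfolding sum_distrib_left by (simp only: mult_ac)
    finally show "(c * (\<Sum>q\<in>UNIV. f q * d i q)) * (c * (\<Sum>q\<in>UNIV. g q * d i q))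
      = (\<Sum>q\<in>UNIV. \<Sum>q'\<in>UNIV. c\<^sup>2 * (f q * g q' * (d i q * d i q')))" .
  qed
  also have "\<dots> = (\<Sum>q\<in>UNIV. \<Sum>i<n. \<Sum>q'\<in>UNIV. c\<^sup>2 * (f q * g q' * (d i q * d i q')))"
    by (rule sum.swap)
  also have "\<dots> = (\<Sum>q\<in>UNIV. \<Sum>q'\<in>UNIV. \<Sum>i<n. c\<^sup>2 * (f q * g q' * (d i q * d i q')))"
    by (intro sum.cong refl sum.swap)
  finally have "(\<Sum>i<n. (c * (\<Sum>q\<in>UNIV. f q * d i q)) * (c * (\<Sum>q\<in>UNIV. g q * d i q)))
     = (\<Sum>q\<in>UNIV. \<Sum>q'\<in>UNIV. c\<^sup>2 * (f q * g q' * (\<Sum>i<n. d i q * d i q')))"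
    by (simp only: sum_distrib_left)
  then show ?thesis
    unfolding pcov_def m dd unfolding d_def[symmetric]
    by (simp add: sum_divide_distrib sum_distrib_left)
qed

lemma V_tautau_lim:
  assumes A: "A \<in> effects" and B: "B \<in> effects"
  shows "(\<lambda>n. real n * V_tautau n (nq n) (Y n) A B) \<longlonglongrightarrow> asy_cov e S (tau_coef A) (tau_coef B)"
proof -
  let ?p = "\<lambda>n q q'. pcov n (\<lambda>i. P n i (Inl q)) (\<lambda>i. P n i (Inl q'))"
  have "(\<lambda>n. (cK TYPE('k))\<^sup>2 * (\<Sum>q\<in>UNIV. gval A q * gval B q * ?p n q q * wn n q) - (cK TYPE('k))\<^sup>2 * (\<Sum>q\<in>UNIV. \<Sum>q'\<in>UNIV. gval A q * gval B q' * ?p n q q'))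
     \<longlonglongrightarrow> (cK TYPE('k))\<^sup>2 * (\<Sum>q\<in>UNIV. gval A q * gval B q * S (Inl q) (Inl q) * w q) - (cK TYPE('k))\<^sup>2 * (\<Sum>q\<in>UNIV. \<Sum>q'\<in>UNIV. gval A q * gval B q' * S (Inl q) (Inl q'))"
    by (intro tendsto_intros wn_lim S_lim)
  moreover have "\<forall>\<^sub>F n in sequentially. (cK TYPE('k))\<^sup>2 * (\<Sum>q\<in>UNIV. gval A q * gval B q * ?p n q q * wn n q) - (cK TYPE('k))\<^sup>2 * (\<Sum>q\<in>UNIV. \<Sum>q'\<in>UNIV. gval A q * gval B q' * ?p n q q')
     = real n * V_tautau n (nq n) (Y n) A B"
    using good
  proof eventually_elim
    case (elim n)
    have 1: "S_tautau n (Y n) A B = (cK TYPE('k))\<^sup>2 * (\<Sum>q\<in>UNIV. \<Sum>q'\<in>UNIV. gval A q * gval B q' * ?p n q q')"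
      unfolding S_tautau_def tau_unit_def by (rule pcov_lincomb)
    have 2: "real n * ((cK TYPE('k))\<^sup>2 * (\<Sum>q\<in>UNIV. gval A q * gval B q * S_Y n (Y n) q q / real (nq n q)))
      = (cK TYPE('k))\<^sup>2 * (\<Sum>q\<in>UNIV. gval A q * gval B q * ?p n q q * wn n q)"
      unfolding S_Y_def sum_distrib_left by (intro sum.cong refl) (simp add: wn_def)
    have "real n * V_tautau n (nq n) (Y n) A B = real n * ((cK TYPE('k))\<^sup>2 * (\<Sum>q\<in>UNIV. gval A q * gval B q * S_Y n (Y n) q q / real (nq n q))) - S_tautau n (Y n) A B"
      using elim by (simp add: V_tautau_def right_diff_distrib)
    then show ?case unfolding 1 2 by simp
  qed
  ultimately show ?thesis
    unfolding asy_cov_tau_coef_tau_coef[OF A B] by (rule Lim_transform_eventually)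
qed

definition tier :: "'k set \<Rightarrow> nat" where
  "tier A = (THE h. h \<in> {1..H} \<and> A \<in> T h)"

lemma tier_eq: "h \<in> {1..H} \<Longrightarrow> A \<in> T h \<Longrightarrow> tier A = h"
  unfolding tier_def using tiers_disj by (intro the_equality) blast+

lemma tier_in: "A \<in> effects \<Longrightarrow> tier A \<in> {1..H} \<and> A \<in> T (tier A)"
  using tiers_cover tier_eq by blast

lemma sum_kidx: "(\<Sum>i\<in>(kidx T h :: ('k set \<times> 'l) set). f i) = (\<Sum>A\<in>T h. \<Sum>l\<in>UNIV. f (A, l) :: real)"
  unfolding kidx_def by (simp add: sum.cartesian_product)

definition W_lim :: "nat \<Rightarrow> 'k set \<times> 'l \<Rightarrow> 'k set \<times> 'l \<Rightarrow> real" where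
  "W_lim h i j = asy_cov e S (theta_coef w h i) (theta_coef w h j)"

lemma W_lim_form:
  "(\<Sum>i\<in>I. \<Sum>j\<in>I. u i * W_lim h i j * u j) = asy_cov e S (\<lambda>q v. \<Sum>i\<in>I. u i * theta_coef w h i q v) (\<lambda>q v. \<Sum>i\<in>I. u i * theta_coef w h i q v)"
  unfolding asy_cov_sum_left asy_cov_sum_right[where S = S, OF S_sym] W_lim_def
  by (simp add: sum_distrib_left mult_ac)

lemma W_lim_psd: "psd_on I (W_lim h)"
  unfolding psd_on_def W_lim_form by (simp add: asy_cov_nonneg)

lemma tier_disj_upto: "h \<in> {1..H} \<Longrightarrow> T h \<inter> tiers_upto T (h - 1) = {}"
proof -
  assume h: "h \<in> {1..H}"
  have "T h \<inter> T l = {}" if "l \<in> {1..h - 1}" for l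
    using h that by (intro tiers_disj) auto
  then show ?thesis unfolding tiers_upto_def by blast
qed

lemma W_lim_nonsing:
  assumes h: "h \<in> {1..H}"
  shows "nonsing_on (kidx T h) (W_lim h)"
proof (rule nonsing_on_if_pos_def)
  fix u assume "(\<Sum>i\<in>kidx T h. \<Sum>j\<in>kidx T h. u i * W_lim h i j * u j) = 0"
  define z where "z = (\<lambda>q v. \<Sum>i\<in>kidx T h. u i * theta_coef w h i q v)"
  define y where "y q l = (\<Sum>A\<in>T h. u (A, l) * (cK TYPE('k) * cvecw w T h q A))" for q l
  have G0: "asy_cov e S z z = 0"
    using \<open>_ = 0\<close> unfolding W_lim_form z_def .
  have zl: "z q (Inl q') = 0" for q q' by (simp add: z_def theta_coef_def)
  have zr: "z q (Inr l) = y q l" for q l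
  proof -
    have "z q (Inr l) = (\<Sum>A\<in>T h. \<Sum>l'\<in>UNIV. if l = l' then u (A, l') * (cK TYPE('k) * cvecw w T h q A) else 0)"
      unfolding z_def sum_kidx by (intro sum.cong refl) (simp add: theta_coef_def)
    then show ?thesis by (simp add: y_def)
  qed
  have col: "(\<Sum>q\<in>UNIV. z q v) = 0" for v
  proof (cases v)
    case (Inr l)
    have "(\<Sum>q\<in>UNIV. y q l) = (\<Sum>A\<in>T h. u (A, l) * (cK TYPE('k) * (\<Sum>q\<in>UNIV. cvecw w T h q A)))"
      unfolding y_def by (subst sum.swap) (simp add: sum_distrib_left)
    also have "\<dots> = 0" using h by (simp add: cvecw_zero)
    finally show ?thesis using Inr by (simp add: zr)
  qed (simp add: zl)
  let ?f = "\<lambda>q. \<Sum>l\<in>UNIV. \<Sum>l'\<in>UNIV. y q l * S (Inr l) (Inr l') * y q l'"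
  have "asy_cov e S z z = (\<Sum>q\<in>UNIV. ?f q / e q)"
    unfolding asy_cov_col_zero[OF col] sum_UNIV_Plus zl zr by (simp add: mult_ac)
  then have "(\<Sum>q\<in>UNIV. ?f q / e q) = 0" using G0 by simp
  moreover have "0 \<le> ?f q / e q" for q
    using Sxx_psd e_pos[of q] unfolding psd_on_def by (simp add: less_imp_le)
  ultimately have "\<forall>q\<in>UNIV. ?f q / e q = 0"
    by (subst (asm) sum_nonneg_eq_0_iff) auto
  then have "?f q = 0" for q using e_pos[of q] by (auto simp: less_le)
  then have "y q l = 0" for q l by (rule Sxx_pos)
  then have y0: "(\<Sum>A\<in>T h. u (A, l) * cvecw w T h q A) = 0" for q l
    using cK_pos[where 'k = 'k] unfolding y_def
    by (simp add: mult.left_commute[of _ "cK TYPE('k)"] flip: sum_distrib_left)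
  have "u (A, l) = 0" if "A \<in> T h" for A l
    by (rule cvecw_independent[where u = "\<lambda>A. u (A, l)", OF tier_disj_upto[OF h] y0 that])
  then show "\<forall>i\<in>kidx T h. u i = 0" by (auto simp: kidx_def)
qed

definition white :: "nat \<Rightarrow> 'k set \<times> 'l \<Rightarrow> 'k set \<times> 'l \<Rightarrow> real" where
  "white h = (SOME K. (\<forall>k\<in>kidx T h. \<forall>l\<in>kidx T h.
        (\<Sum>i\<in>kidx T h. \<Sum>j\<in>kidx T h. K i k * K j l * W_lim h i j) = (if k = l then 1 else 0)) \<and>
      (\<forall>i\<in>kidx T h. \<forall>j\<in>kidx T h. mat_inv_on (kidx T h) (W_lim h) i j = (\<Sum>k\<in>kidx T h. K i k * K j k)))"

lemma white:
  assumes h: "h \<in> {1..H}"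
  shows "k \<in> kidx T h \<Longrightarrow> l \<in> kidx T h \<Longrightarrow>
      (\<Sum>i\<in>kidx T h. \<Sum>j\<in>kidx T h. white h i k * white h j l * W_lim h i j) = (if k = l then 1 else 0)"
    and "i \<in> kidx T h \<Longrightarrow> j \<in> kidx T h \<Longrightarrow>
      mat_inv_on (kidx T h) (W_lim h) i j = (\<Sum>k\<in>kidx T h. white h i k * white h j k)"
proof -
  let ?I = "kidx T h :: ('k set \<times> 'l) set"
  have sym: "W_lim h i j = W_lim h j i" for i j
    unfolding W_lim_def by (rule asy_cov_commute[where S = S, OF S_sym])
  obtain K where K: "\<And>k l. k \<in> ?I \<Longrightarrow> l \<in> ?I \<Longrightarrow> (\<Sum>i\<in>?I. \<Sum>j\<in>?I. K i k * K j l * W_lim h i j) = (if k = l then 1 else 0)"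
    "\<And>i j. i \<in> ?I \<Longrightarrow> j \<in> ?I \<Longrightarrow> mat_inv_on ?I (W_lim h) i j = (\<Sum>k\<in>?I. K i k * K j k)"
    using whitening[of ?I "W_lim h", OF sym W_lim_psd W_lim_nonsing[OF h]] by blast
  have "\<exists>K. (\<forall>k\<in>?I. \<forall>l\<in>?I.
        (\<Sum>i\<in>?I. \<Sum>j\<in>?I. K i k * K j l * W_lim h i j) = (if k = l then 1 else 0)) \<and>
      (\<forall>i\<in>?I. \<forall>j\<in>?I. mat_inv_on ?I (W_lim h) i j = (\<Sum>k\<in>?I. K i k * K j k))"
    using K by (intro exI[of _ K]) simp
  from someI_ex[OF this, folded white_def]
  show "k \<in> ?I \<Longrightarrow> l \<in> ?I \<Longrightarrow> (\<Sum>i\<in>?I. \<Sum>j\<in>?I. white h i k * white h j l * W_lim h i j) = (if k = l then 1 else 0)"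
    and "i \<in> ?I \<Longrightarrow> j \<in> ?I \<Longrightarrow> mat_inv_on ?I (W_lim h) i j = (\<Sum>k\<in>?I. white h i k * white h j k)"
    by blast+
qed

definition white_coef :: "'k set \<times> 'l \<Rightarrow> 'k set \<Rightarrow> 'k set + 'l \<Rightarrow> real" where
  "white_coef j = (\<lambda>q v. if fst j \<in> effects
      then \<Sum>i\<in>kidx T (tier (fst j)). white (tier (fst j)) i j * theta_coef w (tier (fst j)) i q v else 0)"

lemma white_coef_eq:
  assumes h: "h \<in> {1..H}" and j: "j \<in> kidx T h"
  shows "white_coef j = (\<lambda>q v. \<Sum>i\<in>kidx T h. white h i j * theta_coef w h i q v)"
proof -
  have "fst j \<in> T h" using j by (auto simp: kidx_def)
  then have "fst j \<in> effects" "tier (fst j) = h" using tiers[OF h] tier_eq[OF h] by auto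
  then show ?thesis by (simp add: white_coef_def)
qed

lemma white_coef_out: "fst j \<notin> effects \<Longrightarrow> white_coef j = (\<lambda>q v. 0)"
  by (simp add: white_coef_def)

lemma asy_cov_theta_coef_other:
  assumes h: "h \<in> {1..H}" "h' \<in> {1..H}" "h \<noteq> h'" and i: "i \<in> kidx T h" and j: "j \<in> kidx T h'"
  shows "asy_cov e S (theta_coef w h i) (theta_coef w h' j) = 0"
proof -
  obtain A l A' l' where ij: "i = (A, l)" "j = (A', l')" "A \<in> T h" "A' \<in> T h'" using i j by (auto simp: kidx_def)
  have "(\<Sum>q\<in>UNIV. cvecw w T h q A * cvecw w T h' q A' * w q) = 0"
  proof (cases "h < h'")
    case True
    then show ?thesis using h ij by (intro cvecw_orthogonal_tiers w_pos) auto
  next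
    case False
    then have "h' < h" using h by simp
    then have "(\<Sum>q\<in>UNIV. cvecw w T h' q A' * cvecw w T h q A * w q) = 0"
      using h ij by (intro cvecw_orthogonal_tiers w_pos) auto
    then show ?thesis by (simp add: mult_ac)
  qed
  then show ?thesis unfolding ij asy_cov_theta_coef_theta_coef[OF h(2) ij(4)] by simp
qed

lemma white_coef_orthonormal:
  assumes j: "fst j \<in> effects" and k: "fst k \<in> effects"
  shows "asy_cov e S (white_coef j) (white_coef k) = (if j = k then 1 else 0)"
proof -
  let ?h = "tier (fst j)" and ?h' = "tier (fst k)"
  have h: "?h \<in> {1..H}" "j \<in> kidx T ?h" and h': "?h' \<in> {1..H}" "k \<in> kidx T ?h'"
    using tier_in[OF j] tier_in[OF k] by (auto simp: kidx_def mem_Times_iff)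
  have "asy_cov e S (white_coef j) (white_coef k) = (\<Sum>i\<in>kidx T ?h. white ?h i j * (\<Sum>i'\<in>kidx T ?h'. white ?h' i' k * asy_cov e S (theta_coef w ?h i) (theta_coef w ?h' i')))"
    unfolding white_coef_eq[OF h] white_coef_eq[OF h'] asy_cov_sum_left asy_cov_sum_right[where S = S, OF S_sym] ..
  also have "\<dots> = (if j = k then 1 else 0)"
  proof (cases "?h = ?h'")
    case True
    have "(\<Sum>i\<in>kidx T ?h. white ?h i j * (\<Sum>i'\<in>kidx T ?h. white ?h i' k * W_lim ?h i i'))
       = (\<Sum>i\<in>kidx T ?h. \<Sum>i'\<in>kidx T ?h. white ?h i j * white ?h i' k * W_lim ?h i i')"
      by (simp add: sum_distrib_left mult.assoc)
    also have "\<dots> = (if j = k then 1 else 0)"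
      using white(1)[OF h(1) h(2)] h'(2) True by simp
    finally show ?thesis using True by (simp add: W_lim_def)
  next
    case False
    then have "j \<noteq> k" by auto
    moreover have "asy_cov e S (theta_coef w ?h i) (theta_coef w ?h' i') = 0" if "i \<in> kidx T ?h" "i' \<in> kidx T ?h'" for i i'
      using asy_cov_theta_coef_other[OF h(1) h'(1) False that] .
    ultimately show ?thesis by simp
  qed
  finally show ?thesis .
qed

definition \<beta> :: "'k set \<Rightarrow> 'k set \<times> 'l \<Rightarrow> real" where
  "\<beta> A j = asy_cov e S (tau_coef A) (white_coef j)"

lemma n_W_xx_inv:
  assumes h: "h \<in> {1..H}"
  shows "\<forall>\<^sub>F n in sequentially. \<forall>i\<in>kidx T h. \<forall>j\<in>kidx T h.
    mat_inv_on (kidx T h) (W_xx n (nq n) T (x n) h) i j = real n * mat_inv_on (kidx T h) (\<lambda>i j. real n * W_xx n (nq n) T (x n) h i j) i j"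
proof -
  have "\<forall>\<^sub>F n in sequentially. nonsing_on (kidx T h) (\<lambda>i j. real n * W_xx n (nq n) T (x n) h i j)"
  proof (rule eventually_nonsing_on[OF _ W_lim_nonsing[OF h]])
    show "(\<lambda>n. real n * W_xx n (nq n) T (x n) h i j) \<longlonglongrightarrow> W_lim h i j" if "i \<in> kidx T h" "j \<in> kidx T h" for i j
      unfolding W_lim_def by (rule W_xx_lim[OF h that])
  qed
  then show ?thesis
    using eventually_gt_at_top[of 0]
  proof eventually_elim
    case (elim n)
    then show ?case
      by (intro ballI mat_inv_on_scale) (auto simp: nonsing_on_scale)
  qed
qed

lemma inv_W_xx_lim:
  assumes h: "h \<in> {1..H}" and ij: "i \<in> kidx T h" "j \<in> kidx T h"
  shows "(\<lambda>n. mat_inv_on (kidx T h) (\<lambda>i j. real n * W_xx n (nq n) T (x n) h i j) i j) \<longlonglongrightarrow> mat_inv_on (kidx T h) (W_lim h) i j"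
  by (rule tendsto_mat_inv_on[OF _ W_lim_nonsing[OF h] ij]) (unfold W_lim_def, rule W_xx_lim[OF h])

lemma W_par_lim:
  assumes h: "h \<in> {1..H}" and A: "A \<in> effects" and B: "B \<in> effects"
  shows "(\<lambda>n. real n * W_par n (nq n) T (Y n) (x n) h A B) \<longlonglongrightarrow> (\<Sum>j\<in>kidx T h. \<beta> A j * \<beta> B j)"
proof -
  let ?I = "kidx T h :: ('k set \<times> 'l) set"
  let ?N = "\<lambda>n. mat_inv_on ?I (\<lambda>i j. real n * W_xx n (nq n) T (x n) h i j)"
  let ?g = "\<lambda>A i. asy_cov e S (tau_coef A) (theta_coef w h i)"
  have lim: "(\<lambda>n. \<Sum>i\<in>?I. \<Sum>j\<in>?I. (real n * W_taux n (nq n) T (Y n) (x n) h A i) * ?N n i j * (real n * W_taux n (nq n) T (Y n) (x n) h B j))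
    \<longlonglongrightarrow> (\<Sum>i\<in>?I. \<Sum>j\<in>?I. ?g A i * mat_inv_on ?I (W_lim h) i j * ?g B j)"
    by (intro tendsto_intros inv_W_xx_lim W_taux_lim h A B)
  have eventually_eq: "\<forall>\<^sub>F n in sequentially. (\<Sum>i\<in>?I. \<Sum>j\<in>?I. (real n * W_taux n (nq n) T (Y n) (x n) h A i) * ?N n i j * (real n * W_taux n (nq n) T (Y n) (x n) h B j))
    = real n * W_par n (nq n) T (Y n) (x n) h A B"
    using n_W_xx_inv[OF h]
  proof eventually_elim
    case (elim n)
    show ?case unfolding W_par_def sum_distrib_left
      by (intro sum.cong refl) (simp add: elim mult_ac)
  qed
  have eq: "(\<Sum>i\<in>?I. \<Sum>j\<in>?I. ?g A i * mat_inv_on ?I (W_lim h) i j * ?g B j) = (\<Sum>k\<in>?I. \<beta> A k * \<beta> B k)"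
  proof -
    have \<beta>: "\<beta> A k = (\<Sum>i\<in>?I. white h i k * ?g A i)" if "k \<in> ?I" for A k
      unfolding \<beta>_def white_coef_eq[OF h that] by (rule asy_cov_sum_right[where S = S, OF S_sym])
    have "(\<Sum>i\<in>?I. \<Sum>j\<in>?I. ?g A i * mat_inv_on ?I (W_lim h) i j * ?g B j)
       = (\<Sum>i\<in>?I. \<Sum>j\<in>?I. \<Sum>k\<in>?I. (white h i k * ?g A i) * (white h j k * ?g B j))"
    proof (intro sum.cong refl)
      fix i j assume "i \<in> ?I" "j \<in> ?I"
      then show "?g A i * mat_inv_on ?I (W_lim h) i j * ?g B j = (\<Sum>k\<in>?I. (white h i k * ?g A i) * (white h j k * ?g B j))"
        unfolding white(2)[OF h \<open>i \<in> ?I\<close> \<open>j \<in> ?I\<close>] sum_distrib_left sum_distrib_right by (simp only: mult_ac)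
    qed
    also have "\<dots> = (\<Sum>i\<in>?I. \<Sum>k\<in>?I. \<Sum>j\<in>?I. (white h i k * ?g A i) * (white h j k * ?g B j))"
      by (intro sum.cong refl sum.swap)
    also have "\<dots> = (\<Sum>k\<in>?I. \<Sum>i\<in>?I. \<Sum>j\<in>?I. (white h i k * ?g A i) * (white h j k * ?g B j))"
      by (rule sum.swap)
    also have "\<dots> = (\<Sum>k\<in>?I. \<beta> A k * \<beta> B k)"
      by (intro sum.cong refl) (simp add: \<beta> sum_product)
    finally show ?thesis .
  qed
  show ?thesis using Lim_transform_eventually[OF lim eventually_eq] unfolding eq .
qed

lemma scaled_err_eq: "scaled_err n (nq n) (Y n) Z A = pairing (tau_coef A) (X n Z)"
proof (cases "A = {}")
  case False
  have "scaled_err n (nq n) (Y n) Z A = sqrt (real n) * (cK TYPE('k) * (\<Sum>q\<in>UNIV. gval A q * (Yhat n (nq n) (Y n) Z q - pmean n (\<lambda>i. P n i (Inl q)))))"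
    using False by (simp add: scaled_err_def effects_def tau_hat_def tau_pop_def right_diff_distrib sum_subtractf)
  also have "\<dots> = (\<Sum>q\<in>UNIV. cK TYPE('k) * gval A q * X n Z q (Inl q))"
    unfolding sum_distrib_left by (intro sum.cong refl) (simp add: group_dev_def Yhat_def)
  finally show ?thesis using False by (simp add: pairing_tau_coef)
qed (simp add: scaled_err_def effects_def pairing_tau_coef)

lemma theta_eq:
  assumes h: "h \<in> {1..H}" and i: "i \<in> kidx T h" and n: "n \<ge> 2" "\<And>q. nq n q \<ge> 1"
  shows "sqrt (real n) * theta_x n (nq n) T (x n) Z h i = pairing (theta_coef (wn n) h i) (X n Z)"
proof -
  obtain A l where A: "i = (A, l)" "A \<in> T h" using i by (auto simp: kidx_def)
  have c: "cvec (nq n) T h q A = cvecw (wn n) T h q A" for q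
    unfolding wn_def using n h by (intro cvec_eq_cvecw) auto
  have "pairing (theta_coef (wn n) h i) (X n Z) = (\<Sum>q\<in>UNIV. cK TYPE('k) * cvecw (wn n) T h q A * (sqrt (real n) * (xhat n (nq n) (x n) Z q l - pmean n (\<lambda>i. P n i (Inr l)))))"
    unfolding pairing_theta_coef A by (simp add: group_dev_def xhat_def)
  also have "\<dots> = sqrt (real n) * (cK TYPE('k) * (\<Sum>q\<in>UNIV. cvecw (wn n) T h q A * xhat n (nq n) (x n) Z q l))
      - sqrt (real n) * cK TYPE('k) * pmean n (\<lambda>i. P n i (Inr l)) * (\<Sum>q\<in>UNIV. cvecw (wn n) T h q A)"
    unfolding sum_distrib_left sum_subtractf[symmetric] by (intro sum.cong refl) (simp add: algebra_simps)
  finally show ?thesis using cvecw_zero[OF h A(2)] by (simp add: theta_x_def A c)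
qed

lemma X_sq_bounded: "\<exists>C. \<forall>\<^sub>F n in sequentially. EE n (\<lambda>Z. (X n Z q v)\<^sup>2) \<le> C"
proof -
  have "(\<Sum>q'\<in>UNIV. \<Sum>v'\<in>UNIV. (if q' = q then if v' = v then 1 else 0 else 0) * X n Z q' v') = X n Z q v" for n Z
  proof -
    have "(\<Sum>v'\<in>UNIV. (if q' = q then if v' = v then 1 else 0 else 0) * X n Z q' v') = (if q' = q then X n Z q v else 0)" for q'
      by (simp add: if_distrib[where f = "\<lambda>z. z * _"] cong: if_cong)
    then show ?thesis by simp
  qed
  then show ?thesis
    using second_moment_bounded[of "\<lambda>q' v'. if q' = q then if v' = v then 1 else 0 else 0"] by simp
qed

lemma X_prod_bounded: "\<exists>C. \<forall>\<^sub>F n in sequentially. EE n (\<lambda>Z. \<bar>X n Z q v * X n Z q' v'\<bar>) \<le> C"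
proof -
  obtain C where C: "\<forall>\<^sub>F n in sequentially. EE n (\<lambda>Z. (X n Z q v)\<^sup>2) \<le> C"
    using X_sq_bounded[of q v] by blast
  obtain C' where C': "\<forall>\<^sub>F n in sequentially. EE n (\<lambda>Z. (X n Z q' v')\<^sup>2) \<le> C'"
    using X_sq_bounded[of q' v'] by blast
  from C C' have "\<forall>\<^sub>F n in sequentially. EE n (\<lambda>Z. \<bar>X n Z q v * X n Z q' v'\<bar>) \<le> C + C'"
  proof eventually_elim
    case (elim n)
    have "EE n (\<lambda>Z. \<bar>X n Z q v * X n Z q' v'\<bar>) \<le> EE n (\<lambda>Z. (X n Z q v)\<^sup>2 + (X n Z q' v')\<^sup>2)"
      by (intro avg_mono abs_mult_le_sum_squares)
    then show ?case using elim by (simp add: avg_add)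
  qed
  then show ?thesis by blast
qed

lemma quad_stat_close:
  fixes Q :: "nat \<Rightarrow> 'i \<Rightarrow> real" and Ql :: "'i \<Rightarrow> real"
  assumes Q: "\<And>i. i \<in> I \<Longrightarrow> (\<lambda>n. Q n i) \<longlonglongrightarrow> Ql i"
    and p: "\<And>i. i \<in> I \<Longrightarrow> \<exists>C. \<forall>\<^sub>F n in sequentially. EE n (\<lambda>Z. \<bar>p n i Z\<bar>) \<le> C"
  shows "(\<lambda>n. EE n (\<lambda>Z. \<bar>(\<Sum>i\<in>I. Q n i * p n i Z) - (\<Sum>i\<in>I. Ql i * p n i Z)\<bar>)) \<longlonglongrightarrow> 0"
proof (rule Lim_null_comparison)
  have "(\<lambda>n. \<bar>Q n i - Ql i\<bar> * EE n (\<lambda>Z. \<bar>p n i Z\<bar>)) \<longlonglongrightarrow> 0" if i: "i \<in> I" for i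
  proof -
    obtain C where C: "\<forall>\<^sub>F n in sequentially. EE n (\<lambda>Z. \<bar>p n i Z\<bar>) \<le> C" using p[OF i] by blast
    have "(\<lambda>n. \<bar>Q n i - Ql i\<bar> * C) \<longlonglongrightarrow> \<bar>Ql i - Ql i\<bar> * C"
      by (intro tendsto_intros Q i)
    then have "(\<lambda>n. \<bar>Q n i - Ql i\<bar> * C) \<longlonglongrightarrow> 0" by simp
    then show ?thesis
      by (rule Lim_null_comparison[rotated])
        (use C in eventually_elim, auto simp: abs_mult avg_nonneg intro!: mult_left_mono)
  qed
  then show "(\<lambda>n. \<Sum>i\<in>I. \<bar>Q n i - Ql i\<bar> * EE n (\<lambda>Z. \<bar>p n i Z\<bar>)) \<longlonglongrightarrow> 0"
    by (rule tendsto_null_sum)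
  show "\<forall>\<^sub>F n in sequentially. norm (EE n (\<lambda>Z. \<bar>(\<Sum>i\<in>I. Q n i * p n i Z) - (\<Sum>i\<in>I. Ql i * p n i Z)\<bar>))
      \<le> (\<Sum>i\<in>I. \<bar>Q n i - Ql i\<bar> * EE n (\<lambda>Z. \<bar>p n i Z\<bar>))"
  proof (rule always_eventually, rule allI)
    fix n
    have "EE n (\<lambda>Z. \<bar>(\<Sum>i\<in>I. Q n i * p n i Z) - (\<Sum>i\<in>I. Ql i * p n i Z)\<bar>) \<le> EE n (\<lambda>Z. \<Sum>i\<in>I. \<bar>Q n i - Ql i\<bar> * \<bar>p n i Z\<bar>)"
    proof (rule avg_mono)
      fix Z
      have "(\<Sum>i\<in>I. Q n i * p n i Z) - (\<Sum>i\<in>I. Ql i * p n i Z) = (\<Sum>i\<in>I. (Q n i - Ql i) * p n i Z)"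
        by (simp add: left_diff_distrib sum_subtractf)
      then show "\<bar>(\<Sum>i\<in>I. Q n i * p n i Z) - (\<Sum>i\<in>I. Ql i * p n i Z)\<bar> \<le> (\<Sum>i\<in>I. \<bar>Q n i - Ql i\<bar> * \<bar>p n i Z\<bar>)"
        by (simp add: order_trans[OF sum_abs] abs_mult)
    qed
    then show "norm (EE n (\<lambda>Z. \<bar>(\<Sum>i\<in>I. Q n i * p n i Z) - (\<Sum>i\<in>I. Ql i * p n i Z)\<bar>))
      \<le> (\<Sum>i\<in>I. \<bar>Q n i - Ql i\<bar> * EE n (\<lambda>Z. \<bar>p n i Z\<bar>))"
      by (simp add: avg_sum avg_cmult abs_of_nonneg avg_nonneg)
  qed
qed

definition qidx :: "nat \<Rightarrow> ((('k set \<times> 'l) \<times> ('k set \<times> 'l)) \<times> ('k set \<times> 'k set)) set" where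
  "qidx h = (kidx T h \<times> kidx T h) \<times> UNIV"

definition qcoef :: "('k set \<Rightarrow> real) \<Rightarrow> ('k set \<times> 'l \<Rightarrow> 'k set \<times> 'l \<Rightarrow> real) \<Rightarrow> nat \<Rightarrow>
    (('k set \<times> 'l) \<times> ('k set \<times> 'l)) \<times> ('k set \<times> 'k set) \<Rightarrow> real" where
  "qcoef w' N h = (\<lambda>((i, j), (q, q')). cK TYPE('k) * cvecw w' T h q (fst i) * N i j * (cK TYPE('k) * cvecw w' T h q' (fst j)))"

definition qprod :: "('k set \<Rightarrow> 'k set + 'l \<Rightarrow> real) \<Rightarrow> (('k set \<times> 'l) \<times> ('k set \<times> 'l)) \<times> ('k set \<times> 'k set) \<Rightarrow> real" where
  "qprod X' = (\<lambda>((i, j), (q, q')). X' q (Inr (snd i)) * X' q' (Inr (snd j)))"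

lemma sum_Times: "(\<Sum>k\<in>A' \<times> B'. f k) = (\<Sum>a\<in>A'. \<Sum>b\<in>B'. f (a, b) :: real)"
  by (simp add: sum.cartesian_product)

lemma quad_expand:
  "(\<Sum>i\<in>kidx T h. \<Sum>j\<in>kidx T h. pairing (theta_coef w' h i) X' * N i j * pairing (theta_coef w' h j) X')
    = (\<Sum>k\<in>qidx h. qcoef w' N h k * qprod X' k)"
proof -
  have "(\<Sum>k\<in>qidx h. qcoef w' N h k * qprod X' k)
     = (\<Sum>i\<in>kidx T h. \<Sum>j\<in>kidx T h. \<Sum>q\<in>UNIV. \<Sum>q'\<in>UNIV. qcoef w' N h ((i, j), (q, q')) * qprod X' ((i, j), (q, q')))"
    unfolding qidx_def UNIV_Times_UNIV[symmetric] sum_Times ..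
  also have "\<dots> = (\<Sum>i\<in>kidx T h. \<Sum>j\<in>kidx T h. pairing (theta_coef w' h i) X' * N i j * pairing (theta_coef w' h j) X')"
  proof (intro sum.cong refl)
    fix i j
    let ?f = "\<lambda>i q. cK TYPE('k) * cvecw w' T h q (fst i) * X' q (Inr (snd i))"
    have "pairing (theta_coef w' h i) X' * N i j * pairing (theta_coef w' h j) X' = N i j * ((\<Sum>q\<in>UNIV. ?f i q) * (\<Sum>q\<in>UNIV. ?f j q))"
      unfolding pairing_theta_coef by (simp only: mult_ac)
    also have "\<dots> = (\<Sum>q\<in>UNIV. \<Sum>q'\<in>UNIV. qcoef w' N h ((i, j), (q, q')) * qprod X' ((i, j), (q, q')))"
      unfolding sum_product unfolding sum_distrib_left qcoef_def qprod_def prod.case by (simp only: mult_ac)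
    finally show "(\<Sum>q\<in>UNIV. \<Sum>q'\<in>UNIV. qcoef w' N h ((i, j), (q, q')) * qprod X' ((i, j), (q, q')))
      = pairing (theta_coef w' h i) X' * N i j * pairing (theta_coef w' h j) X'" by simp
  qed
  finally show ?thesis by simp
qed

lemma M_stat_close:
  assumes h: "h \<in> {1..H}"
  shows "(\<lambda>n. EE n (\<lambda>Z. \<bar>M_stat n (nq n) T (x n) Z h - (\<Sum>j\<in>kidx T h. (pairing (white_coef j) (X n Z))\<^sup>2)\<bar>)) \<longlonglongrightarrow> 0"
proof -
  let ?I = "kidx T h :: ('k set \<times> 'l) set"
  let ?Nn = "\<lambda>n. mat_inv_on ?I (\<lambda>i j. real n * W_xx n (nq n) T (x n) h i j)"
  let ?N = "mat_inv_on ?I (W_lim h)"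
  have lim_stat: "(\<Sum>k\<in>?I. (pairing (white_coef k) X')\<^sup>2) = (\<Sum>i\<in>?I. \<Sum>j\<in>?I. pairing (theta_coef w h i) X' * ?N i j * pairing (theta_coef w h j) X')" for X'
  proof -
    let ?f = "\<lambda>i k. white h i k * pairing (theta_coef w h i) X'"
    have "(\<Sum>k\<in>?I. (pairing (white_coef k) X')\<^sup>2) = (\<Sum>k\<in>?I. (\<Sum>i\<in>?I. ?f i k) * (\<Sum>j\<in>?I. ?f j k))"
      by (intro sum.cong refl) (simp add: white_coef_eq[OF h] pairing_sum power2_eq_square)
    also have "\<dots> = (\<Sum>k\<in>?I. \<Sum>i\<in>?I. \<Sum>j\<in>?I. ?f i k * ?f j k)"
      by (simp only: sum_product)
    also have "\<dots> = (\<Sum>i\<in>?I. \<Sum>k\<in>?I. \<Sum>j\<in>?I. ?f i k * ?f j k)"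
      by (rule sum.swap)
    also have "\<dots> = (\<Sum>i\<in>?I. \<Sum>j\<in>?I. \<Sum>k\<in>?I. ?f i k * ?f j k)"
      by (intro sum.cong refl sum.swap)
    also have "\<dots> = (\<Sum>i\<in>?I. \<Sum>j\<in>?I. pairing (theta_coef w h i) X' * ?N i j * pairing (theta_coef w h j) X')"
    proof (intro sum.cong refl)
      fix i j assume ij: "i \<in> ?I" "j \<in> ?I"
      show "(\<Sum>k\<in>?I. ?f i k * ?f j k) = pairing (theta_coef w h i) X' * ?N i j * pairing (theta_coef w h j) X'"
        unfolding white(2)[OF h ij] sum_distrib_left sum_distrib_right by (simp only: mult_ac)
    qed
    finally show ?thesis .
  qed
  have "(\<lambda>n. EE n (\<lambda>Z. \<bar>(\<Sum>k\<in>qidx h. qcoef (wn n) (?Nn n) h k * qprod (X n Z) k) - (\<Sum>k\<in>qidx h. qcoef w ?N h k * qprod (X n Z) k)\<bar>)) \<longlonglongrightarrow> 0"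
  proof (rule quad_stat_close)
    fix k assume k: "k \<in> qidx h"
    obtain i j q q' where ij: "k = ((i, j), (q, q'))" "i \<in> ?I" "j \<in> ?I"
      using k by (auto simp: qidx_def)
    show "(\<lambda>n. qcoef (wn n) (?Nn n) h k) \<longlonglongrightarrow> qcoef w ?N h k"
      unfolding ij qcoef_def prod.case
      by (intro tendsto_intros tendsto_cvecw wn_lim w_pos inv_W_xx_lim h ij)
    show "\<exists>C. \<forall>\<^sub>F n in sequentially. EE n (\<lambda>Z. \<bar>qprod (X n Z) k\<bar>) \<le> C"
      unfolding ij qprod_def prod.case by (rule X_prod_bounded)
  qed
  moreover have "\<forall>\<^sub>F n in sequentially.
      EE n (\<lambda>Z. \<bar>(\<Sum>k\<in>qidx h. qcoef (wn n) (?Nn n) h k * qprod (X n Z) k) - (\<Sum>k\<in>qidx h. qcoef w ?N h k * qprod (X n Z) k)\<bar>)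
      = EE n (\<lambda>Z. \<bar>M_stat n (nq n) T (x n) Z h - (\<Sum>j\<in>kidx T h. (pairing (white_coef j) (X n Z))\<^sup>2)\<bar>)"
    using good n_W_xx_inv[OF h]
  proof eventually_elim
    case (elim n)
    have "M_stat n (nq n) T (x n) Z h = (\<Sum>i\<in>?I. \<Sum>j\<in>?I. pairing (theta_coef (wn n) h i) (X n Z) * ?Nn n i j * pairing (theta_coef (wn n) h j) (X n Z))" for Z
      unfolding M_stat_def
    proof (intro sum.cong refl)
      fix i j assume ij: "i \<in> ?I" "j \<in> ?I"
      have r: "real n = sqrt (real n) * sqrt (real n)" by simp
      have t: "sqrt (real n) * theta_x n (nq n) T (x n) Z h i = pairing (theta_coef (wn n) h i) (X n Z)" if "i \<in> ?I" for i
        using elim by (intro theta_eq h that) auto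
      have "theta_x n (nq n) T (x n) Z h i * mat_inv_on ?I (W_xx n (nq n) T (x n) h) i j * theta_x n (nq n) T (x n) Z h j
         = theta_x n (nq n) T (x n) Z h i * ((sqrt (real n) * sqrt (real n)) * ?Nn n i j) * theta_x n (nq n) T (x n) Z h j"
        using elim ij by simp
      also have "\<dots> = (sqrt (real n) * theta_x n (nq n) T (x n) Z h i) * ?Nn n i j * (sqrt (real n) * theta_x n (nq n) T (x n) Z h j)"
        by (simp only: mult_ac)
      finally show "theta_x n (nq n) T (x n) Z h i * mat_inv_on ?I (W_xx n (nq n) T (x n) h) i j * theta_x n (nq n) T (x n) Z h j
         = pairing (theta_coef (wn n) h i) (X n Z) * ?Nn n i j * pairing (theta_coef (wn n) h j) (X n Z)"
        unfolding t[OF ij(1)] t[OF ij(2)] .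
    qed
    then show ?case by (simp add: lim_stat quad_expand)
  qed
  ultimately show ?thesis by (rule Lim_transform_eventually)
qed

definition joint_coef :: "'k set + ('k set \<times> 'l) \<Rightarrow> 'k set \<Rightarrow> 'k set + 'l \<Rightarrow> real" where
  "joint_coef k = (case k of Inl A \<Rightarrow> tau_coef A | Inr j \<Rightarrow> white_coef j)"

definition effect_pairs :: "('k set \<times> 'l) set" where
  "effect_pairs = {j. fst j \<in> effects}"

lemma effect_pairs_eq: "effect_pairs = (\<Union>h\<in>{1..H}. kidx T h)"
  unfolding effect_pairs_def kidx_def using tiers_cover by (auto simp: set_eq_iff)

lemma asy_cov_zero [simp]: "asy_cov e S (\<lambda>q v. 0) u = 0" "asy_cov e S u (\<lambda>q v. 0) = 0"
  by (simp_all add: asy_cov_def)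

lemma \<beta>_out: "j \<notin> effect_pairs \<Longrightarrow> \<beta> A j = 0"
  by (simp add: \<beta>_def effect_pairs_def white_coef_out)

lemma sum_effect_pairs: "(\<And>j. j \<notin> effect_pairs \<Longrightarrow> f j = 0) \<Longrightarrow> (\<Sum>j\<in>UNIV. f j) = (\<Sum>j\<in>effect_pairs. f j :: real)"
  by (rule sum.mono_neutral_right) auto

lemma white_coef_gram: "asy_cov e S (white_coef j) (white_coef k) = (if j = k \<and> j \<in> effect_pairs then 1 else 0)"
proof (cases "j \<in> effect_pairs \<and> k \<in> effect_pairs")
  case True
  then show ?thesis using white_coef_orthonormal[of j k] by (auto simp: effect_pairs_def)
next
  case False
  then have "white_coef j = (\<lambda>q v. 0) \<or> white_coef k = (\<lambda>q v. 0)" by (auto simp: effect_pairs_def white_coef_out)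
  then show ?thesis using False by auto
qed

lemma asy_cov_joint_coef:
  "asy_cov e S (\<lambda>q v. \<Sum>k\<in>UNIV. t k * joint_coef k q v) (\<lambda>q v. \<Sum>k\<in>UNIV. t k * joint_coef k q v)
    = (\<Sum>A\<in>UNIV. \<Sum>B\<in>UNIV. t (Inl A) * t (Inl B) * asy_cov e S (tau_coef A) (tau_coef B))
      + 2 * (\<Sum>j\<in>effect_pairs. t (Inr j) * (\<Sum>A\<in>UNIV. t (Inl A) * \<beta> A j)) + (\<Sum>j\<in>effect_pairs. (t (Inr j))\<^sup>2)"
proof -
  let ?C = "\<lambda>A B. asy_cov e S (tau_coef A) (tau_coef B)"
  have "asy_cov e S (\<lambda>q v. \<Sum>k\<in>UNIV. t k * joint_coef k q v) (\<lambda>q v. \<Sum>k\<in>UNIV. t k * joint_coef k q v)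
     = (\<Sum>k\<in>UNIV. t k * (\<Sum>k'\<in>UNIV. t k' * asy_cov e S (joint_coef k) (joint_coef k')))"
    unfolding asy_cov_sum_left asy_cov_sum_right[where S = S, OF S_sym] ..
  also have "\<dots> = (\<Sum>A\<in>UNIV. t (Inl A) * ((\<Sum>B\<in>UNIV. t (Inl B) * ?C A B) + (\<Sum>j\<in>UNIV. t (Inr j) * \<beta> A j)))
      + (\<Sum>j\<in>UNIV. t (Inr j) * ((\<Sum>A\<in>UNIV. t (Inl A) * \<beta> A j) + (\<Sum>k\<in>UNIV. t (Inr k) * asy_cov e S (white_coef j) (white_coef k))))"
    unfolding sum_UNIV_Plus joint_coef_def by (simp add: \<beta>_def asy_cov_commute[where S = S, OF S_sym, of e "white_coef _" "tau_coef _"])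
  also have "(\<Sum>j\<in>UNIV. t (Inr j) * ((\<Sum>A\<in>UNIV. t (Inl A) * \<beta> A j) + (\<Sum>k\<in>UNIV. t (Inr k) * asy_cov e S (white_coef j) (white_coef k))))
      = (\<Sum>j\<in>effect_pairs. t (Inr j) * (\<Sum>A\<in>UNIV. t (Inl A) * \<beta> A j)) + (\<Sum>j\<in>effect_pairs. (t (Inr j))\<^sup>2)"
  proof -
    have "(\<Sum>k\<in>UNIV. t (Inr k) * asy_cov e S (white_coef j) (white_coef k)) = (if j \<in> effect_pairs then t (Inr j) else 0)" for j
    proof -
      have "(\<Sum>k\<in>UNIV. t (Inr k) * asy_cov e S (white_coef j) (white_coef k)) = (\<Sum>k\<in>UNIV. if j = k then (if j \<in> effect_pairs then t (Inr j) else 0) else 0)"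
        by (intro sum.cong refl) (simp add: white_coef_gram)
      then show ?thesis by simp
    qed
    then have "(\<Sum>j\<in>UNIV. t (Inr j) * ((\<Sum>A\<in>UNIV. t (Inl A) * \<beta> A j) + (\<Sum>k\<in>UNIV. t (Inr k) * asy_cov e S (white_coef j) (white_coef k))))
       = (\<Sum>j\<in>effect_pairs. t (Inr j) * ((\<Sum>A\<in>UNIV. t (Inl A) * \<beta> A j) + (\<Sum>k\<in>UNIV. t (Inr k) * asy_cov e S (white_coef j) (white_coef k))))"
      by (intro sum_effect_pairs) (simp add: \<beta>_out)
    also have "\<dots> = (\<Sum>j\<in>effect_pairs. t (Inr j) * (\<Sum>A\<in>UNIV. t (Inl A) * \<beta> A j) + (t (Inr j))\<^sup>2)"
      using \<open>\<And>j. _ = (if j \<in> effect_pairs then t (Inr j) else 0)\<close>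
      by (intro sum.cong refl) (simp add: distrib_left power2_eq_square)
    finally show ?thesis by (simp add: sum.distrib)
  qed
  also have "(\<Sum>A\<in>UNIV. t (Inl A) * ((\<Sum>B\<in>UNIV. t (Inl B) * ?C A B) + (\<Sum>j\<in>UNIV. t (Inr j) * \<beta> A j)))
     = (\<Sum>A\<in>UNIV. \<Sum>B\<in>UNIV. t (Inl A) * t (Inl B) * ?C A B) + (\<Sum>j\<in>effect_pairs. t (Inr j) * (\<Sum>A\<in>UNIV. t (Inl A) * \<beta> A j))"
  proof -
    have "(\<Sum>A\<in>UNIV. t (Inl A) * (\<Sum>j\<in>UNIV. t (Inr j) * \<beta> A j)) = (\<Sum>j\<in>UNIV. t (Inr j) * (\<Sum>A\<in>UNIV. t (Inl A) * \<beta> A j))"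
      unfolding sum_distrib_left by (subst sum.swap) (simp only: mult_ac)
    also have "\<dots> = (\<Sum>j\<in>effect_pairs. t (Inr j) * (\<Sum>A\<in>UNIV. t (Inl A) * \<beta> A j))"
      by (intro sum_effect_pairs) (simp add: \<beta>_out)
    finally show ?thesis by (simp add: distrib_left sum.distrib sum_distrib_left mult.assoc)
  qed
  finally show ?thesis by simp
qed

lemma limit_coefficients:
  obtains \<kappa> :: "'k set \<Rightarrow> 'k set + ('k set \<times> 'l) \<Rightarrow> real" where
    "\<And>A B. asy_cov e S (tau_coef A) (tau_coef B) = (\<Sum>k\<in>UNIV. \<kappa> A k * \<kappa> B k)"
    "\<And>A j. \<kappa> A (Inr j) = \<beta> A j"
proof -
  let ?C = "\<lambda>A B. asy_cov e S (tau_coef A) (tau_coef B)"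
  have psd: "0 \<le> (\<Sum>A\<in>UNIV. \<Sum>B\<in>UNIV. t A * t B * ?C A B) + 2 * (\<Sum>j\<in>effect_pairs. s j * (\<Sum>A\<in>UNIV. t A * \<beta> A j)) + (\<Sum>j\<in>effect_pairs. (s j)\<^sup>2)" for t s
    using asy_cov_nonneg[of "\<lambda>q v. \<Sum>k\<in>UNIV. case_sum t s k * joint_coef k q v"] unfolding asy_cov_joint_coef by simp
  obtain L :: "'k set \<Rightarrow> 'k set \<Rightarrow> real" where
    L: "\<forall>A B. ?C A B = (\<Sum>k\<in>UNIV. L k A * L k B) + (\<Sum>j\<in>effect_pairs. \<beta> A j * \<beta> B j)"
    by (rule complete_square[where C = ?C and J = effect_pairs and \<beta> = \<beta>, OF asy_cov_commute[where S = S, OF S_sym] psd]) blast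
  define \<kappa> where "\<kappa> A = case_sum (\<lambda>k. L k A) (\<beta> A)" for A
  have "(\<Sum>j\<in>UNIV. \<beta> A j * \<beta> B j) = (\<Sum>j\<in>effect_pairs. \<beta> A j * \<beta> B j)" for A B
    by (intro sum_effect_pairs) (simp add: \<beta>_out)
  then show ?thesis
    by (intro that[of \<kappa>]) (simp_all add: L \<kappa>_def sum_UNIV_Plus)
qed

definition joint_stat :: "nat \<Rightarrow> (nat \<Rightarrow> 'k set) \<Rightarrow> 'k set + ('k set \<times> 'l) \<Rightarrow> real" where
  "joint_stat n Z k = pairing (joint_coef k) (X n Z)"

lemma joint_stat_Inl: "joint_stat n Z (Inl A) = scaled_err n (nq n) (Y n) Z A"
  by (simp add: joint_stat_def joint_coef_def scaled_err_eq)

lemma joint_stat_Inr: "joint_stat n Z (Inr j) = pairing (white_coef j) (X n Z)"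
  by (simp add: joint_stat_def joint_coef_def)

definition joint_limit :: "('k set \<Rightarrow> 'k set + ('k set \<times> 'l) \<Rightarrow> real) \<Rightarrow> ('k set + ('k set \<times> 'l) \<Rightarrow> real) \<Rightarrow> 'k set + ('k set \<times> 'l) \<Rightarrow> real" where
  "joint_limit \<kappa> \<omega> k = (case k of Inl A \<Rightarrow> \<Sum>k\<in>UNIV. \<kappa> A k * \<omega> k | Inr j \<Rightarrow> if j \<in> effect_pairs then \<omega> (Inr j) else 0)"

lemma joint_limit_lin:
  "\<exists>c. \<forall>\<omega>. joint_limit \<kappa> \<omega> k = (\<Sum>i\<in>UNIV. c i * \<omega> i)"
proof (cases k)
  case (Inr j)
  have lin: "(if j \<in> effect_pairs then \<omega> (Inr j) else 0) = (\<Sum>i\<in>UNIV. (if i = Inr j then (if j \<in> effect_pairs then 1 else 0) else 0) * \<omega> i)" for \<omega> :: "'k set + ('k set \<times> 'l) \<Rightarrow> real"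
    by (simp add: if_distrib[where f = "\<lambda>z. z * _"] cong: if_cong)
  have "\<exists>c. \<forall>\<omega> :: 'k set + ('k set \<times> 'l) \<Rightarrow> real. (if j \<in> effect_pairs then \<omega> (Inr j) else 0) = (\<Sum>i\<in>UNIV. c i * \<omega> i)"
    by (rule exI, rule allI, rule lin)
  then show ?thesis by (simp only: Inr joint_limit_def sum.case)
qed (auto simp: joint_limit_def)

lemma joint_limit_measurable: "joint_limit \<kappa> \<in> borel_measurable (gauss UNIV)"
proof (rule measurable_coordinatewise_then_product)
  fix k
  obtain c where c: "\<And>\<omega>. joint_limit \<kappa> \<omega> k = (\<Sum>i\<in>UNIV. c i * \<omega> i)" using joint_limit_lin by blast
  show "(\<lambda>\<omega>. joint_limit \<kappa> \<omega> k) \<in> borel_measurable (gauss UNIV)"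
    unfolding c by (intro borel_measurable_sum borel_measurable_times coord_measurable) auto
qed

lemma weak_limit_joint_stat:
  assumes \<kappa>: "\<And>A B. asy_cov e S (tau_coef A) (tau_coef B) = (\<Sum>k\<in>UNIV. \<kappa> A k * \<kappa> B k)" "\<And>A j. \<kappa> A (Inr j) = \<beta> A j"
  shows "weak_limit (gauss UNIV) (\<lambda>n. assignments n (nq n)) joint_stat (joint_limit \<kappa>)"
proof -
  interpret prob_space "gauss (UNIV :: ('k set + ('k set \<times> 'l)) set)" by (rule prob_space_gauss)
  show ?thesis
  proof
    show "\<forall>\<^sub>F n in sequentially. finite (assignments n (nq n)) \<and> assignments n (nq n) \<noteq> {}"
      using good by eventually_elim (auto simp: finite_assignments crfe_design.nonempty)
    show "joint_limit \<kappa> \<in> borel_measurable (gauss UNIV)" by (rule joint_limit_measurable)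
    show "\<exists>C. \<forall>\<^sub>F n in sequentially. avg (assignments n (nq n)) (\<lambda>Z. (joint_stat n Z k)\<^sup>2) \<le> C" for k
      unfolding joint_stat_def pairing_def by (rule second_moment_bounded)
    show "integrable (gauss UNIV) (\<lambda>\<omega>. (joint_limit \<kappa> \<omega> k)\<^sup>2)" for k
    proof -
      obtain c where c: "\<And>\<omega>. joint_limit \<kappa> \<omega> k = (\<Sum>i\<in>UNIV. c i * \<omega> i)" using joint_limit_lin by blast
      show ?thesis unfolding c power2_eq_square by (rule lin_prod_integrable)
    qed
    fix t :: "'k set + ('k set \<times> 'l) \<Rightarrow> real" and c :: real
    define b where "b j = (\<Sum>A\<in>UNIV. t (Inl A) * \<beta> A j)" for j
    define \<gamma> where "\<gamma> k = (\<Sum>A\<in>UNIV. t (Inl A) * \<kappa> A k) + (case k of Inl _ \<Rightarrow> 0 | Inr j \<Rightarrow> if j \<in> effect_pairs then t (Inr j) else 0)" for k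
    have lhs: "(\<Sum>k\<in>UNIV. t k * joint_stat n Z k) = (\<Sum>q\<in>UNIV. \<Sum>v\<in>UNIV. (\<Sum>k\<in>UNIV. t k * joint_coef k q v) * X n Z q v)" for n Z
      unfolding joint_stat_def pairing_sum[symmetric] by (simp add: pairing_def)
    have rhs: "(\<Sum>k\<in>UNIV. t k * joint_limit \<kappa> \<omega> k) = (\<Sum>k\<in>UNIV. \<gamma> k * \<omega> k)" for \<omega>
    proof -
      have 1: "(\<Sum>A\<in>UNIV. t (Inl A) * (\<Sum>k\<in>UNIV. \<kappa> A k * \<omega> k)) = (\<Sum>k\<in>UNIV. (\<Sum>A\<in>UNIV. t (Inl A) * \<kappa> A k) * \<omega> k)"
        unfolding sum_distrib_left sum_distrib_right by (subst sum.swap) (simp only: mult_ac)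
      have 2: "(\<Sum>j\<in>UNIV. t (Inr j) * (if j \<in> effect_pairs then \<omega> (Inr j) else 0))
        = (\<Sum>k\<in>UNIV. (case k of Inl _ \<Rightarrow> 0 | Inr j \<Rightarrow> if j \<in> effect_pairs then t (Inr j) else 0) * \<omega> k)"
        unfolding sum_UNIV_Plus by (simp add: if_distrib if_distribR cong: if_cong)
      have 3: "(\<Sum>k\<in>UNIV. t k * joint_limit \<kappa> \<omega> k) = (\<Sum>A\<in>UNIV. t (Inl A) * (\<Sum>k\<in>UNIV. \<kappa> A k * \<omega> k))
          + (\<Sum>j\<in>UNIV. t (Inr j) * (if j \<in> effect_pairs then \<omega> (Inr j) else 0))"
        unfolding sum_UNIV_Plus[of "\<lambda>k. t k * joint_limit \<kappa> \<omega> k"] by (simp only: joint_limit_def sum.case)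
      show ?thesis
        unfolding 3 1 2 \<gamma>_def distrib_right sum.distrib ..
    qed
    have \<gamma>2: "(\<Sum>k\<in>UNIV. (\<gamma> k)\<^sup>2) = asy_cov e S (\<lambda>q v. \<Sum>k\<in>UNIV. t k * joint_coef k q v) (\<lambda>q v. \<Sum>k\<in>UNIV. t k * joint_coef k q v)"
    proof -
      let ?f = "\<lambda>k. \<Sum>A\<in>UNIV. t (Inl A) * \<kappa> A k"
      let ?g = "\<lambda>k :: 'k set + ('k set \<times> 'l). case k of Inl _ \<Rightarrow> 0 | Inr j \<Rightarrow> if j \<in> effect_pairs then t (Inr j) else (0::real)"
      have "(\<Sum>k\<in>UNIV. (\<gamma> k)\<^sup>2) = (\<Sum>k\<in>UNIV. ?f k * ?f k) + 2 * (\<Sum>k\<in>UNIV. ?g k * ?f k) + (\<Sum>k\<in>UNIV. (?g k)\<^sup>2)"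
      proof -
        have "(f k + g k)\<^sup>2 = f k * f k + 2 * (g k * f k) + (g k)\<^sup>2"
          for f g :: "'k set + ('k set \<times> 'l) \<Rightarrow> real" and k
          by (simp add: power2_eq_square algebra_simps)
        then have sq: "(\<Sum>k\<in>UNIV. (f k + g k)\<^sup>2) = (\<Sum>k\<in>UNIV. f k * f k) + 2 * (\<Sum>k\<in>UNIV. g k * f k) + (\<Sum>k\<in>UNIV. (g k)\<^sup>2)"
          for f g :: "'k set + ('k set \<times> 'l) \<Rightarrow> real"
          by (simp add: sum.distrib sum_distrib_left)
        show ?thesis unfolding \<gamma>_def by (rule sq)
      qed
      also have "(\<Sum>k\<in>UNIV. ?f k * ?f k) = (\<Sum>A\<in>UNIV. \<Sum>B\<in>UNIV. t (Inl A) * t (Inl B) * asy_cov e S (tau_coef A) (tau_coef B))"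
      proof -
        have "(\<Sum>k\<in>UNIV. ?f k * ?f k) = (\<Sum>k\<in>UNIV. \<Sum>A\<in>UNIV. \<Sum>B\<in>UNIV. t (Inl A) * t (Inl B) * (\<kappa> A k * \<kappa> B k))"
          unfolding sum_product by (simp only: mult_ac)
        also have "\<dots> = (\<Sum>A\<in>UNIV. \<Sum>k\<in>UNIV. \<Sum>B\<in>UNIV. t (Inl A) * t (Inl B) * (\<kappa> A k * \<kappa> B k))"
          by (rule sum.swap)
        also have "\<dots> = (\<Sum>A\<in>UNIV. \<Sum>B\<in>UNIV. \<Sum>k\<in>UNIV. t (Inl A) * t (Inl B) * (\<kappa> A k * \<kappa> B k))"
          by (intro sum.cong refl sum.swap)
        finally show ?thesis unfolding \<kappa>(1) sum_distrib_left .
      qed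
      also have "(\<Sum>k\<in>UNIV. ?g k * ?f k) = (\<Sum>j\<in>effect_pairs. t (Inr j) * (\<Sum>A\<in>UNIV. t (Inl A) * \<beta> A j))"
      proof -
        have "(\<Sum>k\<in>UNIV. ?g k * ?f k) = (\<Sum>j\<in>UNIV. ?g (Inr j) * (\<Sum>A\<in>UNIV. t (Inl A) * \<beta> A j))"
          unfolding sum_UNIV_Plus[of "\<lambda>k. ?g k * ?f k"] \<kappa>(2) by simp
        also have "\<dots> = (\<Sum>j\<in>effect_pairs. ?g (Inr j) * (\<Sum>A\<in>UNIV. t (Inl A) * \<beta> A j))"
          by (rule sum_effect_pairs) simp
        finally show ?thesis by simp
      qed
      also have "(\<Sum>k\<in>UNIV. (?g k)\<^sup>2) = (\<Sum>j\<in>effect_pairs. (t (Inr j))\<^sup>2)"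
      proof -
        have "(\<Sum>k\<in>UNIV. (?g k)\<^sup>2) = (\<Sum>j\<in>UNIV. (?g (Inr j))\<^sup>2)"
          unfolding sum_UNIV_Plus[of "\<lambda>k. (?g k)\<^sup>2"] by simp
        also have "\<dots> = (\<Sum>j\<in>effect_pairs. (?g (Inr j))\<^sup>2)"
          by (rule sum_effect_pairs) simp
        finally show ?thesis by simp
      qed
      finally show ?thesis unfolding asy_cov_joint_coef .
    qed
    show "(\<lambda>n. avg (assignments n (nq n)) (\<lambda>Z. cos ((\<Sum>k\<in>UNIV. t k * joint_stat n Z k) + c)))
      \<longlonglongrightarrow> (\<integral>\<omega>. cos ((\<Sum>k\<in>UNIV. t k * joint_limit \<kappa> \<omega> k) + c) \<partial>gauss UNIV)"
      unfolding lhs rhs gauss_cos \<gamma>2 by (rule finite_population_CLT)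
  qed
qed

lemma truncated_weight:
  fixes k :: "'k set + ('k set \<times> 'l)"
  assumes "k \<in> Inl ` UNIV \<union> Inr ` effect_pairs"
  shows "(\<integral>x. (x k)\<^sup>2 * in_balls (\<lambda>h. Inr ` kidx T h) a {1..H} x \<partial>gauss UNIV)
    = (case k of Inl _ \<Rightarrow> 1 | Inr j \<Rightarrow> v_const (CARD('l) * card (T (tier (fst j)))) (a (tier (fst j))))
      * (\<integral>x. in_balls (\<lambda>h. Inr ` kidx T h) a {1..H} x \<partial>gauss (UNIV :: ('k set + ('k set \<times> 'l)) set))"
proof (cases k)
  case (Inl A)
  have "(\<integral>x. (x (Inl A))\<^sup>2 * in_balls (\<lambda>h. Inr ` kidx T h) a {1..H} x \<partial>gauss (UNIV :: ('k set + ('k set \<times> 'l)) set))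
     = (\<integral>x. in_balls (\<lambda>h. Inr ` kidx T h) a {1..H} x \<partial>gauss (UNIV :: ('k set + ('k set \<times> 'l)) set))"
    by (rule truncated_sq_out) auto
  then show ?thesis unfolding Inl sum.case by (simp only: mult_1)
next
  case (Inr j)
  let ?h = "tier (fst j)"
  have "fst j \<in> effects" using assms Inr by (auto simp: effect_pairs_def)
  then have h: "?h \<in> {1..H}" "j \<in> kidx T ?h" using tier_in[of "fst j"] by (auto simp: kidx_def mem_Times_iff)
  have "card (Inr ` kidx T ?h :: ('k set + ('k set \<times> 'l)) set) = CARD('l) * card (T ?h)"
    by (subst card_image) (auto simp: kidx_def card_cartesian_product)
  moreover have "kidx T h' \<inter> kidx T ?h = ({} :: ('k set \<times> 'l) set)" if "h' \<in> {1..H}" "h' \<noteq> ?h" for h'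
    using tiers_disj[OF that(1) h(1) that(2)] by (auto simp: kidx_def)
  then have "Inr ` kidx T h' \<inter> Inr ` kidx T ?h = ({} :: ('k set + ('k set \<times> 'l)) set)" if "h' \<in> {1..H}" "h' \<noteq> ?h" for h'
    using that by (simp flip: image_Int)
  ultimately show ?thesis
    using truncated_sq_in[of "{1..H}" ?h a "\<lambda>h. Inr ` kidx T h" k] h a_pos[OF h(1)] Inr by simp
qed

lemma sum_effect_pairs_tiers: "(\<Sum>j\<in>effect_pairs. f j) = (\<Sum>h\<in>{1..H}. \<Sum>j\<in>kidx T h. f j :: real)"
  unfolding effect_pairs_eq
proof (rule sum.UNION_disjoint)
  show "\<forall>h\<in>{1..H}. \<forall>h'\<in>{1..H}. h \<noteq> h' \<longrightarrow> kidx T h \<inter> kidx T h' = ({} :: ('k set \<times> 'l) set)"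
    using tiers_disj by (fastforce simp: kidx_def)
qed auto

lemma fst_kidx: "h \<in> {1..H} \<Longrightarrow> j \<in> kidx T h \<Longrightarrow> tier (fst j) = h"
  by (rule tier_eq) (auto simp: kidx_def)

theorem refmt_limit:
  "\<exists>\<mu>0 \<mu>1 :: ('k set \<Rightarrow> real) measure.
     prob_space \<mu>0 \<and> prob_space \<mu>1 \<and> sets \<mu>0 = sets borel \<and> sets \<mu>1 = sets borel \<and>
     weak_conv_to (\<lambda>n. map_pmf (scaled_err n (nq n) (Y n)) (CRFE n (nq n))) \<mu>0 \<and>
     weak_conv_to (\<lambda>n. map_pmf (scaled_err n (nq n) (Y n)) (ReFMT n (nq n) H T a (x n))) \<mu>1 \<and>
     (\<forall>A. integrable \<mu>0 (\<lambda>v. (v A)\<^sup>2) \<and> integrable \<mu>1 (\<lambda>v. (v A)\<^sup>2)) \<and>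
     (\<forall>A B. cov_meas \<mu>0 A B = asy_cov e S (tau_coef A) (tau_coef B)) \<and>
     (\<forall>A B. cov_meas \<mu>0 A B - cov_meas \<mu>1 A B
        = (\<Sum>h\<in>{1..H}. (1 - v_const (CARD('l) * card (T h)) (a h)) * (\<Sum>j\<in>kidx T h. \<beta> A j * \<beta> B j)))"
proof -
  let ?G = "gauss (UNIV :: ('k set + ('k set \<times> 'l)) set)"
  let ?J = "\<lambda>h. Inr ` kidx T h :: ('k set + ('k set \<times> 'l)) set"
  let ?in_balls = "in_balls ?J a {1..H}"
  obtain \<kappa> :: "'k set \<Rightarrow> 'k set + ('k set \<times> 'l) \<Rightarrow> real"
    where "\<forall>A B. asy_cov e S (tau_coef A) (tau_coef B) = (\<Sum>k\<in>UNIV. \<kappa> A k * \<kappa> B k)" "\<forall>A j. \<kappa> A (Inr j) = \<beta> A j"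
    by (rule limit_coefficients) blast
  then have \<kappa>: "\<And>A B. asy_cov e S (tau_coef A) (tau_coef B) = (\<Sum>k\<in>UNIV. \<kappa> A k * \<kappa> B k)" "\<And>A j. \<kappa> A (Inr j) = \<beta> A j"
    by auto
  interpret W: weak_limit ?G "\<lambda>n. assignments n (nq n)" joint_stat "joint_limit \<kappa>"
    by (rule weak_limit_joint_stat[OF \<kappa>])
  define \<tau> where "\<tau> \<omega> A = (\<Sum>k\<in>UNIV. \<kappa> A k * \<omega> k)" for \<omega> A
  define p where "p = (\<integral>\<omega>. ?in_balls \<omega> \<partial>?G)"
  define D where "D = density ?G (\<lambda>\<omega>. ennreal (?in_balls \<omega> / p))"
  define \<mu>0 where "\<mu>0 = distr ?G borel \<tau>"
  define \<mu>1 where "\<mu>1 = distr D borel \<tau>"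
  have \<tau>_joint_limit: "\<tau> \<omega> = (\<lambda>A. joint_limit \<kappa> \<omega> (Inl A))" for \<omega>
    by (intro ext) (simp add: \<tau>_def joint_limit_def)
  have \<tau>_meas: "\<tau> \<in> borel_measurable ?G"
  proof (rule measurable_coordinatewise_then_product)
    show "(\<lambda>\<omega>. \<tau> \<omega> A) \<in> borel_measurable ?G" for A
      unfolding \<tau>_def by (intro borel_measurable_sum borel_measurable_times coord_measurable) auto
  qed
  have \<tau>_meas_D: "\<tau> \<in> borel_measurable D"
    using \<tau>_meas unfolding D_def by simp
  have in_balls_meas: "?in_balls \<in> borel_measurable ?G"
    by (rule in_balls_measurable) auto
  have kne: "kidx T h \<noteq> ({} :: ('k set \<times> 'l) set)" if "h \<in> {1..H}" for h
    using tiers[OF that] by (auto simp: kidx_def)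
  have disj: "?J h \<inter> ?J h' = {}" if "h \<in> {1..H}" "h' \<in> {1..H}" "h \<noteq> h'" for h h'
    using tiers_disj[OF that] by (auto simp: kidx_def)
  have p_pos: "p > 0"
    unfolding p_def using kne a_pos disj by (intro in_balls_integral_pos) auto
  have in_balls_int: "integrable ?G ?in_balls" by (rule integrable_in_balls) simp
  have dens_meas: "(\<lambda>\<omega>. ennreal (?in_balls \<omega> / p)) \<in> borel_measurable ?G"
    using in_balls_meas by simp
  have in_balls_nonneg: "0 \<le> ?in_balls \<omega> / p" for \<omega>
    using p_pos in_balls_bounds(1)[of ?J a "{1..H}" \<omega>] by simp
  have prob_D: "prob_space D"
  proof (rule prob_spaceI)
    have 1: "emeasure D (space D) = (\<integral>\<^sup>+\<omega>. ennreal (?in_balls \<omega> / p) * indicator (space ?G) \<omega> \<partial>?G)"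
      unfolding D_def space_density by (rule emeasure_density[OF dens_meas sets.top])
    have 2: "(\<integral>\<^sup>+\<omega>. ennreal (?in_balls \<omega> / p) * indicator (space ?G) \<omega> \<partial>?G) = (\<integral>\<^sup>+\<omega>. ennreal (?in_balls \<omega> / p) \<partial>?G)"
      by (rule nn_integral_cong) simp
    have 3: "(\<integral>\<^sup>+\<omega>. ennreal (?in_balls \<omega> / p) \<partial>?G) = ennreal (\<integral>\<omega>. ?in_balls \<omega> / p \<partial>?G)"
      by (rule nn_integral_eq_integral) (auto intro: integrable_divide_zero in_balls_int in_balls_nonneg simp del: One_nat_def)
    have 4: "(\<integral>\<omega>. ?in_balls \<omega> / p \<partial>?G) = 1"
      unfolding integral_divide_zero p_def[symmetric] using p_pos by simp
    show "emeasure D (space D) = 1" unfolding 1 2 3 4 by simp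
  qed
  have prob0: "prob_space \<mu>0" unfolding \<mu>0_def by (rule W.prob_space_distr[OF \<tau>_meas])
  have prob1: "prob_space \<mu>1" unfolding \<mu>1_def by (rule prob_space.prob_space_distr[OF prob_D \<tau>_meas_D])
  have int0: "integral\<^sup>L \<mu>0 g = (\<integral>\<omega>. g (\<tau> \<omega>) \<partial>?G)" if "g \<in> borel_measurable borel" for g :: "('k set \<Rightarrow> real) \<Rightarrow> real"
    unfolding \<mu>0_def by (rule integral_distr[OF \<tau>_meas that])
  have int1: "integral\<^sup>L \<mu>1 g = (\<integral>\<omega>. g (\<tau> \<omega>) * ?in_balls \<omega> \<partial>?G) / p" if g: "g \<in> borel_measurable borel" for g :: "('k set \<Rightarrow> real) \<Rightarrow> real"
  proof -
    have 1: "integral\<^sup>L \<mu>1 g = (\<integral>\<omega>. g (\<tau> \<omega>) \<partial>D)"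
      unfolding \<mu>1_def by (rule integral_distr[OF \<tau>_meas_D g])
    have 2: "(\<integral>\<omega>. g (\<tau> \<omega>) \<partial>D) = (\<integral>\<omega>. (?in_balls \<omega> / p) *\<^sub>R g (\<tau> \<omega>) \<partial>?G)"
      unfolding D_def using in_balls_meas
      by (intro integral_density measurable_compose[OF \<tau>_meas g] AE_I2 in_balls_nonneg) simp
    have 3: "(\<lambda>\<omega>. (?in_balls \<omega> / p) *\<^sub>R g (\<tau> \<omega>)) = (\<lambda>\<omega>. g (\<tau> \<omega>) * ?in_balls \<omega> / p)"
      by (simp add: mult.commute)
    show ?thesis unfolding 1 2 3 by (rule integral_divide_zero)
  qed
  have coord: "(\<lambda>v. v A) \<in> borel_measurable (borel :: ('k set \<Rightarrow> real) measure)" for A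
    by (intro borel_measurable_continuous_onI continuous_on_product_coordinates)
  have \<tau>\<tau>_int: "integrable ?G (\<lambda>\<omega>. \<tau> \<omega> A * \<tau> \<omega> B)" for A B
    unfolding \<tau>_def by (rule lin_prod_integrable)
  have sq0: "integrable \<mu>0 (\<lambda>v. (v A)\<^sup>2)" for A
    unfolding \<mu>0_def using \<tau>\<tau>_int[of A A] coord
    by (subst integrable_distr_eq[OF \<tau>_meas]) (auto simp: power2_eq_square intro!: borel_measurable_times)
  have sq1: "integrable \<mu>1 (\<lambda>v. (v A)\<^sup>2)" for A
  proof -
    have "integrable ?G (\<lambda>\<omega>. (1 / p) * (\<tau> \<omega> A * \<tau> \<omega> A * ?in_balls \<omega>))"
      by (intro integrable_mult_right integrable_times_in_balls \<tau>\<tau>_int) auto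
    then have "integrable ?G (\<lambda>\<omega>. (?in_balls \<omega> / p) *\<^sub>R (\<tau> \<omega> A)\<^sup>2)"
      by (simp add: power2_eq_square mult_ac)
    moreover have "(\<lambda>\<omega>. (\<tau> \<omega> A)\<^sup>2) \<in> borel_measurable ?G"
      using measurable_compose[OF \<tau>_meas coord[of A]] by simp
    ultimately have "integrable D (\<lambda>\<omega>. (\<tau> \<omega> A)\<^sup>2)"
      unfolding D_def using in_balls_meas in_balls_nonneg by (subst integrable_density) auto
    then show ?thesis
      unfolding \<mu>1_def using coord[of A] by (subst integrable_distr_eq[OF \<tau>_meas_D]) auto
  qed
  have mean0: "(\<integral>v. v A \<partial>\<mu>0) = 0" for A
    unfolding int0[OF coord] \<tau>_def using truncated_linear_mean[of "{}" "\<kappa> A"] by simp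
  have mean1: "(\<integral>v. v A \<partial>\<mu>1) = 0" for A
    unfolding int1[OF coord] \<tau>_def by (subst truncated_linear_mean) auto
  have cov0: "cov_meas \<mu>0 A B = (\<Sum>k\<in>UNIV. \<kappa> A k * \<kappa> B k)" for A B
  proof -
    have 1: "(\<integral>v. v A * v B \<partial>\<mu>0) = (\<integral>\<omega>. \<tau> \<omega> A * \<tau> \<omega> B \<partial>?G)"
      by (rule int0[OF borel_measurable_times[OF coord coord]])
    have 2: "(\<integral>\<omega>. \<tau> \<omega> A * \<tau> \<omega> B \<partial>?G) = (\<Sum>k\<in>UNIV. \<kappa> A k * \<kappa> B k)"
      unfolding \<tau>_def using truncated_linear_prod[of "{}" "\<kappa> A" "\<kappa> B"] by (simp add: gauss_sq_integrable)
    show ?thesis unfolding cov_meas_def mean0 1 2 by simp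
  qed
  let ?r = "\<lambda>k :: 'k set + ('k set \<times> 'l). case k of Inl _ \<Rightarrow> 1 | Inr j \<Rightarrow> v_const (CARD('l) * card (T (tier (fst j)))) (a (tier (fst j)))"
  have cov1: "cov_meas \<mu>1 A B = (\<Sum>k\<in>UNIV. \<kappa> A k * \<kappa> B k * ?r k)" for A B
  proof -
    have 1: "(\<integral>v. v A * v B \<partial>\<mu>1) = (\<integral>\<omega>. \<tau> \<omega> A * \<tau> \<omega> B * ?in_balls \<omega> \<partial>?G) / p"
      by (rule int1[OF borel_measurable_times[OF coord coord]])
    have 2: "(\<integral>\<omega>. \<tau> \<omega> A * \<tau> \<omega> B * ?in_balls \<omega> \<partial>?G) = (\<Sum>k\<in>UNIV. \<kappa> A k * \<kappa> B k * (\<integral>\<omega>. (\<omega> k)\<^sup>2 * ?in_balls \<omega> \<partial>?G))"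
      unfolding \<tau>_def by (rule truncated_linear_prod) simp
    have 3: "\<kappa> A k * \<kappa> B k * (\<integral>\<omega>. (\<omega> k)\<^sup>2 * ?in_balls \<omega> \<partial>?G) = \<kappa> A k * \<kappa> B k * ?r k * p" for k
    proof (cases "k \<in> Inl ` UNIV \<union> Inr ` effect_pairs")
      case True
      then show ?thesis unfolding truncated_weight[OF True] p_def by (simp only: mult.assoc)
    next
      case False
      then obtain j where "k = Inr j" "j \<notin> effect_pairs" by (cases k) auto
      then show ?thesis by (simp add: \<kappa>(2) \<beta>_out)
    qed
    show ?thesis unfolding cov_meas_def mean1 1 2 3 sum_distrib_right[symmetric] using p_pos by simp
  qed
  have diff: "cov_meas \<mu>0 A B - cov_meas \<mu>1 A B
     = (\<Sum>h\<in>{1..H}. (1 - v_const (CARD('l) * card (T h)) (a h)) * (\<Sum>j\<in>kidx T h. \<beta> A j * \<beta> B j))" for A B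
  proof -
    have "cov_meas \<mu>0 A B - cov_meas \<mu>1 A B = (\<Sum>k\<in>UNIV. \<kappa> A k * \<kappa> B k * (1 - ?r k))"
      unfolding cov0 cov1 sum_subtractf[symmetric] by (simp add: right_diff_distrib)
    also have "\<dots> = (\<Sum>j\<in>UNIV. \<beta> A j * \<beta> B j * (1 - ?r (Inr j)))"
      unfolding sum_UNIV_Plus \<kappa>(2) by simp
    also have "\<dots> = (\<Sum>j\<in>effect_pairs. \<beta> A j * \<beta> B j * (1 - ?r (Inr j)))"
      by (rule sum_effect_pairs) (simp add: \<beta>_out)
    also have "\<dots> = (\<Sum>h\<in>{1..H}. \<Sum>j\<in>kidx T h. \<beta> A j * \<beta> B j * (1 - ?r (Inr j)))"
      by (rule sum_effect_pairs_tiers)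
    also have "\<dots> = (\<Sum>h\<in>{1..H}. \<Sum>j\<in>kidx T h. (1 - v_const (CARD('l) * card (T h)) (a h)) * (\<beta> A j * \<beta> B j))"
      by (intro sum.cong refl) (simp add: fst_kidx mult.commute)
    finally show ?thesis by (simp add: sum_distrib_left)
  qed
  have fin: "finite (assignments n (nq n))" for n by (rule finite_assignments)
  have proj: "continuous_on UNIV (\<lambda>y. g (\<lambda>A. y (Inl A)) :: real)" if "continuous_on UNIV g" for g :: "('k set \<Rightarrow> real) \<Rightarrow> real"
    by (rule continuous_on_compose2[OF that])
       (auto intro!: continuous_on_coordinatewise_then_product continuous_on_product_coordinates)
  have joint_stat_proj: "(\<lambda>A. joint_stat n Z (Inl A)) = scaled_err n (nq n) (Y n) Z" for n Z
    by (intro ext) (rule joint_stat_Inl)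
  have bdd: "\<exists>B. \<forall>v. \<bar>g v\<bar> \<le> B" if "bounded (range g)" for g :: "('k set \<Rightarrow> real) \<Rightarrow> real"
    using that unfolding bounded_iff by auto
  have weak0: "weak_conv_to (\<lambda>n. map_pmf (scaled_err n (nq n) (Y n)) (CRFE n (nq n))) \<mu>0"
    unfolding weak_conv_to_def
  proof (intro allI impI)
    fix g :: "('k set \<Rightarrow> real) \<Rightarrow> real" assume "continuous_on UNIV g \<and> bounded (range g)"
    then obtain B where g: "continuous_on UNIV g" and B: "\<And>v. \<bar>g v\<bar> \<le> B" using bdd by blast
    have "(\<lambda>n. avg (assignments n (nq n)) (\<lambda>Z. g (\<lambda>A. joint_stat n Z (Inl A)))) \<longlonglongrightarrow> (\<integral>\<omega>. g (\<lambda>A. joint_limit \<kappa> \<omega> (Inl A)) \<partial>?G)"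
      by (rule W.levy[OF proj[OF g], of B]) (rule B)
    then have lim: "(\<lambda>n. avg (assignments n (nq n)) (\<lambda>Z. g (scaled_err n (nq n) (Y n) Z))) \<longlonglongrightarrow> integral\<^sup>L \<mu>0 g"
      unfolding joint_stat_proj int0[OF borel_measurable_continuous_onI[OF g]] \<tau>_joint_limit .
    have "\<forall>\<^sub>F n in sequentially. avg (assignments n (nq n)) (\<lambda>Z. g (scaled_err n (nq n) (Y n) Z))
        = measure_pmf.expectation (map_pmf (scaled_err n (nq n) (Y n)) (CRFE n (nq n))) g"
      using W.finite_\<Omega> by eventually_elim (simp add: CRFE_def avg_eq_expectation)
    with lim show "(\<lambda>n. measure_pmf.expectation (map_pmf (scaled_err n (nq n) (Y n)) (CRFE n (nq n))) g) \<longlonglongrightarrow> integral\<^sup>L \<mu>0 g"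
      by (rule Lim_transform_eventually)
  qed
  let ?s = "\<lambda>h y. \<Sum>j\<in>kidx T h. (y (Inr j :: 'k set + ('k set \<times> 'l)))\<^sup>2 :: real"
  let ?ind = "\<lambda>n Z. if \<forall>h\<in>{1..H}. M_stat n (nq n) T (x n) Z h \<le> a h then 1 else 0 :: real"
  have s_joint_limit: "?s h (joint_limit \<kappa> \<omega>) = (\<Sum>k\<in>?J h. (\<omega> k)\<^sup>2)" if h: "h \<in> {1..H}" for h \<omega>
  proof -
    have "j \<in> effect_pairs" if "j \<in> kidx T h" for j using that h by (auto simp: effect_pairs_eq)
    then have "?s h (joint_limit \<kappa> \<omega>) = (\<Sum>j\<in>kidx T h. (\<omega> (Inr j))\<^sup>2)"
      by (intro sum.cong refl) (simp add: joint_limit_def)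
    also have "\<dots> = (\<Sum>k\<in>?J h. (\<omega> k)\<^sup>2)"
      by (subst sum.reindex) auto
    finally show ?thesis .
  qed
  have restricted: "(\<lambda>n. avg (assignments n (nq n)) (\<lambda>Z. g (scaled_err n (nq n) (Y n) Z) * ?ind n Z)) \<longlonglongrightarrow> (\<integral>\<omega>. g (\<tau> \<omega>) * ?in_balls \<omega> \<partial>?G)"
    if g: "continuous_on UNIV g" and B: "\<And>v. \<bar>g v\<bar> \<le> B" for g B
  proof -
    have "(\<lambda>n. avg (assignments n (nq n)) (\<lambda>Z. g (\<lambda>A. joint_stat n Z (Inl A)) * ?ind n Z))
      \<longlonglongrightarrow> (\<integral>\<omega>. g (\<lambda>A. joint_limit \<kappa> \<omega> (Inl A)) * (if \<forall>h\<in>{1..H}. ?s h (joint_limit \<kappa> \<omega>) \<le> a h then 1 else 0) \<partial>?G)"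
    proof (rule W.levy_restricted[OF proj[OF g], of B])
      show "continuous_on UNIV (?s h)" for h
        by (intro continuous_intros continuous_on_product_coordinates)
      show "(\<lambda>n. avg (assignments n (nq n)) (\<lambda>Z. \<bar>M_stat n (nq n) T (x n) Z h - ?s h (joint_stat n Z)\<bar>)) \<longlonglongrightarrow> 0" if "h \<in> {1..H}" for h
        unfolding joint_stat_Inr by (rule M_stat_close[OF that])
      show "AE \<omega> in ?G. ?s h (joint_limit \<kappa> \<omega>) \<noteq> a h" if "h \<in> {1..H}" for h
        unfolding s_joint_limit[OF that] by (rule AE_block_neq) (use kne[OF that] in simp)
    qed (auto intro: B)
    moreover have "(if \<forall>h\<in>{1..H}. ?s h (joint_limit \<kappa> \<omega>) \<le> a h then 1 else 0) = ?in_balls \<omega>" for \<omega>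
      unfolding in_balls_def by (simp add: s_joint_limit)
    ultimately show ?thesis unfolding joint_stat_proj \<tau>_joint_limit by simp
  qed
  have ind_lim: "(\<lambda>n. avg (assignments n (nq n)) (?ind n)) \<longlonglongrightarrow> p"
    using restricted[of "\<lambda>_. 1" 1] by (simp add: p_def)
  then have ind_pos: "\<forall>\<^sub>F n in sequentially. avg (assignments n (nq n)) (?ind n) > 0"
    using p_pos by (rule order_tendstoD)
  have weak1: "weak_conv_to (\<lambda>n. map_pmf (scaled_err n (nq n) (Y n)) (ReFMT n (nq n) H T a (x n))) \<mu>1"
    unfolding weak_conv_to_def
  proof (intro allI impI)
    fix g :: "('k set \<Rightarrow> real) \<Rightarrow> real" assume "continuous_on UNIV g \<and> bounded (range g)"
    then obtain B where g: "continuous_on UNIV g" and B: "\<And>v. \<bar>g v\<bar> \<le> B" using bdd by blast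
    have "(\<lambda>n. avg (assignments n (nq n)) (\<lambda>Z. g (scaled_err n (nq n) (Y n) Z) * ?ind n Z) / avg (assignments n (nq n)) (?ind n))
       \<longlonglongrightarrow> (\<integral>\<omega>. g (\<tau> \<omega>) * ?in_balls \<omega> \<partial>?G) / p"
      using p_pos by (intro tendsto_divide restricted[OF g B] ind_lim) auto
    then have lim: "(\<lambda>n. avg (assignments n (nq n)) (\<lambda>Z. g (scaled_err n (nq n) (Y n) Z) * ?ind n Z) / avg (assignments n (nq n)) (?ind n))
       \<longlonglongrightarrow> integral\<^sup>L \<mu>1 g"
      unfolding int1[OF borel_measurable_continuous_onI[OF g]] .
    have "\<forall>\<^sub>F n in sequentially. avg (assignments n (nq n)) (\<lambda>Z. g (scaled_err n (nq n) (Y n) Z) * ?ind n Z) / avg (assignments n (nq n)) (?ind n)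
        = measure_pmf.expectation (map_pmf (scaled_err n (nq n) (Y n)) (ReFMT n (nq n) H T a (x n))) g"
      using W.finite_\<Omega> ind_pos
    proof eventually_elim
      case (elim n)
      let ?\<Omega> = "assignments n (nq n)"
      let ?S = "{Z \<in> ?\<Omega>. accepted n (nq n) H T a (x n) Z}"
      have sums: "(\<Sum>Z\<in>?\<Omega>. f Z * ?ind n Z) = (\<Sum>Z\<in>?S. f Z)" for f :: "_ \<Rightarrow> real"
      proof -
        have "(\<Sum>Z\<in>?S. f Z) = (\<Sum>Z\<in>?\<Omega>. if accepted n (nq n) H T a (x n) Z then f Z else 0)"
          using fin by (intro sum.inter_filter) auto
        also have "\<dots> = (\<Sum>Z\<in>?\<Omega>. f Z * ?ind n Z)"
          by (intro sum.cong refl) (simp add: accepted_def)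
        finally show ?thesis by simp
      qed
      have card: "(\<Sum>Z\<in>?\<Omega>. ?ind n Z) = real (card ?S)"
        using sums[of "\<lambda>_. 1"] by simp
      have ne: "?S \<noteq> {}"
      proof
        assume e: "?S = {}"
        have "(\<Sum>Z\<in>?\<Omega>. ?ind n Z) = 0" unfolding card e by simp
        then have "avg ?\<Omega> (?ind n) = 0" unfolding avg_def by (simp only: div_0)
        then show False using elim(2) by linarith
      qed
      have "avg ?\<Omega> (\<lambda>Z. g (scaled_err n (nq n) (Y n) Z) * ?ind n Z) / avg ?\<Omega> (?ind n)
          = avg ?S (\<lambda>Z. g (scaled_err n (nq n) (Y n) Z))"
        unfolding avg_def sums card using elim(1) by simp
      also have "\<dots> = measure_pmf.expectation (map_pmf (scaled_err n (nq n) (Y n)) (ReFMT n (nq n) H T a (x n))) g"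
        unfolding ReFMT_def integral_map_pmf by (rule avg_eq_expectation[symmetric]) (use fin ne in auto)
      finally show ?case .
    qed
    with lim show "(\<lambda>n. measure_pmf.expectation (map_pmf (scaled_err n (nq n) (Y n)) (ReFMT n (nq n) H T a (x n))) g) \<longlonglongrightarrow> integral\<^sup>L \<mu>1 g"
      by (rule Lim_transform_eventually)
  qed
  have sets: "sets \<mu>0 = sets borel" "sets \<mu>1 = sets borel" by (simp_all add: \<mu>0_def \<mu>1_def)
  have cov0': "cov_meas \<mu>0 A B = asy_cov e S (tau_coef A) (tau_coef B)" for A B
    unfolding cov0 \<kappa>(1) ..
  show ?thesis
    by (rule exI[of _ \<mu>0], rule exI[of _ \<mu>1])
       (intro conjI allI prob0 prob1 sets weak0 weak1 sq0 sq1 cov0' diff)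
qed

definition reduction :: "'k set \<Rightarrow> 'k set \<Rightarrow> real" where
  "reduction A B = (\<Sum>h\<in>{1..H}. (1 - v_const (CARD('l) * card (T h)) (a h)) * (\<Sum>j\<in>kidx T h. \<beta> A j * \<beta> B j))"

lemma reduction_psd: "psd_on I reduction"
  unfolding psd_on_def
proof
  fix u :: "'k set \<Rightarrow> real"
  let ?r = "\<lambda>h. 1 - v_const (CARD('l) * card (T h)) (a h)"
  have "(\<Sum>A\<in>I. \<Sum>B\<in>I. u A * reduction A B * u B)
      = (\<Sum>A\<in>I. \<Sum>B\<in>I. \<Sum>h\<in>{1..H}. ?r h * (\<Sum>j\<in>kidx T h. (u A * \<beta> A j) * (u B * \<beta> B j)))"
    unfolding reduction_def sum_distrib_left sum_distrib_right by (simp only: mult_ac)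
  also have "\<dots> = (\<Sum>A\<in>I. \<Sum>h\<in>{1..H}. \<Sum>B\<in>I. ?r h * (\<Sum>j\<in>kidx T h. (u A * \<beta> A j) * (u B * \<beta> B j)))"
    by (intro sum.cong refl sum.swap)
  also have "\<dots> = (\<Sum>h\<in>{1..H}. \<Sum>A\<in>I. \<Sum>B\<in>I. ?r h * (\<Sum>j\<in>kidx T h. (u A * \<beta> A j) * (u B * \<beta> B j)))"
    by (rule sum.swap)
  also have "\<dots> = (\<Sum>h\<in>{1..H}. ?r h * (\<Sum>j\<in>kidx T h. (\<Sum>A\<in>I. u A * \<beta> A j)\<^sup>2))"
  proof (rule sum.cong[OF refl])
    fix h
    have "(\<Sum>A\<in>I. \<Sum>B\<in>I. ?r h * (\<Sum>j\<in>kidx T h. (u A * \<beta> A j) * (u B * \<beta> B j)))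
        = ?r h * (\<Sum>A\<in>I. \<Sum>B\<in>I. \<Sum>j\<in>kidx T h. (u A * \<beta> A j) * (u B * \<beta> B j))"
      by (simp only: sum_distrib_left)
    also have "(\<Sum>A\<in>I. \<Sum>B\<in>I. \<Sum>j\<in>kidx T h. (u A * \<beta> A j) * (u B * \<beta> B j))
        = (\<Sum>A\<in>I. \<Sum>j\<in>kidx T h. \<Sum>B\<in>I. (u A * \<beta> A j) * (u B * \<beta> B j))"
      by (intro sum.cong refl sum.swap)
    also have "\<dots> = (\<Sum>j\<in>kidx T h. \<Sum>A\<in>I. \<Sum>B\<in>I. (u A * \<beta> A j) * (u B * \<beta> B j))"
      by (rule sum.swap)
    finally show "(\<Sum>A\<in>I. \<Sum>B\<in>I. ?r h * (\<Sum>j\<in>kidx T h. (u A * \<beta> A j) * (u B * \<beta> B j)))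
        = ?r h * (\<Sum>j\<in>kidx T h. (\<Sum>A\<in>I. u A * \<beta> A j)\<^sup>2)"
      by (simp only: power2_eq_square sum_product)
  qed
  also have "\<dots> \<ge> 0"
  proof (intro sum_nonneg mult_nonneg_nonneg)
    fix h assume h: "h \<in> {1..H}"
    then have "CARD('l) * card (T h) > 0" using tiers[OF h] by (simp add: card_gt_0_iff)
    then show "0 \<le> ?r h" using v_const_le_1[OF _ a_pos[OF h]] by simp
  qed auto
  finally show "0 \<le> (\<Sum>A\<in>I. \<Sum>B\<in>I. u A * reduction A B * u B)" .
qed

lemma reduction_lim:
  assumes A: "A \<in> effects" and B: "B \<in> effects"
  shows "(\<lambda>n. real n * (\<Sum>h\<in>{1..H}. (1 - v_const (CARD('l) * card (T h)) (a h)) * W_par n (nq n) T (Y n) (x n) h A B))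
    \<longlonglongrightarrow> reduction A B"
proof -
  have "(\<lambda>n. \<Sum>h\<in>{1..H}. (1 - v_const (CARD('l) * card (T h)) (a h)) * (real n * W_par n (nq n) T (Y n) (x n) h A B))
    \<longlonglongrightarrow> reduction A B"
    unfolding reduction_def by (intro tendsto_intros W_par_lim A B)
  then show ?thesis by (simp only: sum_distrib_left mult.left_commute)
qed

lemma rho2_lim:
  assumes f: "f \<in> effects" and pos: "asy_cov e S (tau_coef f) (tau_coef f) > 0"
  shows "(\<lambda>n. \<Sum>h\<in>{1..H}. (1 - v_const (CARD('l) * card (T h)) (a h)) * rho2 n (nq n) T (Y n) (x n) h f)
    \<longlonglongrightarrow> reduction f f / asy_cov e S (tau_coef f) (tau_coef f)"
proof -
  let ?W = "\<lambda>n. \<Sum>h\<in>{1..H}. (1 - v_const (CARD('l) * card (T h)) (a h)) * W_par n (nq n) T (Y n) (x n) h f f"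
  have "(\<lambda>n. (real n * ?W n) / (real n * V_tautau n (nq n) (Y n) f f)) \<longlonglongrightarrow> reduction f f / asy_cov e S (tau_coef f) (tau_coef f)"
    using pos by (intro tendsto_divide reduction_lim V_tautau_lim f) auto
  moreover have "\<forall>\<^sub>F n in sequentially. (real n * ?W n) / (real n * V_tautau n (nq n) (Y n) f f)
     = (\<Sum>h\<in>{1..H}. (1 - v_const (CARD('l) * card (T h)) (a h)) * rho2 n (nq n) T (Y n) (x n) h f)"
    using eventually_gt_at_top[of 0]
    by eventually_elim (simp add: rho2_def sum_divide_distrib)
  ultimately show ?thesis by (rule Lim_transform_eventually)
qed

end

theorem theorem8:
  fixes Y :: "nat \<Rightarrow> nat \<Rightarrow> 'k::finite set \<Rightarrow> real"
    and x :: "nat \<Rightarrow> nat \<Rightarrow> 'l::finite \<Rightarrow> real"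
    and nq :: "nat \<Rightarrow> 'k set \<Rightarrow> nat"
    and H :: nat
    and T :: "nat \<Rightarrow> 'k set set"
    and a :: "nat \<Rightarrow> real"
  assumes design: "\<forall>\<^sub>F n in sequentially. (\<forall>q. nq n q \<ge> 1) \<and> (\<Sum>q\<in>UNIV. nq n q) = n"
    and H_pos: "H \<ge> 1"
    and tiers_nonempty: "\<forall>h\<in>{1..H}. T h \<noteq> {} \<and> T h \<subseteq> effects"
    and tiers_disjoint: "\<forall>h\<in>{1..H}. \<forall>h'\<in>{1..H}. h \<noteq> h' \<longrightarrow> T h \<inter> T h' = {}"
    and tiers_cover: "(\<Union>h\<in>{1..H}. T h) = effects"
    and thresholds: "\<forall>h\<in>{1..H}. a h > 0"
    and cond_i: "\<forall>q. \<exists>e>0. (\<lambda>n. real (nq n q) / real n) \<longlonglongrightarrow> e"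
    and cond_ii_Y: "\<forall>q k. convergent (\<lambda>n. S_Y n (Y n) q k)"
    and cond_ii_xx: "\<forall>l l'. convergent (\<lambda>n. S_xx n (x n) l l')"
    and cond_ii_Yx: "\<forall>q l. convergent (\<lambda>n. S_qx n (Y n) (x n) q l)"
    and cond_ii_nonsing: "\<forall>\<^sub>F n in sequentially. invertible (\<chi> l l'. S_xx n (x n) l l')"
    and cond_ii_nonsing_lim: "invertible (\<chi> l l'. lim (\<lambda>n. S_xx n (x n) l l'))"
    and cond_iii_Y: "\<forall>q. (\<lambda>n. Max ((\<lambda>i. (Y n i q - pmean n (\<lambda>j. Y n j q))\<^sup>2) ` {..<n}) / real n)
                         \<longlonglongrightarrow> 0"
    and cond_iii_x: "(\<lambda>n. Max ((\<lambda>i. \<Sum>l\<in>UNIV. (x n i l - pmean n (\<lambda>j. x n j l))\<^sup>2) ` {..<n}) / real n)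
                         \<longlonglongrightarrow> 0"
  shows "\<exists>\<mu>0 \<mu>1 :: ('k set \<Rightarrow> real) measure.
     prob_space \<mu>0 \<and> prob_space \<mu>1 \<and> sets \<mu>0 = sets borel \<and> sets \<mu>1 = sets borel \<and>
     weak_conv_to (\<lambda>n. map_pmf (scaled_err n (nq n) (Y n)) (CRFE n (nq n))) \<mu>0 \<and>
     weak_conv_to (\<lambda>n. map_pmf (scaled_err n (nq n) (Y n)) (ReFMT n (nq n) H T a (x n))) \<mu>1 \<and>
     (\<forall>A. integrable \<mu>0 (\<lambda>v. (v A)\<^sup>2) \<and> integrable \<mu>1 (\<lambda>v. (v A)\<^sup>2)) \<and>
     psd_on effects (\<lambda>A B. cov_meas \<mu>0 A B - cov_meas \<mu>1 A B) \<and>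
     (\<forall>A\<in>effects. \<forall>B\<in>effects.
        (\<lambda>n. real n * (\<Sum>h\<in>{1..H}. (1 - v_const (CARD('l) * card (T h)) (a h))
                                       * W_par n (nq n) T (Y n) (x n) h A B))
        \<longlonglongrightarrow> cov_meas \<mu>0 A B - cov_meas \<mu>1 A B) \<and>
     (\<forall>f\<in>effects. cov_meas \<mu>0 f f > 0 \<longrightarrow>
        (\<lambda>n. \<Sum>h\<in>{1..H}. (1 - v_const (CARD('l) * card (T h)) (a h))
                               * rho2 n (nq n) T (Y n) (x n) h f)
        \<longlonglongrightarrow> 1 - cov_meas \<mu>1 f f / cov_meas \<mu>0 f f)"
proof -
  obtain e where e: "\<forall>q. e q > 0 \<and> (\<lambda>n. real (nq n q) / real n) \<longlonglongrightarrow> e q"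
    using choice[OF cond_i] by blast
  define P where "P n i = case_sum (Y n i) (x n i)" for n i
  define S where "S v v' = lim (\<lambda>n. pcov n (\<lambda>i. P n i v) (\<lambda>i. P n i v'))" for v v'
  define mY where "mY q n = Max ((\<lambda>i. (Y n i q - pmean n (\<lambda>j. Y n j q))\<^sup>2) ` {..<n}) / real n" for q n
  define mx where "mx n = Max ((\<lambda>i. \<Sum>l\<in>UNIV. (x n i l - pmean n (\<lambda>j. x n j l))\<^sup>2) ` {..<n}) / real n" for n
  define m where "m n = (\<Sum>q\<in>UNIV. mY q n) + mx n" for n
  have pcov_commute: "pcov n u v = pcov n v u" for n u v
    by (simp add: pcov_def mult.commute)
  have conv: "convergent (\<lambda>n. pcov n (\<lambda>i. P n i v) (\<lambda>i. P n i v'))" for v v'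
  proof (cases v; cases v')
    fix q l assume "v = Inr l" "v' = Inl q"
    then show ?thesis using cond_ii_Yx by (subst pcov_commute) (simp add: P_def S_qx_def)
  qed (use cond_ii_Y cond_ii_xx cond_ii_Yx in \<open>simp_all add: P_def S_Y_def S_xx_def S_qx_def\<close>)
  have S_lim: "(\<lambda>n. pcov n (\<lambda>i. P n i v) (\<lambda>i. P n i v')) \<longlonglongrightarrow> S v v'" for v v'
    using conv[of v v'] unfolding S_def convergent_LIMSEQ_iff .
  have S_sym: "S v v' = S v' v" for v v'
    unfolding S_def by (subst pcov_commute) (rule refl)
  have Sxx: "S (Inr l) (Inr l') = lim (\<lambda>n. S_xx n (x n) l l')" for l l'
    by (simp add: S_def S_xx_def P_def)
  have Sxx_psd: "psd_on UNIV (\<lambda>l l'. S (Inr l) (Inr l'))"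
    unfolding psd_on_def
  proof
    fix u :: "'l \<Rightarrow> real"
    have lim: "(\<lambda>n. \<Sum>l\<in>UNIV. \<Sum>l'\<in>UNIV. u l * pcov n (\<lambda>i. P n i (Inr l)) (\<lambda>i. P n i (Inr l')) * u l')
      \<longlonglongrightarrow> (\<Sum>l\<in>UNIV. \<Sum>l'\<in>UNIV. u l * S (Inr l) (Inr l') * u l')"
      by (intro tendsto_intros S_lim)
    have "0 \<le> (\<Sum>l\<in>UNIV. \<Sum>l'\<in>UNIV. u l * pcov n (\<lambda>i. P n i (Inr l)) (\<lambda>i. P n i (Inr l')) * u l')" if n: "n \<ge> 2" for n
    proof -
      have "0 \<le> (\<Sum>i<n. (\<Sum>l\<in>UNIV. u l * (x n i l - pmean n (\<lambda>i. x n i l)))\<^sup>2)"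
        by (intro sum_nonneg) auto
      also have "\<dots> = (real n - 1) * (\<Sum>l\<in>UNIV. \<Sum>l'\<in>UNIV. u l * u l' * pcov n (\<lambda>i. x n i l) (\<lambda>i. x n i l'))"
        by (rule sum_sq_lincomb_pcov[OF n])
      finally have "0 \<le> (\<Sum>l\<in>UNIV. \<Sum>l'\<in>UNIV. u l * u l' * pcov n (\<lambda>i. x n i l) (\<lambda>i. x n i l'))"
        using n by (simp add: zero_le_mult_iff)
      then show ?thesis by (simp add: P_def mult_ac)
    qed
    then show "0 \<le> (\<Sum>l\<in>UNIV. \<Sum>l'\<in>UNIV. u l * S (Inr l) (Inr l') * u l')"
      by (intro tendsto_lowerbound[OF lim] eventually_sequentiallyI[of 2]) auto
  qed
  have m_lim: "m \<longlonglongrightarrow> 0"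
  proof -
    have "(\<lambda>n. (\<Sum>q\<in>UNIV. mY q n) + mx n) \<longlonglongrightarrow> (\<Sum>q\<in>(UNIV :: 'k set set). 0) + 0"
      unfolding mY_def mx_def using cond_iii_Y cond_iii_x by (intro tendsto_intros) auto
    then show ?thesis unfolding m_def by simp
  qed
  have m_bound: "\<forall>\<^sub>F n in sequentially. \<forall>i<n. \<forall>v. (P n i v - pmean n (\<lambda>i. P n i v))\<^sup>2 \<le> real n * m n"
    using eventually_gt_at_top[of 0]
  proof eventually_elim
    case (elim n)
    have Ymax: "(Y n i q - pmean n (\<lambda>j. Y n j q))\<^sup>2 \<le> real n * mY q n" if "i < n" for i q
      unfolding mY_def using elim that by simp
    have xmax: "(\<Sum>l\<in>UNIV. (x n i l - pmean n (\<lambda>j. x n j l))\<^sup>2) \<le> real n * mx n" if "i < n" for i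
      unfolding mx_def using elim that by simp
    have Y0: "0 \<le> real n * mY q n" for q using Ymax[OF elim, of q] zero_le_power2 order_trans by blast
    have x0: "0 \<le> real n * mx n" using xmax[OF elim] by (rule order_trans[rotated]) (simp add: sum_nonneg)
    have m_eq: "real n * m n = (\<Sum>q\<in>UNIV. real n * mY q n) + real n * mx n"
      by (simp add: m_def distrib_left sum_distrib_left)
    show ?case
    proof (intro allI impI)
      fix i v assume i: "i < n"
      show "(P n i v - pmean n (\<lambda>i. P n i v))\<^sup>2 \<le> real n * m n"
      proof (cases v)
        case (Inl q)
        have "(Y n i q - pmean n (\<lambda>j. Y n j q))\<^sup>2 \<le> (\<Sum>q\<in>UNIV. real n * mY q n)"
          by (rule order_trans[OF Ymax[OF i]]) (rule member_le_sum, use Y0 in auto)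
        then show ?thesis unfolding m_eq using x0 by (simp add: Inl P_def)
      next
        case (Inr l)
        have "(x n i l - pmean n (\<lambda>j. x n j l))\<^sup>2 \<le> (\<Sum>l\<in>UNIV. (x n i l - pmean n (\<lambda>j. x n j l))\<^sup>2)"
          by (rule member_le_sum) auto
        also have "\<dots> \<le> real n * mx n" by (rule xmax[OF i])
        finally show ?thesis unfolding m_eq using Y0 sum_nonneg[of UNIV "\<lambda>q. real n * mY q n"]
          by (simp add: Inr P_def)
      qed
    qed
  qed
  interpret R: refmt nq P e S m H T a
  proof
    show "u l = 0" if "(\<Sum>l\<in>UNIV. \<Sum>l'\<in>UNIV. u l * S (Inr l) (Inr l') * u l') = 0" for u l
      by (rule psd_invertible_pos_def[OF _ Sxx_psd _ that])
         (simp_all add: S_sym Sxx cond_ii_nonsing_lim)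
  qed (use design e S_lim m_lim m_bound tiers_nonempty tiers_disjoint tiers_cover thresholds S_sym Sxx_psd in auto)
  have PY: "(\<lambda>i q. P n i (Inl q)) = Y n" and Px: "(\<lambda>i l. P n i (Inr l)) = x n" for n
    by (simp_all add: P_def)
  obtain \<mu>0 \<mu>1 :: "('k set \<Rightarrow> real) measure" where
    \<mu>: "prob_space \<mu>0" "prob_space \<mu>1" "sets \<mu>0 = sets borel" "sets \<mu>1 = sets borel"
      "weak_conv_to (\<lambda>n. map_pmf (scaled_err n (nq n) (Y n)) (CRFE n (nq n))) \<mu>0"
      "weak_conv_to (\<lambda>n. map_pmf (scaled_err n (nq n) (Y n)) (ReFMT n (nq n) H T a (x n))) \<mu>1"
      "\<forall>A. integrable \<mu>0 (\<lambda>v. (v A)\<^sup>2) \<and> integrable \<mu>1 (\<lambda>v. (v A)\<^sup>2)"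
    and cov0: "\<forall>A B. cov_meas \<mu>0 A B = asy_cov e S (R.tau_coef A) (R.tau_coef B)"
    and diff: "\<forall>A B. cov_meas \<mu>0 A B - cov_meas \<mu>1 A B = R.reduction A B"
    using R.refmt_limit unfolding PY Px R.reduction_def by blast
  have psd: "psd_on effects (\<lambda>A B. cov_meas \<mu>0 A B - cov_meas \<mu>1 A B)"
    using R.reduction_psd[of effects] by (simp add: diff)
  have red: "\<forall>A\<in>effects. \<forall>B\<in>effects.
        (\<lambda>n. real n * (\<Sum>h\<in>{1..H}. (1 - v_const (CARD('l) * card (T h)) (a h))
                                       * W_par n (nq n) T (Y n) (x n) h A B))
        \<longlonglongrightarrow> cov_meas \<mu>0 A B - cov_meas \<mu>1 A B"
    using R.reduction_lim unfolding PY Px diff[rule_format] by blast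
  have rho: "\<forall>f\<in>effects. cov_meas \<mu>0 f f > 0 \<longrightarrow>
        (\<lambda>n. \<Sum>h\<in>{1..H}. (1 - v_const (CARD('l) * card (T h)) (a h))
                               * rho2 n (nq n) T (Y n) (x n) h f)
        \<longlonglongrightarrow> 1 - cov_meas \<mu>1 f f / cov_meas \<mu>0 f f"
  proof (intro ballI impI)
    fix f :: "'k set" assume f: "f \<in> effects" and pos: "cov_meas \<mu>0 f f > 0"
    have "1 - cov_meas \<mu>1 f f / cov_meas \<mu>0 f f = R.reduction f f / asy_cov e S (R.tau_coef f) (R.tau_coef f)"
      unfolding diff[rule_format, symmetric] cov0[rule_format, symmetric] using pos
      by (simp add: diff_divide_distrib)
    then show "(\<lambda>n. \<Sum>h\<in>{1..H}. (1 - v_const (CARD('l) * card (T h)) (a h)) * rho2 n (nq n) T (Y n) (x n) h f)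
        \<longlonglongrightarrow> 1 - cov_meas \<mu>1 f f / cov_meas \<mu>0 f f"
      using R.rho2_lim[OF f] pos unfolding PY Px cov0[rule_format] by simp
  qed
  show ?thesis
    by (rule exI[of _ \<mu>0], rule exI[of _ \<mu>1]) (intro conjI \<mu> psd red rho)
qed

end
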